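(* Let $E\to B$ be a fibration with fibre $F$, where $B$ has the homotopy type of a connected CW complex. Assume that $E$ as well as $F$ have the homotopy type of compactly generated Hausdorff spaces, and let $X$ be a Hausdorff space. If the map $X\to X^F$ sending a point to the corresponding constant map is a homotopy equivalence, then so is the map $X^B\to X^E$ induced by $E\to B$.
   Context: All spaces are Hausdorff; function spaces carry the compact open topology. A fibration is a Hurewicz fibration. The conclusion and hypothesis concern genuine (not merely weak) homotopy equivalences. *)

theory Defs
  imports "HOL-Analysis.Analysis"
begin

definition homotopy_equivalence_map :: "'a topology \<Rightarrow> 'b topology \<Rightarrow> ('a \<Rightarrow> 'b) \<Rightarrow> bool" where
  "homotopy_equivalence_map X Y f \<longleftrightarrow>
     continuous_map X Y f \<and>
     (\<exists>g. continuous_map Y X g \<and>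
          homotopic_with (\<lambda>_. True) X X (g \<circ> f) id \<and>
          homotopic_with (\<lambda>_. True) Y Y (f \<circ> g) id)"

lemma homotopy_equivalent_space_iff_map:
  "X homotopy_equivalent_space Y \<longleftrightarrow> (\<exists>f. homotopy_equivalence_map X Y f)"
  unfolding homotopy_equivalent_space_def homotopy_equivalence_map_def by blast


subsection \<open>Function spaces\<close>

text \<open>Maps are represented by their extensional representatives, so that a continuous map
  \<open>A \<rightarrow> X\<close> is exactly one point of the function space.\<close>

definition maps :: "'a topology \<Rightarrow> 'b topology \<Rightarrow> ('a \<Rightarrow> 'b) set" where
  "maps A X = {f \<in> extensional (topspace A). continuous_map A X f}"

definition mapping_space :: "'a topology \<Rightarrow> 'b topology \<Rightarrow> ('a \<Rightarrow> 'b) topology" where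
  "mapping_space A X =
     topology_generated_by {{f \<in> maps A X. f ` K \<subseteq> U} | K U. compactin A K \<and> openin X U}"

lemma topspace_mapping_space [simp]: "topspace (mapping_space A X) = maps A X"
proof -
  have "\<exists>K U. compactin A K \<and> openin X U \<and> maps A X = {f \<in> maps A X. f ` K \<subseteq> U}"
    by (rule exI[of _ "{}"], rule exI[of _ "{}"]) auto
  then show ?thesis
    unfolding mapping_space_def topology_generated_by_topspace by blast
qed

definition constant_map :: "'a topology \<Rightarrow> 'b \<Rightarrow> 'a \<Rightarrow> 'b" where
  "constant_map A x = restrict (\<lambda>_. x) (topspace A)"

definition induced_map :: "'a topology \<Rightarrow> ('a \<Rightarrow> 'b) \<Rightarrow> ('b \<Rightarrow> 'c) \<Rightarrow> 'a \<Rightarrow> 'c" where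
  "induced_map A p f = restrict (f \<circ> p) (topspace A)"


subsection \<open>CW complexes\<close>

definition closed_disc :: "nat \<Rightarrow> (nat \<Rightarrow> real) topology" where
  "closed_disc n = subtopology (Euclidean_space n) {x. (\<Sum>i<n. (x i)\<^sup>2) \<le> 1}"

definition disc_interior :: "nat \<Rightarrow> (nat \<Rightarrow> real) set" where
  "disc_interior n = {x \<in> topspace (Euclidean_space n). (\<Sum>i<n. (x i)\<^sup>2) < 1}"

definition disc_boundary :: "nat \<Rightarrow> (nat \<Rightarrow> real) set" where
  "disc_boundary n = {x \<in> topspace (Euclidean_space n). (\<Sum>i<n. (x i)\<^sup>2) = 1}"

text \<open>A CW structure is given by its characteristic maps: a pair \<open>(n, \<phi>)\<close> stands for the
  \<open>n\<close>-cell \<open>\<phi> ` disc_interior n\<close>. Values of \<open>\<phi>\<close> off the disc are irrelevant; since cells are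
  non-empty, disjointness rules out two pairs which describe the same characteristic map.\<close>

definition CW_structure :: "'a topology \<Rightarrow> (nat \<times> ((nat \<Rightarrow> real) \<Rightarrow> 'a)) set \<Rightarrow> bool" where
  "CW_structure K C \<longleftrightarrow>
     (\<forall>(n, \<phi>) \<in> C.
        continuous_map (closed_disc n) K \<phi> \<and>
        homeomorphic_map (subtopology (closed_disc n) (disc_interior n))
                         (subtopology K (\<phi> ` disc_interior n)) \<phi> \<and>
        (\<exists>D \<subseteq> C. finite D \<and> (\<forall>(m, \<psi>) \<in> D. m < n) \<and>
             \<phi> ` disc_boundary n \<subseteq> (\<Union>(m, \<psi>) \<in> D. \<psi> ` disc_interior m))) \<and>
     disjoint_family_on (\<lambda>(n, \<phi>). \<phi> ` disc_interior n) C \<and>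
     topspace K = (\<Union>(n, \<phi>) \<in> C. \<phi> ` disc_interior n) \<and>
     (\<forall>A \<subseteq> topspace K.
        (\<forall>(n, \<phi>) \<in> C. closedin K (A \<inter> \<phi> ` topspace (closed_disc n))) \<longrightarrow> closedin K A)"

definition CW_complex :: "'a topology \<Rightarrow> bool" where
  "CW_complex K \<longleftrightarrow> Hausdorff_space K \<and> (\<exists>C. CW_structure K C)"


subsection \<open>Hurewicz fibrations\<close>

definition homotopy_lifting_property ::
    "'y topology \<Rightarrow> 'e topology \<Rightarrow> 'b topology \<Rightarrow> ('e \<Rightarrow> 'b) \<Rightarrow> bool" where
  "homotopy_lifting_property Y E B p \<longleftrightarrow>
     (\<forall>h f. continuous_map (prod_topology (top_of_set {0..1::real}) Y) B h \<and>
            continuous_map Y E f \<and>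
            (\<forall>y \<in> topspace Y. p (f y) = h (0, y)) \<longrightarrow>
        (\<exists>H. continuous_map (prod_topology (top_of_set {0..1}) Y) E H \<and>
             (\<forall>y \<in> topspace Y. H (0, y) = f y) \<and>
             (\<forall>t \<in> {0..1}. \<forall>y \<in> topspace Y. p (H (t, y)) = h (t, y))))"

text \<open>A definition cannot quantify over all types, so the test spaces \<open>Y\<close> live on one type
  which is large enough to carry the mapping path space of \<open>p\<close>. By
  \<open>Hurewicz_fibration_lifting\<close> below, this gives the homotopy lifting property for all
  spaces on all types.\<close>

definition Hurewicz_fibration :: "'e topology \<Rightarrow> 'b topology \<Rightarrow> ('e \<Rightarrow> 'b) \<Rightarrow> bool" where
  "Hurewicz_fibration E B p \<longleftrightarrow>
     continuous_map E B p \<and>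
     (\<forall>Y :: ('e \<times> (real \<Rightarrow> 'b)) topology.
        Hausdorff_space Y \<longrightarrow> homotopy_lifting_property Y E B p)"

lemma Hausdorff_mapping_space:
  assumes "Hausdorff_space X"
  shows "Hausdorff_space (mapping_space A X)"
  unfolding Hausdorff_space_def
proof (intro allI impI, elim conjE)
  fix f g assume f: "f \<in> topspace (mapping_space A X)" and g: "g \<in> topspace (mapping_space A X)"
    and ne: "f \<noteq> g"
  then obtain a where a: "a \<in> topspace A" "f a \<noteq> g a"
    by (auto simp: maps_def intro: extensionalityI)
  have "f a \<in> topspace X" "g a \<in> topspace X"
    using f g a by (auto simp: maps_def continuous_map_def)
  then obtain U V where UV: "openin X U" "openin X V" "f a \<in> U" "g a \<in> V" "disjnt U V"
    using assms a unfolding Hausdorff_space_def by meson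
  have op: "openin (mapping_space A X) {f \<in> maps A X. f ` {a} \<subseteq> W}" if "openin X W" for W
    unfolding mapping_space_def
    by (rule topology_generated_by_Basis) (use that a in \<open>auto intro!: exI[of _ "{a}"]\<close>)
  show "\<exists>U V. openin (mapping_space A X) U \<and> openin (mapping_space A X) V \<and>
              f \<in> U \<and> g \<in> V \<and> disjnt U V"
    using op[OF UV(1)] op[OF UV(2)] f g UV
    by (intro exI[of _ "{f \<in> maps A X. f ` {a} \<subseteq> U}"] exI[of _ "{f \<in> maps A X. f ` {a} \<subseteq> V}"])
       (auto simp: disjnt_def)
qed

lemma continuous_map_curry:
  assumes h: "continuous_map (prod_topology A Y) X h"
  shows "continuous_map Y (mapping_space A X) (\<lambda>y. \<lambda>a \<in> topspace A. h (a, y))"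
proof -
  let ?k = "\<lambda>y. \<lambda>a \<in> topspace A. h (a, y)"
  have k: "?k y \<in> maps A X" if y: "y \<in> topspace Y" for y
  proof -
    have "continuous_map A X (h \<circ> (\<lambda>a. (a, y)))"
      by (rule continuous_map_compose[OF _ h]) (simp add: continuous_map_pairwise o_def y)
    then have "continuous_map A X (?k y)"
      by (rule continuous_map_eq) auto
    then show ?thesis by (simp add: maps_def)
  qed
  show ?thesis
    unfolding mapping_space_def
  proof (rule continuous_on_generated_topo)
    have "maps A X \<in> {{f \<in> maps A X. f ` K \<subseteq> U} | K U. compactin A K \<and> openin X U}"
      by (rule CollectI, rule exI[of _ "{}"], rule exI[of _ "{}"]) auto
    then show "?k ` topspace Y \<subseteq> \<Union> {{f \<in> maps A X. f ` K \<subseteq> U} | K U. compactin A K \<and> openin X U}"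
      using k by blast
  next
    fix W assume "W \<in> {{f \<in> maps A X. f ` K \<subseteq> U} | K U. compactin A K \<and> openin X U}"
    then obtain K U where W: "W = {f \<in> maps A X. f ` K \<subseteq> U}" and K: "compactin A K"
      and U: "openin X U" by blast
    have KA: "K \<subseteq> topspace A" using K by (simp add: compactin_def)
    let ?V = "{z \<in> topspace (prod_topology A Y). h z \<in> U}"
    have V: "openin (prod_topology A Y) ?V"
      using h U by (rule openin_continuous_map_preimage)
    show "openin Y (?k -` W \<inter> topspace Y)"
    proof (subst openin_subopen, intro ballI)
      fix y assume "y \<in> ?k -` W \<inter> topspace Y"
      then have y: "y \<in> topspace Y" and "?k y ` K \<subseteq> U" by (auto simp: W)
      then have "K \<times> {y} \<subseteq> ?V" using KA by (auto simp: image_subset_iff)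
      then obtain P Q where PQ: "openin A P" "openin Y Q" "K \<subseteq> P" "{y} \<subseteq> Q" "P \<times> Q \<subseteq> ?V"
        by (rule Wallace_theorem_prod_topology[OF K _ V, rotated]) (use y in auto)
      have "Q \<subseteq> ?k -` W \<inter> topspace Y"
      proof
        fix z assume z: "z \<in> Q"
        then have zY: "z \<in> topspace Y" using PQ(2) openin_subset by blast
        have "?k z ` K \<subseteq> U" using PQ z KA by (auto simp: image_subset_iff)
        then show "z \<in> ?k -` W \<inter> topspace Y" using zY k by (simp add: W)
      qed
      then show "\<exists>T. openin Y T \<and> y \<in> T \<and> T \<subseteq> ?k -` W \<inter> topspace Y"
        using PQ by blast
    qed
  qed
qed

lemma continuous_map_eval_interval:
  fixes X :: "'b topology"
  defines "I \<equiv> top_of_set {0..1::real}"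
  shows "continuous_map (prod_topology I (mapping_space I X)) X (\<lambda>(t, \<gamma>). \<gamma> t)"
  unfolding continuous_map
proof (intro conjI allI impI)
  show "(\<lambda>(t, \<gamma>). \<gamma> t) ` topspace (prod_topology I (mapping_space I X)) \<subseteq> topspace X"
    by (auto simp: maps_def continuous_map_def)
next
  fix U assume U: "openin X U"
  let ?P = "prod_topology I (mapping_space I X)"
  show "openin ?P {z \<in> topspace ?P. (\<lambda>(t, \<gamma>). \<gamma> t) z \<in> U}"
  proof (subst openin_subopen, intro ballI)
    fix z assume "z \<in> {z \<in> topspace ?P. (\<lambda>(t, \<gamma>). \<gamma> t) z \<in> U}"
    then obtain t \<gamma> where z: "z = (t, \<gamma>)" and t: "t \<in> {0..1}" and \<gamma>: "\<gamma> \<in> maps I X"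
      and tU: "\<gamma> t \<in> U" by (auto simp: I_def)
    have "openin I {s \<in> topspace I. \<gamma> s \<in> U}"
      using \<gamma> U by (auto simp: maps_def intro: openin_continuous_map_preimage)
    moreover have "t \<in> {s \<in> topspace I. \<gamma> s \<in> U}"
      using t tU by (simp add: I_def)
    ultimately obtain e where e: "e > 0" "cball t e \<inter> {0..1} \<subseteq> {s \<in> topspace I. \<gamma> s \<in> U}"
      unfolding I_def openin_contains_cball by blast
    let ?K = "cball t e \<inter> {0..1}"
    have "compactin I ?K"
      by (simp add: I_def compactin_subtopology compact_Int)
    then have 1: "openin (mapping_space I X) {f \<in> maps I X. f ` ?K \<subseteq> U}"
      unfolding mapping_space_def using U by (intro topology_generated_by_Basis) blast
    have 2: "openin I ({0..1} \<inter> ball t e)"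
      by (simp add: I_def openin_open_Int)
    have "openin ?P (({0..1} \<inter> ball t e) \<times> {f \<in> maps I X. f ` ?K \<subseteq> U})"
      using 1 2 by (simp add: openin_prod_Times_iff)
    moreover have "\<gamma> ` ?K \<subseteq> U"
      using e(2) by blast
    then have "z \<in> ({0..1} \<inter> ball t e) \<times> {f \<in> maps I X. f ` ?K \<subseteq> U}"
      using z t \<gamma> e(1) by simp
    moreover have "({0..1} \<inter> ball t e) \<times> {f \<in> maps I X. f ` ?K \<subseteq> U}
        \<subseteq> {z \<in> topspace ?P. (\<lambda>(t, \<gamma>). \<gamma> t) z \<in> U}"
      by (auto simp: I_def image_subset_iff)
    ultimately show "\<exists>T. openin ?P T \<and> z \<in> T \<and> T \<subseteq> {z \<in> topspace ?P. (\<lambda>(t, \<gamma>). \<gamma> t) z \<in> U}"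
      by blast
  qed
qed

lemma Hurewicz_fibration_lifting:
  fixes E :: "'e topology" and B :: "'b topology" and Y :: "'y topology"
  assumes p: "Hurewicz_fibration E B p" and E: "Hausdorff_space E" and B: "Hausdorff_space B"
  shows "homotopy_lifting_property Y E B p"
  unfolding homotopy_lifting_property_def
proof (intro allI impI, elim conjE)
  fix h f
  assume h: "continuous_map (prod_topology (top_of_set {0..1::real}) Y) B h"
    and f: "continuous_map Y E f" and hf: "\<forall>y \<in> topspace Y. p (f y) = h (0, y)"
  define I where "I = top_of_set {0..1::real}"
  define M where "M = prod_topology E (mapping_space I B)"
  define P where "P = subtopology M {(e, \<gamma>). p e = \<gamma> 0}"
  have "Hausdorff_space P"
    unfolding P_def M_def
    by (intro Hausdorff_space_subtopology)
       (simp add: Hausdorff_space_prod_topology E Hausdorff_mapping_space[OF B])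
  then have hlp: "homotopy_lifting_property P E B p"
    using p by (simp add: Hurewicz_fibration_def)
  have fstP: "continuous_map P E fst"
    unfolding P_def M_def by (simp add: continuous_map_from_subtopology continuous_map_fst)
  have sndP: "continuous_map P (mapping_space I B) snd"
    unfolding P_def M_def by (simp add: continuous_map_from_subtopology continuous_map_snd)
  have "continuous_map (prod_topology I P) (prod_topology I (mapping_space I B)) (\<lambda>(t, z). (t, snd z))"
    unfolding continuous_map_prod_top using sndP by simp
  from continuous_map_compose[OF this continuous_map_eval_interval[of B, folded I_def]]
  have ev: "continuous_map (prod_topology I P) B (\<lambda>(t, z). snd z t)"
    by (simp add: o_def case_prod_unfold)
  have start: "\<forall>z \<in> topspace P. p (fst z) = (\<lambda>(t, z). snd z t) (0, z)"
    by (auto simp: P_def)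
  obtain H where H: "continuous_map (prod_topology I P) E H"
    and H0: "\<forall>z \<in> topspace P. H (0, z) = fst z"
    and Hp: "\<forall>t \<in> {0..1}. \<forall>z \<in> topspace P. p (H (t, z)) = snd z t"
    using hlp[unfolded homotopy_lifting_property_def, rule_format, of "\<lambda>(t, z). snd z t" fst]
      ev fstP start unfolding I_def by auto
  define k where "k = (\<lambda>y. (f y, \<lambda>t \<in> topspace I. h (t, y)))"
  have kM: "continuous_map Y M k"
    unfolding k_def M_def continuous_map_pairwise
    using f continuous_map_curry[OF h[folded I_def]] by (simp add: o_def)
  have k: "continuous_map Y P k"
    unfolding P_def continuous_map_in_subtopology
    using kM hf by (auto simp: k_def I_def)
  have kP: "k y \<in> topspace P" if "y \<in> topspace Y" for y
    using k that by (auto simp: continuous_map_def)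
  have "continuous_map (prod_topology I Y) (prod_topology I P) (\<lambda>(t, y). (t, k y))"
    unfolding continuous_map_prod_top using k by simp
  from continuous_map_compose[OF this H]
  have 1: "continuous_map (prod_topology I Y) E (\<lambda>(t, y). H (t, k y))"
    by (simp add: o_def case_prod_unfold)
  show "\<exists>H. continuous_map (prod_topology (top_of_set {0..1}) Y) E H \<and>
             (\<forall>y \<in> topspace Y. H (0, y) = f y) \<and>
             (\<forall>t \<in> {0..1}. \<forall>y \<in> topspace Y. p (H (t, y)) = h (t, y))"
    using 1 H0 Hp kP
    by (intro exI[of _ "\<lambda>(t, y). H (t, k y)"]) (auto simp: I_def k_def)
qed

end

theory Submission
  imports Defs
begin

text \<open>Given a base map \<open>f : A \<rightarrow> B\<close> and a family \<open>u\<close> of maps \<open>E \<rightarrow> X\<close> parametrised by a space \<open>Y\<close>,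
  consider families \<open>g\<close> of maps \<open>A \<rightarrow> X\<close> together with a homotopy \<open>h\<close>, on the pullback of \<open>E\<close> to \<open>A\<close>,
  from \<open>g\<close> to \<open>u\<close>. Over a constant map such pairs form a contractible space, because
  \<open>X \<rightarrow> X\<^sup>F\<close> is a homotopy equivalence; together with path lifting this extends every pair given over
  the boundary of a disc to the whole disc. Hence pairs can be constructed cell by cell over a CW
  complex, and relative to the two ends over its product with an interval. For \<open>Y = X\<^sup>E\<close> the first gives a
  right homotopy inverse of \<open>X\<^sup>B \<rightarrow> X\<^sup>E\<close>; for \<open>Y = X\<^sup>B\<close> the second shows that it is also a left
  inverse. The space \<open>Y\<close> need not be compactly generated, so continuity on \<open>Y \<times> T\<close> is only asked on
  \<open>Y \<times> C\<close> for compact \<open>C \<subseteq> T\<close>, which is what maps from \<open>Y\<close> to the function space of the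
  k-ification of \<open>T\<close> amount to.\<close>

subsection \<open>Families of maps continuous on compact subsets\<close>

text \<open>Treating one map E -> X at a time would only compare the spaces weakly; carrying the
  whole function space along as the parameter \<open>Y\<close> makes every choice continuous and
  yields genuine homotopies. Three obstacles shape the details. Solutions over neighbouring cells
  are glued, so boundary values must be kept strictly, although in a Hurewicz fibration the lift of
  a constant path may move; the transports used for the extension are therefore reparametrised by a
  length that vanishes on the boundary. The two homotopies that come with a homotopy inverse of X ->
  X^F need not fit together, so contracting the pairs over a constant map leaves a loop behind,
  which is undone explicitly. Finally, pasting over compact sets only gives maps into X^(kT), with
  kT the k-ification of T; the hypotheses on E and F supply a map T -> kT homotopic to the identity,
  which bridges the gap, whereas a CW complex is its own k-ification.\<close>

abbreviation unit_interval :: "real topology" ("\<I>") where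
  "\<I> \<equiv> top_of_set {0..1}"

lemma continuous_map_compose_Pair:
  assumes "continuous_map (prod_topology A B) X h" "continuous_map Z A f" "continuous_map Z B g"
  shows "continuous_map Z X (\<lambda>z. h (f z, g z))"
  using continuous_map_compose[OF _ assms(1), of Z "\<lambda>z. (f z, g z)"] assms(2,3)
  by (simp add: continuous_map_pairwise o_def)

lemma continuous_map_into_top_of_set:
  "continuous_map Z (top_of_set S) f \<longleftrightarrow> continuous_map Z euclidean f \<and> f \<in> topspace Z \<rightarrow> S"
  by (auto simp: continuous_map_in_subtopology)

lemma continuous_map_finite_closed_cover:
  assumes "finite \<A>" "\<And>S. S \<in> \<A> \<Longrightarrow> closedin T S" "topspace T \<subseteq> \<Union>\<A>"
    and "\<And>S. S \<in> \<A> \<Longrightarrow> continuous_map (subtopology T S) X h"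
  shows "continuous_map T X h"
  by (rule pasting_lemma_closed[where I = \<A> and T = id and f = "\<lambda>_. h"]) (use assms in auto)

lemma continuous_map_finite_closed_cover_right:
  assumes "finite \<A>" "\<And>S. S \<in> \<A> \<Longrightarrow> closedin T S" "topspace T \<subseteq> \<Union>\<A>"
    and "\<And>S. S \<in> \<A> \<Longrightarrow> continuous_map (prod_topology Y (subtopology T S)) X h"
  shows "continuous_map (prod_topology Y T) X h"
proof (rule continuous_map_finite_closed_cover[where \<A> = "(\<times>) (topspace Y) ` \<A>"])
  show "closedin (prod_topology Y T) S" if "S \<in> (\<times>) (topspace Y) ` \<A>" for S
    using that assms(2) by (auto simp: closedin_prod_Times_iff)
  show "continuous_map (subtopology (prod_topology Y T) S) X h" if S: "S \<in> (\<times>) (topspace Y) ` \<A>" for S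
    using S assms(4) by (auto simp: subtopology_Times)
  show "topspace (prod_topology Y T) \<subseteq> \<Union> ((\<times>) (topspace Y) ` \<A>)"
    using assms(3) by auto
qed (use assms(1) in simp)

definition kcontinuous :: "'y topology \<Rightarrow> 't topology \<Rightarrow> 'x topology \<Rightarrow> ('y \<times> 't \<Rightarrow> 'x) \<Rightarrow> bool" where
  "kcontinuous Y T X h \<longleftrightarrow>
     (\<forall>C. compactin T C \<longrightarrow> continuous_map (prod_topology Y (subtopology T C)) X h)"

lemma kcontinuousD:
  "kcontinuous Y T X h \<Longrightarrow> compactin T C \<Longrightarrow> continuous_map (prod_topology Y (subtopology T C)) X h"
  by (simp add: kcontinuous_def)

lemma kcontinuous_compact:
  assumes "compact_space T"
  shows "kcontinuous Y T X h \<longleftrightarrow> continuous_map (prod_topology Y T) X h"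
proof
  assume "kcontinuous Y T X h"
  then show "continuous_map (prod_topology Y T) X h"
    using assms kcontinuousD[of Y T X h "topspace T"] by (simp add: compact_space_def)
next
  assume "continuous_map (prod_topology Y T) X h"
  then show "kcontinuous Y T X h"
    unfolding kcontinuous_def by (simp add: prod_topology_subtopology continuous_map_from_subtopology)
qed

lemma kcontinuous_cong:
  assumes "kcontinuous Y T X h" "\<And>y t. y \<in> topspace Y \<Longrightarrow> t \<in> topspace T \<Longrightarrow> h (y, t) = k (y, t)"
  shows "kcontinuous Y T X k"
  unfolding kcontinuous_def
proof (intro allI impI)
  fix C assume "compactin T C"
  then show "continuous_map (prod_topology Y (subtopology T C)) X k"
    by (intro continuous_map_eq[OF kcontinuousD[OF assms(1)]]) (auto simp: assms(2))
qed

text \<open>Here \<open>q\<close> depends on the second variable alone, so a compact set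
  \<open>C\<close> has a compact image, over which \<open>h\<close> is jointly continuous; the
  parameter may move with both variables.\<close>

lemma kcontinuous_compose:
  assumes h: "kcontinuous Y T X h"
    and r: "continuous_map (prod_topology Y' T') Y r" and q: "continuous_map T' T q"
  shows "kcontinuous Y' T' X (\<lambda>(y, t). h (r (y, t), q t))"
  unfolding kcontinuous_def
proof (intro allI impI)
  fix C assume C: "compactin T' C"
  have "continuous_map (subtopology T' C) (subtopology T (q ` C)) q"
    using q by (auto simp: continuous_map_in_subtopology continuous_map_from_subtopology)
  then have "continuous_map (prod_topology Y' (subtopology T' C)) (subtopology T (q ` C)) (\<lambda>z. q (snd z))"
    using continuous_map_compose[OF continuous_map_snd] by (fastforce simp: o_def)
  moreover have "continuous_map (prod_topology Y' (subtopology T' C)) Y r"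
    using r by (simp add: prod_topology_subtopology continuous_map_from_subtopology)
  ultimately have "continuous_map (prod_topology Y' (subtopology T' C)) X (\<lambda>z. h (r z, q (snd z)))"
    by (intro continuous_map_compose_Pair[OF kcontinuousD[OF h image_compactin[OF C q]]])
  then show "continuous_map (prod_topology Y' (subtopology T' C)) X (\<lambda>(y, t). h (r (y, t), q t))"
    by (simp add: case_prod_unfold)
qed

lemma kcontinuous_compose_right:
  assumes h: "kcontinuous Y T X h" and q: "continuous_map T' T q"
  shows "kcontinuous Y T' X (\<lambda>(y, t). h (y, q t))"
  using kcontinuous_compose[OF h continuous_map_fst q] by simp

lemma kcontinuous_compose_left:
  assumes h: "kcontinuous Y T X h" and q: "continuous_map Y' Y q"
  shows "kcontinuous Y' T X (\<lambda>(y, t). h (q y, t))"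
  using kcontinuous_compose[OF h continuous_map_compose[OF continuous_map_fst q] continuous_map_id]
  by (simp add: o_def)

lemma kcontinuous_subtopology:
  "kcontinuous Y T X h \<Longrightarrow> kcontinuous Y (subtopology T S) X h"
  using kcontinuous_compose_right[OF _ continuous_map_id_subt, of Y T X h S] by simp

text \<open>If the second argument is to depend on the parameter as well, its values must stay in a
  compact set. Letting it do so only through a compact space \<open>P\<close> ensures this:
  \<open>q\<close> maps the product of \<open>P\<close> with a compact set to a compact set. In this
  way time intervals and compact bases migrate from the space of points to the space of
  parameters.\<close>

lemma kcontinuous_compact_param:
  assumes h: "kcontinuous Y T X h" and P: "compact_space P"
    and r: "continuous_map Y' Y r" and \<pi>: "continuous_map Y' P \<pi>"
    and q: "continuous_map (prod_topology P T') T q"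
  shows "kcontinuous Y' T' X (\<lambda>(y, t). h (r y, q (\<pi> y, t)))"
  unfolding kcontinuous_def
proof (intro allI impI)
  fix C assume C: "compactin T' C"
  let ?D = "q ` (topspace P \<times> C)"
  have PC: "compactin (prod_topology P T') (topspace P \<times> C)"
    using P C by (simp add: compactin_Times compact_space_def)
  have D: "compactin T ?D"
    using image_compactin[OF PC q] .
  have q': "continuous_map (prod_topology P (subtopology T' C)) T q"
    using q by (simp add: prod_topology_subtopology continuous_map_from_subtopology)
  have "continuous_map (prod_topology Y' (subtopology T' C)) T (\<lambda>z. q (\<pi> (fst z), snd z))"
    using continuous_map_compose[OF continuous_map_fst \<pi>]
    by (intro continuous_map_compose_Pair[OF q']) (auto simp: o_def continuous_map_snd)
  moreover have "(\<lambda>z. q (\<pi> (fst z), snd z)) \<in> topspace (prod_topology Y' (subtopology T' C)) \<rightarrow> ?D"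
    using \<pi> by (auto simp: continuous_map_def)
  ultimately have 1: "continuous_map (prod_topology Y' (subtopology T' C)) (subtopology T ?D)
      (\<lambda>z. q (\<pi> (fst z), snd z))"
    by (simp add: continuous_map_in_subtopology image_subset_iff_funcset)
  have 2: "continuous_map (prod_topology Y' (subtopology T' C)) Y (\<lambda>z. r (fst z))"
    using continuous_map_compose[OF continuous_map_fst r] by (auto simp: o_def)
  show "continuous_map (prod_topology Y' (subtopology T' C)) X (\<lambda>(y, t). h (r y, q (\<pi> y, t)))"
    using continuous_map_compose_Pair[OF kcontinuousD[OF h D] 2 1] by (simp add: case_prod_unfold)
qed

lemma kcontinuous_closed_cover:
  assumes "closedin T S1" "closedin T S2" "topspace T \<subseteq> S1 \<union> S2"
    and "kcontinuous Y (subtopology T S1) X h" "kcontinuous Y (subtopology T S2) X h"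
  shows "kcontinuous Y T X h"
  unfolding kcontinuous_def
proof (intro allI impI)
  fix C assume C: "compactin T C"
  have CT: "C \<subseteq> topspace T" using C by (rule compactin_subset_topspace)
  show "continuous_map (prod_topology Y (subtopology T C)) X h"
  proof (rule continuous_map_finite_closed_cover_right[where \<A> = "{C \<inter> S1, C \<inter> S2}"])
    show "topspace (subtopology T C) \<subseteq> \<Union> {C \<inter> S1, C \<inter> S2}"
      using assms(3) by auto
    fix S assume S: "S \<in> {C \<inter> S1, C \<inter> S2}"
    then show "closedin (subtopology T C) S"
      using assms(1,2) by (auto simp: closedin_subtopology_Int_closed)
    have *: "continuous_map (prod_topology Y (subtopology (subtopology T C) (C \<inter> S'))) X h"
      if "kcontinuous Y (subtopology T S') X h" "closedin T S'" for S'
    proof -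
      have "compactin (subtopology T S') (S' \<inter> C)"
        using closed_Int_compactin[OF that(2) C] by (simp add: compactin_subtopology)
      from kcontinuousD[OF that(1) this] show ?thesis
        by (simp add: subtopology_subtopology Int_ac)
    qed
    show "continuous_map (prod_topology Y (subtopology (subtopology T C) S)) X h"
      using S * assms by blast
  qed simp
qed

lemma kcontinuous_cases_le:
  assumes pq: "continuous_map T euclideanreal p" "continuous_map T euclideanreal q"
    and h: "kcontinuous Y (subtopology T {t. p t \<le> q t}) X h"
    and k: "kcontinuous Y (subtopology T {t. q t \<le> p t}) X k"
    and eq: "\<And>y t. y \<in> topspace Y \<Longrightarrow> t \<in> topspace T \<Longrightarrow> p t = q t \<Longrightarrow> h (y, t) = k (y, t)"
  shows "kcontinuous Y T X (\<lambda>(y, t). if p t \<le> q t then h (y, t) else k (y, t))"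
proof (rule kcontinuous_closed_cover)
  let ?S1 = "{t \<in> topspace T. p t \<le> q t}" and ?S2 = "{t \<in> topspace T. q t \<le> p t}"
  let ?h = "\<lambda>(y, t). if p t \<le> q t then h (y, t) else k (y, t)"
  have cl: "closedin T {t \<in> topspace T. f t \<le> g t}"
    if "continuous_map T euclideanreal f" "continuous_map T euclideanreal g" for f g
  proof -
    have "closedin T {t \<in> topspace T. g t - f t \<in> {0..}}"
      by (rule closedin_continuous_map_preimage[where Y = euclideanreal])
         (use that in \<open>auto intro: continuous_map_diff\<close>)
    then show ?thesis by simp
  qed
  show "closedin T ?S1" "closedin T ?S2" using cl pq by blast+
  show "topspace T \<subseteq> ?S1 \<union> ?S2" by auto
  have e1: "subtopology T ?S1 = subtopology T {t. p t \<le> q t}"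
    and e2: "subtopology T ?S2 = subtopology T {t. q t \<le> p t}"
    using subtopology_restrict[of T "{t. p t \<le> q t}"] subtopology_restrict[of T "{t. q t \<le> p t}"]
    by (simp_all add: Int_def)
  show "kcontinuous Y (subtopology T ?S1) X ?h"
    unfolding e1 using h by (rule kcontinuous_cong) auto
  show "kcontinuous Y (subtopology T ?S2) X ?h"
    unfolding e2 using k by (rule kcontinuous_cong) (use eq in auto)
qed

section \<open>K-ification and the exponential law\<close>

lemma kcontinuous_kification: "kcontinuous Y (kification T) X h \<longleftrightarrow> kcontinuous Y T X h"
  by (auto simp: kcontinuous_def subtopology_kification_compact)

lemma kcontinuous_imp_continuous_kification:
  assumes h: "kcontinuous Y T X h" and y: "y \<in> topspace Y"
  shows "continuous_map (kification T) X (\<lambda>t. h (y, t))"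
proof (rule continuous_map_from_k_space)
  fix C assume "compactin (kification T) C"
  then have "continuous_map (prod_topology Y (subtopology (kification T) C)) X h"
    using h kcontinuous_kification kcontinuousD by metis
  from continuous_map_compose_Pair[OF this, of _ "\<lambda>_. y" "\<lambda>t. t"]
  show "continuous_map (subtopology (kification T) C) X (\<lambda>t. h (y, t))"
    using y by simp
qed simp

text \<open>A subbasic open set of the compact open topology refers to one compact \<open>K\<close>,
  so its preimage can be computed after restriction to \<open>K\<close>, where the family is jointly
  continuous and \<open>continuous_map_curry\<close> applies. Continuity of each single map on all
  of \<open>T\<close> does not follow from \<open>kcontinuous\<close> and is therefore assumed in
  \<open>cont\<close>; over the k-ification it is automatic.\<close>

lemma continuous_map_into_mapping_space:
  assumes h: "kcontinuous Y T X h"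
    and cont: "\<And>y. y \<in> topspace Y \<Longrightarrow> continuous_map T X (\<lambda>t. h (y, t))"
  shows "continuous_map Y (mapping_space T X) (\<lambda>y. \<lambda>t \<in> topspace T. h (y, t))"
proof -
  let ?k = "\<lambda>y. \<lambda>t \<in> topspace T. h (y, t)"
  have k: "?k y \<in> maps T X" if y: "y \<in> topspace Y" for y
    using cont[OF y] by (auto simp: maps_def intro: continuous_map_eq)
  show ?thesis
    unfolding mapping_space_def
  proof (rule continuous_on_generated_topo)
    have "maps T X \<in> {{f \<in> maps T X. f ` K \<subseteq> U} | K U. compactin T K \<and> openin X U}"
      by (rule CollectI, rule exI[of _ "{}"], rule exI[of _ "{}"]) auto
    then show "?k ` topspace Y \<subseteq> \<Union> {{f \<in> maps T X. f ` K \<subseteq> U} | K U. compactin T K \<and> openin X U}"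
      using k by blast
  next
    fix W assume "W \<in> {{f \<in> maps T X. f ` K \<subseteq> U} | K U. compactin T K \<and> openin X U}"
    then obtain K U where W: "W = {f \<in> maps T X. f ` K \<subseteq> U}" and K: "compactin T K"
      and U: "openin X U" by blast
    have KT: "K \<subseteq> topspace T" using K by (simp add: compactin_def)
    have cK: "continuous_map (prod_topology Y (subtopology T K)) X h"
      using kcontinuousD[OF h K] .
    have "compact_space (subtopology T K)"
      using K compact_space_subtopology by blast
    then have "continuous_map Y (mapping_space (subtopology T K) X)
        (\<lambda>y. \<lambda>t \<in> topspace (subtopology T K). h (y, t))"
      using continuous_map_curry[of "subtopology T K" Y X "\<lambda>(t, y). h (y, t)"] cK
        continuous_map_compose_Pair[OF cK continuous_map_snd continuous_map_fst]
      by (simp add: case_prod_unfold)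
    moreover have "openin (mapping_space (subtopology T K) X) {f \<in> maps (subtopology T K) X. f ` K \<subseteq> U}"
      unfolding mapping_space_def using K U
      by (intro topology_generated_by_Basis) (auto simp: compactin_subtopology)
    ultimately have "openin Y {y \<in> topspace Y. (\<lambda>t \<in> topspace (subtopology T K). h (y, t))
          \<in> {f \<in> maps (subtopology T K) X. f ` K \<subseteq> U}}"
      by (rule openin_continuous_map_preimage)
    moreover have "(\<lambda>t \<in> topspace (subtopology T K). h (y, t)) \<in> maps (subtopology T K) X"
      if y: "y \<in> topspace Y" for y
      using cont[OF y] by (auto simp: maps_def intro: continuous_map_eq continuous_map_from_subtopology)
    moreover have "?k y ` K = (\<lambda>t \<in> topspace (subtopology T K). h (y, t)) ` K" for y
      using KT by (auto simp: image_iff)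
    ultimately have "openin Y {y \<in> topspace Y. ?k y ` K \<subseteq> U}"
      by (simp cong: conj_cong)
    moreover have "?k -` W \<inter> topspace Y = {y \<in> topspace Y. ?k y ` K \<subseteq> U}"
      using k by (auto simp: W)
    ultimately show "openin Y (?k -` W \<inter> topspace Y)" by simp
  qed
qed

lemma continuous_map_into_mapping_space_kification:
  assumes "kcontinuous Y T X h"
  shows "continuous_map Y (mapping_space (kification T) X) (\<lambda>y. \<lambda>t \<in> topspace T. h (y, t))"
  using continuous_map_into_mapping_space[of Y "kification T" X h]
    kcontinuous_imp_continuous_kification[OF assms] assms kcontinuous_kification by fastforce

text \<open>A compact subset of a Hausdorff space is regular: inside any open set each point has a
  closed, hence compact, neighbourhood \<open>D\<close>, and \<open>D\<close> defines a subbasic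
  open set of maps.\<close>

lemma kcontinuous_eval:
  assumes T: "Hausdorff_space T"
  shows "kcontinuous (mapping_space T X) T X (\<lambda>(f, t). f t)"
  unfolding kcontinuous_def
proof (intro allI impI)
  fix C assume C: "compactin T C"
  let ?T = "subtopology T C"
  let ?P = "prod_topology (mapping_space T X) ?T"
  have reg: "neighbourhood_base_of (closedin ?T) ?T"
    using compact_Hausdorff_imp_regular_space[OF compact_space_subtopology[OF C]
        Hausdorff_space_subtopology[OF T]] by (simp add: neighbourhood_base_of_closedin)
  show "continuous_map ?P X (\<lambda>(f, t). f t)"
    unfolding continuous_map
  proof (intro conjI allI impI)
    show "(\<lambda>(f, t). f t) ` topspace ?P \<subseteq> topspace X"
      by (auto simp: maps_def continuous_map_def)
  next
    fix U assume U: "openin X U"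
    show "openin ?P {z \<in> topspace ?P. (\<lambda>(f, t). f t) z \<in> U}"
    proof (subst openin_subopen, intro ballI)
      fix z assume "z \<in> {z \<in> topspace ?P. (\<lambda>(f, t). f t) z \<in> U}"
      then obtain f t where z: "z = (f, t)" and f: "f \<in> maps T X" and t: "t \<in> C" "t \<in> topspace T"
        and ft: "f t \<in> U" by auto
      have "openin ?T {s \<in> topspace ?T. f s \<in> U}"
        using f U by (intro openin_continuous_map_preimage[where Y = X])
          (auto simp: maps_def continuous_map_from_subtopology)
      then obtain V D where V: "openin ?T V" "closedin ?T D" "t \<in> V" "V \<subseteq> D"
        "D \<subseteq> {s \<in> topspace ?T. f s \<in> U}"
        using reg[unfolded neighbourhood_base_of, rule_format, of "{s \<in> topspace ?T. f s \<in> U}" t] t ft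
        by auto
      have D: "compactin T D"
        using V(2) C by (metis closedin_compact_space compact_space_subtopology compactin_subtopology)
      have "openin (mapping_space T X) {k \<in> maps T X. k ` D \<subseteq> U}"
        unfolding mapping_space_def using D U by (intro topology_generated_by_Basis) blast
      then have "openin ?P ({k \<in> maps T X. k ` D \<subseteq> U} \<times> V)"
        using V(1) by (simp add: openin_prod_Times_iff)
      moreover have "z \<in> {k \<in> maps T X. k ` D \<subseteq> U} \<times> V"
        using z f V by auto
      moreover have "{k \<in> maps T X. k ` D \<subseteq> U} \<times> V \<subseteq> {z \<in> topspace ?P. (\<lambda>(f, t). f t) z \<in> U}"
        using V by (auto dest: openin_subset)
      ultimately show "\<exists>W. openin ?P W \<and> z \<in> W \<and> W \<subseteq> {z \<in> topspace ?P. (\<lambda>(f, t). f t) z \<in> U}"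
        by blast
    qed
  qed
qed

lemma Hausdorff_space_kification: "Hausdorff_space T \<Longrightarrow> Hausdorff_space (kification T)"
  unfolding Hausdorff_space_def using openin_kification_finer by (metis topspace_kification)

lemma kcontinuous_from_mapping_space:
  assumes "Hausdorff_space T" "continuous_map Y (mapping_space T X) k"
  shows "kcontinuous Y T X (\<lambda>(y, t). k y t)"
  using kcontinuous_compose_left[OF kcontinuous_eval[OF assms(1)] assms(2)] by simp

lemma kcontinuous_from_mapping_space_kification:
  assumes "Hausdorff_space T" "continuous_map Y (mapping_space (kification T) X) k"
  shows "kcontinuous Y T X (\<lambda>(y, t). k y t)"
  using kcontinuous_from_mapping_space[OF Hausdorff_space_kification[OF assms(1)] assms(2)]
  by (simp add: kcontinuous_kification)

subsection \<open>Comparing homotopy inverses\<close>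

lemmas continuous_map_real_intros =
  continuous_map_add continuous_map_diff continuous_map_minus continuous_map_real_mult
  continuous_map_real_max continuous_map_real_min continuous_map_real_abs
  continuous_map_const[THEN iffD2, OF disjI2]

lemma continuous_map_compose_homotopy:
  assumes "continuous_map (prod_topology (top_of_set S) W) X h"
    and "continuous_map Q euclideanreal t" "\<And>z. z \<in> topspace Q \<Longrightarrow> t z \<in> S"
    and "continuous_map Q W w"
  shows "continuous_map Q X (\<lambda>z. h (t z, w z))"
  by (rule continuous_map_compose_Pair[OF assms(1) _ assms(4)])
     (use assms(2,3) in \<open>auto simp: continuous_map_into_top_of_set\<close>)

text \<open>A pair \<open>(g w, \<eta> (-, w))\<close> is a point of the homotopy fibre of
  \<open>f\<close> over \<open>v w\<close>. As \<open>f\<close> is a homotopy equivalence, this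
  fibre is contractible; the locale constructs a contraction onto
  \<open>(G (v w), H (-, v w))\<close> that is continuous in \<open>w\<close>. Nothing relates
  \<open>L\<close> to \<open>H\<close>, so the obvious deformation moves the endpoint
  \<open>v w\<close> around a loop and has to be corrected.\<close>

locale partial_inverse_homotopy =
  fixes X :: "'x topology" and Z :: "'z topology" and W :: "'w topology"
    and f :: "'x \<Rightarrow> 'z" and G :: "'z \<Rightarrow> 'x" and H :: "real \<times> 'z \<Rightarrow> 'z" and L :: "real \<times> 'x \<Rightarrow> 'x"
    and g :: "'w \<Rightarrow> 'x" and v :: "'w \<Rightarrow> 'z" and \<eta> :: "real \<times> 'w \<Rightarrow> 'z"
  assumes f: "continuous_map X Z f" and G: "continuous_map Z X G"
    and H: "continuous_map (prod_topology \<I> Z) Z H"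
    and H0: "\<And>z. z \<in> topspace Z \<Longrightarrow> H (0, z) = f (G z)"
    and H1: "\<And>z. z \<in> topspace Z \<Longrightarrow> H (1, z) = z"
    and L: "continuous_map (prod_topology \<I> X) X L"
    and L0: "\<And>x. x \<in> topspace X \<Longrightarrow> L (0, x) = G (f x)"
    and L1: "\<And>x. x \<in> topspace X \<Longrightarrow> L (1, x) = x"
    and g: "continuous_map W X g" and v: "continuous_map W Z v"
    and \<eta>: "continuous_map (prod_topology \<I> W) Z \<eta>"
    and \<eta>0: "\<And>w. w \<in> topspace W \<Longrightarrow> \<eta> (0, w) = f (g w)"
    and \<eta>1: "\<And>w. w \<in> topspace W \<Longrightarrow> \<eta> (1, w) = v w"
begin

lemma gW: "w \<in> topspace W \<Longrightarrow> g w \<in> topspace X"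
  and vW: "w \<in> topspace W \<Longrightarrow> v w \<in> topspace Z"
  using g v by (auto simp: continuous_map_def)

text \<open>A path in \<open>X\<close> from \<open>g w\<close> to \<open>G (v w)\<close>:
  \<open>L\<close> run backwards to \<open>G (f (g w))\<close>, then the image of \<eta> under
  \<open>G\<close>.\<close>

definition "\<gamma> = (\<lambda>(x, w). if x \<le> 1/2 then L (1 - 2 * x, g w) else G (\<eta> (2 * x - 1, w)))"

lemma continuous_\<gamma>:
  assumes t: "continuous_map Q euclideanreal t" "\<And>z. z \<in> topspace Q \<Longrightarrow> t z \<in> {0..1}"
    and w: "continuous_map Q W w"
  shows "continuous_map Q X (\<lambda>z. \<gamma> (t z, w z))"
proof -
  have "continuous_map Q X (\<lambda>z. if t z \<le> 1/2 then L (1 - 2 * t z, g (w z)) else G (\<eta> (2 * t z - 1, w z)))"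
  proof (rule continuous_map_cases_le)
    show "continuous_map (subtopology Q {x \<in> topspace Q. t x \<le> 1/2}) X (\<lambda>z. L (1 - 2 * t z, g (w z)))"
      by (rule continuous_map_compose_homotopy[OF L])
         (use t w in \<open>auto intro!: continuous_map_real_intros continuous_map_from_subtopology
           continuous_map_compose[OF w g, unfolded o_def]\<close>)
    have "continuous_map (subtopology Q {x \<in> topspace Q. 1/2 \<le> t x}) Z (\<lambda>z. \<eta> (2 * t z - 1, w z))"
      by (rule continuous_map_compose_homotopy[OF \<eta>])
         (use t w in \<open>auto intro!: continuous_map_real_intros continuous_map_from_subtopology\<close>)
    from continuous_map_compose[OF this G]
    show "continuous_map (subtopology Q {x \<in> topspace Q. 1/2 \<le> t x}) X (\<lambda>z. G (\<eta> (2 * t z - 1, w z)))"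
      by (simp add: o_def)
    fix z assume z: "z \<in> topspace Q" "t z = 1/2"
    then have "w z \<in> topspace W" using w by (auto simp: continuous_map_def)
    then show "L (1 - 2 * t z, g (w z)) = G (\<eta> (2 * t z - 1, w z))"
      by (simp add: z(2) L0 gW \<eta>0)
  qed (use t in \<open>auto intro!: continuous_map_real_intros\<close>)
  then show ?thesis by (simp add: \<gamma>_def)
qed

lemma \<gamma>_0: "w \<in> topspace W \<Longrightarrow> \<gamma> (0, w) = g w"
  and \<gamma>_1: "w \<in> topspace W \<Longrightarrow> \<gamma> (1, w) = G (v w)"
  by (simp_all add: \<gamma>_def L1 gW \<eta>1)

text \<open>The three prescribed sides of the square (\<open>\<eta>\<close> reversed, \<open>f \<circ> \<gamma>\<close>, \<open>H\<close>) form one path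
  parametrised by \<open>[-1, 2]\<close>; \<open>t * (1 + 2 * s) - s\<close> is affine in \<open>t\<close> with values \<open>- s\<close> and \<open>1 + s\<close>
  at the ends.\<close>

definition "square = (\<lambda>(t, s, w). let x = t * (1 + 2 * s) - s in
   if x \<le> 0 then \<eta> (- x, w) else if x \<le> 1 then f (\<gamma> (x, w)) else H (x - 1, v w))"

lemma square_bounds:
  fixes t s :: real
  assumes "t \<in> {0..1}" "s \<in> {0..1}"
  shows "-1 \<le> t * (1 + 2 * s) - s" "t * (1 + 2 * s) - s \<le> 2"
proof -
  have "0 \<le> t * (1 + 2 * s)" using assms by simp
  moreover have "s \<le> 1" using assms by simp
  ultimately show "-1 \<le> t * (1 + 2 * s) - s" by linarith
  have "t * (1 + 2 * s) \<le> 1 + 2 * s" using mult_right_mono[of t 1 "1 + 2 * s"] assms by auto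
  with \<open>s \<le> 1\<close> show "t * (1 + 2 * s) - s \<le> 2" by linarith
qed

lemma continuous_square:
  assumes t: "continuous_map Q euclideanreal t" "\<And>z. z \<in> topspace Q \<Longrightarrow> t z \<in> {0..1}"
    and s: "continuous_map Q euclideanreal s" "\<And>z. z \<in> topspace Q \<Longrightarrow> s z \<in> {0..1}"
    and w: "continuous_map Q W w"
  shows "continuous_map Q Z (\<lambda>z. square (t z, s z, w z))"
proof -
  define x where "x = (\<lambda>z. t z * (1 + 2 * s z) - s z)"
  have x: "continuous_map Q euclideanreal x"
    unfolding x_def by (intro continuous_map_real_intros t s) auto
  have xb: "-1 \<le> x z" "x z \<le> 2" if "z \<in> topspace Q" for z
    unfolding x_def using square_bounds[OF t(2) s(2)] that by auto
  have wW: "w z \<in> topspace W" if "z \<in> topspace Q" for z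
    using w that by (auto simp: continuous_map_def)
  have "continuous_map Q Z (\<lambda>z. if x z \<le> 0 then \<eta> (- x z, w z)
      else if x z \<le> 1 then f (\<gamma> (x z, w z)) else H (x z - 1, v (w z)))"
  proof (rule continuous_map_cases_le)
    show "continuous_map (subtopology Q {z \<in> topspace Q. x z \<le> 0}) Z (\<lambda>z. \<eta> (- x z, w z))"
      by (rule continuous_map_compose_homotopy[OF \<eta>])
         (use x w xb in \<open>auto intro!: continuous_map_real_intros continuous_map_from_subtopology simp: minus_le_iff\<close>)
    let ?Q = "subtopology Q {z \<in> topspace Q. 0 \<le> x z}"
    show "continuous_map ?Q Z (\<lambda>z. if x z \<le> 1 then f (\<gamma> (x z, w z)) else H (x z - 1, v (w z)))"
    proof (rule continuous_map_cases_le)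
      have "continuous_map (subtopology ?Q {z \<in> topspace ?Q. x z \<le> 1}) X (\<lambda>z. \<gamma> (x z, w z))"
        by (rule continuous_\<gamma>) (use x w xb in \<open>auto intro!: continuous_map_from_subtopology\<close>)
      from continuous_map_compose[OF this f]
      show "continuous_map (subtopology ?Q {z \<in> topspace ?Q. x z \<le> 1}) Z (\<lambda>z. f (\<gamma> (x z, w z)))"
        by (simp add: o_def)
      show "continuous_map (subtopology ?Q {z \<in> topspace ?Q. 1 \<le> x z}) Z (\<lambda>z. H (x z - 1, v (w z)))"
        by (rule continuous_map_compose_homotopy[OF H])
           (use x w xb in \<open>auto intro!: continuous_map_real_intros continuous_map_from_subtopology
              continuous_map_compose[OF w v, unfolded o_def]\<close>)
      show "f (\<gamma> (x z, w z)) = H (x z - 1, v (w z))" if "z \<in> topspace ?Q" "x z = 1" for z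
        using that wW by (simp add: \<gamma>_1 H0 vW)
    qed (use x in \<open>auto intro!: continuous_map_real_intros continuous_map_from_subtopology\<close>)
    show "\<eta> (- x z, w z) = (if x z \<le> 1 then f (\<gamma> (x z, w z)) else H (x z - 1, v (w z)))"
      if "z \<in> topspace Q" "x z = 0" for z
      using that wW by (simp add: \<gamma>_0 \<eta>0)
  qed (use x in \<open>auto intro!: continuous_map_real_intros\<close>)
  then show ?thesis by (simp add: square_def Let_def x_def cong: if_cong)
qed

lemma square_left: "w \<in> topspace W \<Longrightarrow> 0 \<le> s \<Longrightarrow> square (0, s, w) = \<eta> (s, w)"
  and square_right: "w \<in> topspace W \<Longrightarrow> 0 \<le> s \<Longrightarrow> square (1, s, w) = H (s, v w)"
  and square_bottom: "w \<in> topspace W \<Longrightarrow> t \<in> {0..1} \<Longrightarrow> square (t, 0, w) = f (\<gamma> (t, w))"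
  by (auto simp: square_def Let_def \<gamma>_0 \<gamma>_1 \<eta>0 H0 vW)

text \<open>A loop at \<open>v w\<close>. Up to homotopy it is \<eta> backwards, then the image of
  \<open>L\<close> backwards under \<open>f\<close> followed by \<open>H\<close> at
  \<open>f (g w)\<close>, then \<eta>: it records the mismatch between \<open>L\<close> and
  \<open>H\<close>.\<close>

definition "\<alpha> = (\<lambda>(t, w). square (t, 1, w))"

lemma continuous_\<alpha>:
  assumes t: "continuous_map Q euclideanreal t" "\<And>z. z \<in> topspace Q \<Longrightarrow> t z \<in> {0..1}"
    and w: "continuous_map Q W w"
  shows "continuous_map Q Z (\<lambda>z. \<alpha> (t z, w z))"
  using continuous_square[OF t _ _ w, of "\<lambda>_. 1"] by (simp add: \<alpha>_def)

lemma \<alpha>_0: "w \<in> topspace W \<Longrightarrow> \<alpha> (0, w) = v w"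
  and \<alpha>_1: "w \<in> topspace W \<Longrightarrow> \<alpha> (1, w) = v w"
  by (simp_all add: \<alpha>_def square_left square_right \<eta>1 H1 vW)

lemma \<alpha>_in: 
  assumes "w \<in> topspace W" "t \<in> {0..1}"
  shows "\<alpha> (t, w) \<in> topspace Z"
  using continuous_\<alpha>[of W "\<lambda>_. t" "\<lambda>w. w"] assms by (auto simp: continuous_map_def)

text \<open>The top side of the square is only a loop \<open>\<alpha>\<close>. Going back along \<open>(G \<circ> \<alpha>, H \<circ> \<alpha>)\<close> traverses it
  in the opposite direction, so the total deformation of the endpoint is contracted by appending
  initial pieces of \<open>\<alpha>\<close>.\<close>

definition "g' = (\<lambda>(t, w). if t \<le> 1/2 then \<gamma> (2 * t, w) else G (\<alpha> (2 - 2 * t, w)))"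

text \<open>The deformation before its top edge is repaired: the first half moves through the
  square, the second half uses \<open>H\<close> as the homotopy and moves its endpoint back along
  the loop.\<close>

definition "base = (\<lambda>(t, s, w). if t \<le> 1/2 then square (2 * t, s, w) else H (s, \<alpha> (2 - 2 * t, w)))"

text \<open>At time \<open>t\<close> the top edge of \<open>base\<close> has arrived at \<alpha> of
  \<open>m\<close>. An extra stretch of length \<open>m\<close> runs \<alpha> back to its start
  \<open>v w\<close>, so the endpoint stays fixed. As \<open>m\<close> is 0 at \<open>t = 0\<close>
  and at \<open>t = 1\<close>, the homotopies at both ends are strictly those of
  \<open>base\<close>.\<close>

definition "h' = (\<lambda>(t, s, w). let m = min (2 * t) (2 - 2 * t) in
   if s * (1 + m) \<le> 1 then base (t, s * (1 + m), w) else \<alpha> (m + 1 - s * (1 + m), w))"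

lemma continuous_g': "continuous_map (prod_topology \<I> W) X g'"
proof -
  let ?Q = "prod_topology \<I> W"
  have t: "continuous_map ?Q euclideanreal fst"
    using continuous_map_fst[of \<I> W] by (simp add: continuous_map_into_top_of_set)
  have "continuous_map ?Q X (\<lambda>z. if fst z \<le> 1/2 then \<gamma> (2 * fst z, snd z) else G (\<alpha> (2 - 2 * fst z, snd z)))"
  proof (rule continuous_map_cases_le)
    show "continuous_map (subtopology ?Q {z \<in> topspace ?Q. fst z \<le> 1/2}) X (\<lambda>z. \<gamma> (2 * fst z, snd z))"
      by (rule continuous_\<gamma>)
         (use t in \<open>auto intro!: continuous_map_real_intros continuous_map_from_subtopology continuous_map_snd\<close>)
    have "continuous_map (subtopology ?Q {z \<in> topspace ?Q. 1/2 \<le> fst z}) Z (\<lambda>z. \<alpha> (2 - 2 * fst z, snd z))"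
      by (rule continuous_\<alpha>)
         (use t in \<open>auto intro!: continuous_map_real_intros continuous_map_from_subtopology continuous_map_snd\<close>)
    from continuous_map_compose[OF this G]
    show "continuous_map (subtopology ?Q {z \<in> topspace ?Q. 1/2 \<le> fst z}) X (\<lambda>z. G (\<alpha> (2 - 2 * fst z, snd z)))"
      by (simp add: o_def)
    show "\<gamma> (2 * fst z, snd z) = G (\<alpha> (2 - 2 * fst z, snd z))" if "z \<in> topspace ?Q" "fst z = 1/2" for z
      using that(1) by (auto simp: that(2) \<gamma>_1 \<alpha>_1)
  qed (use t in \<open>auto intro!: continuous_map_real_intros\<close>)
  then show ?thesis by (simp add: g'_def case_prod_unfold)
qed

lemma continuous_base:
  assumes t: "continuous_map Q euclideanreal t" "\<And>z. z \<in> topspace Q \<Longrightarrow> t z \<in> {0..1}"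
    and s: "continuous_map Q euclideanreal s" "\<And>z. z \<in> topspace Q \<Longrightarrow> s z \<in> {0..1}"
    and w: "continuous_map Q W w"
  shows "continuous_map Q Z (\<lambda>z. base (t z, s z, w z))"
proof -
  have "continuous_map Q Z (\<lambda>z. if t z \<le> 1/2 then square (2 * t z, s z, w z) else H (s z, \<alpha> (2 - 2 * t z, w z)))"
  proof (rule continuous_map_cases_le)
    show "continuous_map (subtopology Q {z \<in> topspace Q. t z \<le> 1/2}) Z (\<lambda>z. square (2 * t z, s z, w z))"
      by (rule continuous_square)
         (use t s w in \<open>auto intro!: continuous_map_real_intros continuous_map_from_subtopology\<close>)
    have "continuous_map (subtopology Q {z \<in> topspace Q. 1/2 \<le> t z}) Z (\<lambda>z. \<alpha> (2 - 2 * t z, w z))"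
      by (rule continuous_\<alpha>)
         (use t w in \<open>auto intro!: continuous_map_real_intros continuous_map_from_subtopology\<close>)
    then show "continuous_map (subtopology Q {z \<in> topspace Q. 1/2 \<le> t z}) Z (\<lambda>z. H (s z, \<alpha> (2 - 2 * t z, w z)))"
      by (intro continuous_map_compose_homotopy[OF H]) (use s in \<open>auto intro!: continuous_map_from_subtopology\<close>)
    show "square (2 * t z, s z, w z) = H (s z, \<alpha> (2 - 2 * t z, w z))" if "z \<in> topspace Q" "t z = 1/2" for z
    proof -
      have "w z \<in> topspace W" using w that by (auto simp: continuous_map_def)
      then show ?thesis using that(1) s(2)[of z] by (simp add: that(2) square_right \<alpha>_1)
    qed
  qed (use t in \<open>auto intro!: continuous_map_real_intros\<close>)
  then show ?thesis by (simp add: base_def)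
qed

lemma base_top:
  assumes "w \<in> topspace W" "t \<in> {0..1}"
  shows "base (t, 1, w) = \<alpha> (min (2 * t) (2 - 2 * t), w)"
  using assms H1[OF \<alpha>_in[of w "2 - 2 * t"]] by (auto simp: base_def \<alpha>_def min_def)

lemma continuous_h': "continuous_map (prod_topology \<I> (prod_topology \<I> W)) Z h'"
proof -
  let ?Q = "prod_topology \<I> (prod_topology \<I> W)"
  define t where "t = (fst :: real \<times> real \<times> 'w \<Rightarrow> real)"
  define s where "s = (\<lambda>z :: real \<times> real \<times> 'w. fst (snd z))"
  define w where "w = (\<lambda>z :: real \<times> real \<times> 'w. snd (snd z))"
  define m where "m = (\<lambda>z. min (2 * t z) (2 - 2 * t z))"
  have cs: "continuous_map ?Q \<I> s"
    unfolding s_def using continuous_map_compose[OF continuous_map_snd continuous_map_fst] by (fastforce simp: o_def)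
  have t: "continuous_map ?Q euclideanreal t" and s: "continuous_map ?Q euclideanreal s"
    using cs continuous_map_fst[of \<I> "prod_topology \<I> W"] by (simp_all add: t_def continuous_map_into_top_of_set)
  have w: "continuous_map ?Q W w"
    unfolding w_def using continuous_map_compose[OF continuous_map_snd continuous_map_snd] by (fastforce simp: o_def)
  have b: "t z \<in> {0..1}" "s z \<in> {0..1}" "w z \<in> topspace W" if "z \<in> topspace ?Q" for z
    using that by (auto simp: t_def s_def w_def)
  have m: "continuous_map ?Q euclideanreal m"
    unfolding m_def by (intro continuous_map_real_intros t) auto
  have mb: "0 \<le> m z" "m z \<le> 1" if "z \<in> topspace ?Q" for z
    using b[OF that] by (auto simp: m_def min_def)
  define \<sigma> where "\<sigma> = (\<lambda>z. s z * (1 + m z))"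
  have \<sigma>: "continuous_map ?Q euclideanreal \<sigma>"
    unfolding \<sigma>_def by (intro continuous_map_real_intros s m) auto
  have \<sigma>b: "0 \<le> \<sigma> z" "\<sigma> z \<le> 1 + m z" if "z \<in> topspace ?Q" for z
    using b[OF that] mb[OF that] mult_right_mono[of "s z" 1 "1 + m z"] by (auto simp: \<sigma>_def)
  have "continuous_map ?Q Z (\<lambda>z. if \<sigma> z \<le> 1 then base (t z, \<sigma> z, w z) else \<alpha> (m z + 1 - \<sigma> z, w z))"
  proof (rule continuous_map_cases_le)
    show "continuous_map (subtopology ?Q {z \<in> topspace ?Q. \<sigma> z \<le> 1}) Z (\<lambda>z. base (t z, \<sigma> z, w z))"
      by (rule continuous_base)
         (use t \<sigma> w b \<sigma>b in \<open>auto intro!: continuous_map_from_subtopology simp del: topspace_prod_topology\<close>)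
    show "continuous_map (subtopology ?Q {z \<in> topspace ?Q. 1 \<le> \<sigma> z}) Z (\<lambda>z. \<alpha> (m z + 1 - \<sigma> z, w z))"
      by (rule continuous_\<alpha>)
         (use m \<sigma> w mb \<sigma>b in \<open>fastforce intro!: continuous_map_from_subtopology continuous_map_real_intros
            simp del: topspace_prod_topology\<close>)+
    show "base (t z, \<sigma> z, w z) = \<alpha> (m z + 1 - \<sigma> z, w z)" if "z \<in> topspace ?Q" "\<sigma> z = 1" for z
      using that b[OF that(1)] by (simp add: base_top m_def)
  qed (use \<sigma> in \<open>auto intro!: continuous_map_real_intros\<close>)
  then show ?thesis
    by (simp add: h'_def case_prod_unfold Let_def \<sigma>_def s_def t_def w_def m_def cong: if_cong)
qed

text \<open>The values at both ends of the deformation hold on the nose, as gluing over a disc will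
  require.\<close>

lemma deformation:
  obtains g' h' where
    "continuous_map (prod_topology \<I> W) X g'"
    "continuous_map (prod_topology \<I> (prod_topology \<I> W)) Z h'"
    "\<And>w. w \<in> topspace W \<Longrightarrow> g' (0, w) = g w"
    "\<And>w. w \<in> topspace W \<Longrightarrow> g' (1, w) = G (v w)"
    "\<And>t w. t \<in> {0..1} \<Longrightarrow> w \<in> topspace W \<Longrightarrow> h' (t, 0, w) = f (g' (t, w))"
    "\<And>t w. t \<in> {0..1} \<Longrightarrow> w \<in> topspace W \<Longrightarrow> h' (t, 1, w) = v w"
    "\<And>s w. s \<in> {0..1} \<Longrightarrow> w \<in> topspace W \<Longrightarrow> h' (0, s, w) = \<eta> (s, w)"
    "\<And>s w. s \<in> {0..1} \<Longrightarrow> w \<in> topspace W \<Longrightarrow> h' (1, s, w) = H (s, v w)"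
proof (rule that[of g' h'])
  fix t w assume t: "t \<in> {0..1::real}" and w: "w \<in> topspace W"
  show "h' (t, 0, w) = f (g' (t, w))"
    using t w H0[OF \<alpha>_in[of w "2 - 2 * t"]]
    by (auto simp: h'_def g'_def base_def square_bottom)
  show "h' (t, 1, w) = v w"
    using t w base_top[OF w t] \<alpha>_0[OF w] by (auto simp: h'_def Let_def min_def split: if_splits)
next
  fix s w assume s: "s \<in> {0..1::real}" and w: "w \<in> topspace W"
  show "h' (0, s, w) = \<eta> (s, w)" "h' (1, s, w) = H (s, v w)"
    using s w by (auto simp: h'_def base_def square_left \<alpha>_0)
qed (auto simp: continuous_g' continuous_h', auto simp: g'_def \<gamma>_0 \<alpha>_0)

end

subsection \<open>Maps out of fibrations over a varying base\<close>

lemma kcontinuous_fst: "continuous_map Y X g \<Longrightarrow> kcontinuous Y A X (\<lambda>(y, a). g y)"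
  using continuous_map_compose[OF continuous_map_fst] by (fastforce simp: kcontinuous_def o_def case_prod_unfold)

lemma continuous_map_fst_component: "continuous_map Q (prod_topology A B) f \<Longrightarrow> continuous_map Q A (\<lambda>z. fst (f z))"
  and continuous_map_snd_component: "continuous_map Q (prod_topology A B) f \<Longrightarrow> continuous_map Q B (\<lambda>z. snd (f z))"
  by (simp_all add: continuous_map_pairwise o_def)

locale fibration_problem =
  fixes E :: "'e topology" and B :: "'b topology" and p :: "'e \<Rightarrow> 'b"
    and X :: "'x topology" and Y :: "'y topology" and u :: "'y \<times> 'e \<Rightarrow> 'x"
  assumes fib: "Hurewicz_fibration E B p"
    and HE: "Hausdorff_space E" and HB: "Hausdorff_space B"
    and u: "kcontinuous Y E X u"
begin

section \<open>Solutions over a base map and their transport\<close>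

definition total :: "'a topology \<Rightarrow> ('a \<Rightarrow> 'b) \<Rightarrow> ('a \<times> 'e) topology" where
  "total A f = subtopology (prod_topology A E) {(a, e). f a = p e}"

definition solution ::
    "'a topology \<Rightarrow> ('a \<Rightarrow> 'b) \<Rightarrow> ('y \<times> 'a \<Rightarrow> 'x) \<Rightarrow> ('y \<times> real \<times> 'a \<times> 'e \<Rightarrow> 'x) \<Rightarrow> bool" where
  "solution A f g h \<longleftrightarrow>
     continuous_map A B f \<and> kcontinuous Y A X g \<and> kcontinuous Y (prod_topology \<I> (total A f)) X h \<and>
     (\<forall>y \<in> topspace Y. \<forall>a \<in> topspace A. \<forall>e \<in> topspace E. f a = p e \<longrightarrow>
        h (y, 0, a, e) = g (y, a) \<and> h (y, 1, a, e) = u (y, e))"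

lemma topspace_total [simp]: "topspace (total A f) = {(a, e). a \<in> topspace A \<and> e \<in> topspace E \<and> f a = p e}"
  by (auto simp: total_def)

lemma continuous_map_into_total:
  assumes "continuous_map Q A a" "continuous_map Q E e" "\<And>z. z \<in> topspace Q \<Longrightarrow> f (a z) = p (e z)"
  shows "continuous_map Q (total A f) (\<lambda>z. (a z, e z))"
  using assms by (auto simp: total_def continuous_map_in_subtopology continuous_map_pairwise o_def)

lemma continuous_map_total:
  assumes "continuous_map Q (total A f) z"
  shows "continuous_map Q A (\<lambda>x. fst (z x))" "continuous_map Q E (\<lambda>x. snd (z x))"
  using assms by (auto simp: total_def continuous_map_in_subtopology continuous_map_pairwise o_def)

lemma solution_cong:
  assumes "solution A f g h"
    and f: "\<And>a. a \<in> topspace A \<Longrightarrow> f a = f' a"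
    and g: "\<And>y a. y \<in> topspace Y \<Longrightarrow> a \<in> topspace A \<Longrightarrow> g (y, a) = g' (y, a)"
    and h: "\<And>y s a e. y \<in> topspace Y \<Longrightarrow> s \<in> {0..1} \<Longrightarrow> a \<in> topspace A \<Longrightarrow> e \<in> topspace E \<Longrightarrow> f a = p e \<Longrightarrow>
              h (y, s, a, e) = h' (y, s, a, e)"
  shows "solution A f' g' h'"
proof -
  have eq: "total A f = total A f'"
    unfolding total_def
    by (subst (1 2) subtopology_restrict[symmetric]) (use f in \<open>auto intro!: arg_cong[where f = "subtopology _"]\<close>)
  have "continuous_map A B f'"
    using assms(1) f by (auto simp: solution_def intro: continuous_map_eq)
  moreover have "kcontinuous Y A X g'"
    using assms(1) g by (auto simp: solution_def intro: kcontinuous_cong)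
  moreover have "kcontinuous Y (prod_topology \<I> (total A f)) X h'"
    using assms(1) h by (auto simp: solution_def intro!: kcontinuous_cong[of _ _ _ h])
  ultimately show ?thesis
    using assms(1) f g[symmetric] h[symmetric] by (simp add: solution_def eq)
qed

lemma solution_compose:
  assumes "solution A f g h" and q: "continuous_map A' A q"
  shows "solution A' (\<lambda>x. f (q x)) (\<lambda>(y, x). g (y, q x)) (\<lambda>(y, s, x, e). h (y, s, q x, e))"
proof -
  have qA: "q x \<in> topspace A" if "x \<in> topspace A'" for x
    using q that by (auto simp: continuous_map_def)
  have f: "continuous_map A B f" and g: "kcontinuous Y A X g"
    and h: "kcontinuous Y (prod_topology \<I> (total A f)) X h"
    using assms(1) by (auto simp: solution_def)
  have sq: "continuous_map (prod_topology \<I> (total A' (\<lambda>x. f (q x)))) (prod_topology \<I> (total A f))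
      (\<lambda>z. (fst z, q (fst (snd z)), snd (snd z)))"
    unfolding continuous_map_pairwise[of _ \<I>] o_def fst_conv snd_conv
    by (intro conjI continuous_map_into_total continuous_map_compose[OF _ q, unfolded o_def]
        continuous_map_fst continuous_map_total[OF continuous_map_snd]) auto
  show ?thesis
    unfolding solution_def
    using assms(1) continuous_map_compose[OF q f] kcontinuous_compose_right[OF g q]
      kcontinuous_compose_right[OF h sq] qA
    by (simp add: solution_def o_def case_prod_unfold)
qed

lemma solution_closed_cover:
  assumes f: "continuous_map A B f"
    and S: "closedin A S1" "closedin A S2" "topspace A \<subseteq> S1 \<union> S2"
    and sol: "solution (subtopology A S1) f g h" "solution (subtopology A S2) f g h"
  shows "solution A f g h"
proof -
  let ?T = "prod_topology \<I> (total A f)"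
  have pr: "continuous_map ?T A (\<lambda>z. fst (snd z))"
    by (intro continuous_map_total[OF continuous_map_snd])
  have sub: "kcontinuous Y (subtopology ?T {z \<in> topspace ?T. fst (snd z) \<in> S}) X h"
    if "solution (subtopology A S) f g h" for S
  proof -
    let ?Q = "subtopology ?T {z \<in> topspace ?T. fst (snd z) \<in> S}"
    have "continuous_map ?Q (prod_topology \<I> (total (subtopology A S) f)) (\<lambda>z. (fst z, fst (snd z), snd (snd z)))"
      unfolding continuous_map_pairwise[of _ \<I>] o_def fst_conv snd_conv
      using pr continuous_map_total(2)[OF continuous_map_snd]
      by (intro conjI continuous_map_into_total continuous_map_into_subtopology
          continuous_map_from_subtopology continuous_map_fst) auto
    then show ?thesis
      using kcontinuous_compose_right[of Y "prod_topology \<I> (total (subtopology A S) f)" X h ?Q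
          "\<lambda>z. (fst z, fst (snd z), snd (snd z))"] that
      by (simp add: solution_def)
  qed
  have "kcontinuous Y ?T X h"
    by (rule kcontinuous_closed_cover[OF _ _ _ sub[OF sol(1)] sub[OF sol(2)]])
       (use S closedin_continuous_map_preimage[OF pr] in auto)
  moreover have "kcontinuous Y A X g"
    by (rule kcontinuous_closed_cover[OF S]) (use sol in \<open>auto simp: solution_def\<close>)
  ultimately show ?thesis
    using f sol S(3) unfolding solution_def by (auto 0 3)
qed

text \<open>The lifting property is applied to the pullback at time 0, with the projection to
  \<open>E\<close> as initial map. This lifts all paths simultaneously: \<open>G\<close> carries
  each fibre along the path of its base point.\<close>

lemma lift_homotopy:
  assumes \<Phi>: "continuous_map (prod_topology \<I> A) B \<Phi>"
  obtains G where "continuous_map (prod_topology \<I> (total A (\<lambda>a. \<Phi> (0, a)))) E G"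
    "\<And>a e. a \<in> topspace A \<Longrightarrow> e \<in> topspace E \<Longrightarrow> \<Phi> (0, a) = p e \<Longrightarrow> G (0, a, e) = e"
    "\<And>t a e. t \<in> {0..1} \<Longrightarrow> a \<in> topspace A \<Longrightarrow> e \<in> topspace E \<Longrightarrow> \<Phi> (0, a) = p e \<Longrightarrow>
        p (G (t, a, e)) = \<Phi> (t, a)"
proof -
  let ?Y = "total A (\<lambda>a. \<Phi> (0, a))"
  have "continuous_map (prod_topology \<I> ?Y) B (\<lambda>z. \<Phi> (fst z, fst (snd z)))"
    by (intro continuous_map_compose_Pair[OF \<Phi>] continuous_map_fst continuous_map_total[OF continuous_map_snd])
  moreover have "continuous_map ?Y E snd"
    using continuous_map_total(2)[OF continuous_map_id] by simp
  ultimately show thesis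
    using Hurewicz_fibration_lifting[OF fib HE HB, of ?Y, unfolded homotopy_lifting_property_def,
        rule_format, of "\<lambda>z. \<Phi> (fst z, fst (snd z))" snd]
    by (auto intro!: that)
qed

text \<open>A solution over the end of a homotopy is moved to its beginning by first following the
  given one on the transported points and then \<open>u\<close> along the lifted path. Reparametrising by the
  length \<open>l\<close> of the paths makes this strictly constant where \<open>l\<close> vanishes.\<close>

lemma solution_transport:
  assumes \<Phi>: "continuous_map (prod_topology \<I> A) B \<Phi>"
    and l: "continuous_map A euclideanreal l" "\<And>a. a \<in> topspace A \<Longrightarrow> l a \<in> {0..1}"
    and stop: "\<And>a. a \<in> topspace A \<Longrightarrow> \<Phi> (l a, a) = \<Phi> (1, a)"
    and sol: "solution A (\<lambda>a. \<Phi> (1, a)) g h"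
  obtains h' where "solution A (\<lambda>a. \<Phi> (0, a)) g h'"
    "\<And>y s a e. l a = 0 \<Longrightarrow> s \<in> {0..1} \<Longrightarrow> a \<in> topspace A \<Longrightarrow> e \<in> topspace E \<Longrightarrow> \<Phi> (0, a) = p e \<Longrightarrow>
       h' (y, s, a, e) = h (y, s, a, e)"
proof -
  obtain G where G: "continuous_map (prod_topology \<I> (total A (\<lambda>a. \<Phi> (0, a)))) E G"
    and G0: "\<And>a e. a \<in> topspace A \<Longrightarrow> e \<in> topspace E \<Longrightarrow> \<Phi> (0, a) = p e \<Longrightarrow> G (0, a, e) = e"
    and pG: "\<And>t a e. t \<in> {0..1} \<Longrightarrow> a \<in> topspace A \<Longrightarrow> e \<in> topspace E \<Longrightarrow> \<Phi> (0, a) = p e \<Longrightarrow>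
        p (G (t, a, e)) = \<Phi> (t, a)"
    using lift_homotopy[OF \<Phi>] by blast
  let ?T = "prod_topology \<I> (total A (\<lambda>a. \<Phi> (0, a)))"
  let ?T1 = "prod_topology \<I> (total A (\<lambda>a. \<Phi> (1, a)))"
  define L where "L = (\<lambda>z :: real \<times> 'a \<times> 'e. l (fst (snd z)))"
  \<comment> \<open>\<sigma> runs through \<open>[0, 1 + L z]\<close>: up to 1 it is the time of
    \<open>h\<close>, beyond 1 it measures how far the lifted path has been run backwards.\<close>
  define \<sigma> where "\<sigma> = (\<lambda>z :: real \<times> 'a \<times> 'e. fst z * (1 + L z))"
  \<comment> \<open>\<open>G\<close> is evaluated at time \<open>L z\<close> instead of 1. By
    \<open>stop\<close> the result already lies over the end of the path, and for
    \<open>L z = 0\<close> it is the starting point itself, whereas the lift at time 1 might have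
    moved within the fibre.\<close>
  define q1 where "q1 = (\<lambda>z. (\<sigma> z, fst (snd z), G (L z, snd z)))"
  define q2 where "q2 = (\<lambda>z. G (1 + L z - \<sigma> z, snd z))"
  define h' where "h' = (\<lambda>(y, z). if \<sigma> z \<le> 1 then h (y, q1 z) else u (y, q2 z))"
  have pr: "continuous_map ?T A (\<lambda>z. fst (snd z))"
    by (intro continuous_map_total[OF continuous_map_snd])
  have L: "continuous_map ?T euclideanreal L"
    unfolding L_def using continuous_map_compose[OF pr l(1)] by (simp add: o_def)
  have \<sigma>: "continuous_map ?T euclideanreal \<sigma>"
    unfolding \<sigma>_def using continuous_map_fst[of \<I>]
    by (intro continuous_map_real_intros L) (auto simp: continuous_map_into_top_of_set)
  have Lb: "0 \<le> L z" "L z \<le> 1" if "z \<in> topspace ?T" for z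
    using that l(2)[of "fst (snd z)"] by (auto simp: L_def)
  have \<sigma>b: "0 \<le> \<sigma> z" "\<sigma> z \<le> 1 + L z" if "z \<in> topspace ?T" for z
    using Lb[OF that] that mult_right_mono[of "fst z" 1 "1 + L z"] by (auto simp: \<sigma>_def)
  have GL: "continuous_map (subtopology ?T S) E (\<lambda>z. G (r z, snd z))"
    if "continuous_map ?T euclideanreal r" "\<And>z. z \<in> topspace (subtopology ?T S) \<Longrightarrow> r z \<in> {0..1}" for r S
    by (rule continuous_map_compose_homotopy[OF G])
       (use that in \<open>auto intro!: continuous_map_from_subtopology continuous_map_snd\<close>)
  have q1: "continuous_map (subtopology ?T {z. \<sigma> z \<le> 1}) ?T1 q1"
    unfolding q1_def continuous_map_pairwise[of _ \<I>] o_def fst_conv snd_conv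
  proof (intro conjI continuous_map_into_total)
    show "continuous_map (subtopology ?T {z. \<sigma> z \<le> 1}) \<I> \<sigma>"
      using \<sigma> \<sigma>b by (auto simp: continuous_map_into_top_of_set continuous_map_from_subtopology)
    show "\<Phi> (1, fst (snd z)) = p (G (L z, snd z))" if "z \<in> topspace (subtopology ?T {z. \<sigma> z \<le> 1})" for z
      using that stop Lb[of z] by (auto simp: pG L_def)
    show "continuous_map (subtopology ?T {z. \<sigma> z \<le> 1}) E (\<lambda>z. G (L z, snd z))"
      by (rule GL) (use L Lb in auto)
  qed (use pr in \<open>simp add: continuous_map_from_subtopology\<close>)
  have q2: "continuous_map (subtopology ?T {z. 1 \<le> \<sigma> z}) E q2"
    unfolding q2_def
    by (rule GL) (use L \<sigma> Lb \<sigma>b in \<open>auto intro!: continuous_map_real_intros simp del: topspace_prod_topology\<close>, fastforce)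
  have ends: "h (y, 1, a, e) = u (y, e)" "h (y, 0, a, e) = g (y, a)"
    if "y \<in> topspace Y" "a \<in> topspace A" "e \<in> topspace E" "\<Phi> (1, a) = p e" for y a e
    using sol that by (auto simp: solution_def)
  have GE: "G (t, a, e) \<in> topspace E" if "t \<in> {0..1}" "a \<in> topspace A" "e \<in> topspace E" "\<Phi> (0, a) = p e" for t a e
    using G that by (auto simp: continuous_map_def Pi_iff)
  have k: "kcontinuous Y ?T X h'"
    unfolding h'_def
  proof (rule kcontinuous_cases_le[where h = "\<lambda>(y, z). h (y, q1 z)" and k = "\<lambda>(y, z). u (y, q2 z)", simplified split])
    show "kcontinuous Y (subtopology ?T {z. \<sigma> z \<le> 1}) X (\<lambda>(y, z). h (y, q1 z))"
      by (rule kcontinuous_compose_right[OF _ q1]) (use sol in \<open>simp add: solution_def\<close>)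
    show "kcontinuous Y (subtopology ?T {z. 1 \<le> \<sigma> z}) X (\<lambda>(y, z). u (y, q2 z))"
      using kcontinuous_compose_right[OF u q2] .
    show "h (y, q1 z) = u (y, q2 z)" if "y \<in> topspace Y" "z \<in> topspace ?T" "\<sigma> z = 1" for y z
    proof -
      obtain s a e where z: "z = (s, a, e)" by (metis surj_pair)
      have az: "a \<in> topspace A" "e \<in> topspace E" "\<Phi> (0, a) = p e" using that(2) by (auto simp: z)
      have "\<Phi> (1, a) = p (G (l a, a, e))"
        using az stop l(2)[of a] by (simp add: pG)
      moreover have "G (l a, a, e) \<in> topspace E" using az l(2)[of a] GE by auto
      ultimately show ?thesis
        using ends(1)[OF that(1) az(1)] that(3) by (simp add: q1_def q2_def z L_def)
    qed
  qed (use \<sigma> in auto)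
  have eqs: "h' (y, 0, a, e) = g (y, a) \<and> h' (y, 1, a, e) = u (y, e)"
    if "y \<in> topspace Y" "a \<in> topspace A" "e \<in> topspace E" "\<Phi> (0, a) = p e" for y a e
  proof
    have la: "l a \<in> {0..1}" using l(2) that by blast
    have G1: "\<Phi> (1, a) = p (G (l a, a, e))" "G (l a, a, e) \<in> topspace E"
      using that la stop GE by (simp_all add: pG)
    show "h' (y, 0, a, e) = g (y, a)"
      using ends(2)[OF that(1,2) G1(2,1)] by (simp add: h'_def \<sigma>_def q1_def L_def)
    show "h' (y, 1, a, e) = u (y, e)"
    \<comment> \<open>With \<open>l a = 0\<close> the second branch of \<open>h'\<close> is never
      reached, so the value at time 1 is supplied by \<open>h\<close>.\<close>
    proof (cases "l a = 0")
      case True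
      then show ?thesis
        using ends(1)[OF that(1,2) G1(2,1)] that by (simp add: h'_def \<sigma>_def q1_def L_def G0)
    next
      case False
      then show ?thesis
        using that la by (simp add: h'_def \<sigma>_def q2_def L_def G0)
    qed
  qed
  have "continuous_map A B (\<lambda>a. \<Phi> (0, a))"
    by (rule continuous_map_compose_homotopy[OF \<Phi>]) auto
  then have "solution A (\<lambda>a. \<Phi> (0, a)) g h'"
    using k eqs sol by (auto simp: solution_def)
  moreover have "h' (y, s, a, e) = h (y, s, a, e)"
    if "l a = 0" "s \<in> {0..1}" "a \<in> topspace A" "e \<in> topspace E" "\<Phi> (0, a) = p e" for y s a e
    using that by (simp add: h'_def \<sigma>_def q1_def L_def G0)
  ultimately show thesis by (rule that)
qed


text \<open>Over the constant map \<open>b\<close> the pullback is \<open>A\<close> times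
  \<open>F\<close>, and a solution is a family, over \<open>Y\<close> times \<open>A\<close>, of
  points in the homotopy fibre of X -> X^(kF) over the restriction of \<open>u\<close> to
  \<open>F\<close>. The contraction \<open>deformation\<close> moves it to \<open>gs\<close> and
  \<open>hs\<close>, which do not depend on the point of \<open>A\<close> and hence make sense over
  any base. Compactness of \<open>A\<close> turns k-continuity into continuity on \<open>Y\<close>
  times \<open>A\<close>.\<close>

lemma contract_to_standard_solution:
  assumes b: "b \<in> topspace B" and F: "F = subtopology E {e \<in> topspace E. p e = b}"
    and he: "homotopy_equivalence_map X (mapping_space (kification F) X) (constant_map F)"
  obtains gs hs where
    "\<And>A :: 'a topology. solution A (\<lambda>_. b) (\<lambda>(y, a). gs y) (\<lambda>(y, s, a, e). hs (y, s, e))"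
    "\<And>(A :: 'a topology) g h. compact_space A \<Longrightarrow> solution A (\<lambda>_. b) g h \<Longrightarrow>
       \<exists>g' h'. solution (prod_topology \<I> A) (\<lambda>_. b) g' h' \<and>
         (\<forall>y \<in> topspace Y. \<forall>a \<in> topspace A. g' (y, 0, a) = g (y, a) \<and> g' (y, 1, a) = gs y) \<and>
         (\<forall>y \<in> topspace Y. \<forall>s \<in> {0..1}. \<forall>a \<in> topspace A. \<forall>e \<in> topspace E. p e = b \<longrightarrow>
            h' (y, s, (0, a), e) = h (y, s, a, e) \<and> h' (y, s, (1, a), e) = hs (y, s, e))"
proof -
  let ?Z = "mapping_space (kification F) X"
  let ?f = "constant_map F"
  have HF: "Hausdorff_space F" unfolding F by (rule Hausdorff_space_subtopology[OF HE])
  have tF: "topspace F = {e \<in> topspace E. p e = b}" by (auto simp: F)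
  obtain G where f: "continuous_map X ?Z ?f" and G: "continuous_map ?Z X G"
    and GF: "homotopic_with (\<lambda>_. True) X X (G \<circ> ?f) id"
    and FG: "homotopic_with (\<lambda>_. True) ?Z ?Z (?f \<circ> G) id"
    using he by (auto simp: homotopy_equivalence_map_def)
  obtain L where L: "continuous_map (prod_topology \<I> X) X L" "\<forall>x. L (0, x) = G (?f x)" "\<forall>x. L (1, x) = x"
    using GF by (auto simp: homotopic_with_def)
  obtain H where H: "continuous_map (prod_topology \<I> ?Z) ?Z H" "\<forall>x. H (0, x) = ?f (G x)" "\<forall>x. H (1, x) = x"
    using FG by (auto simp: homotopic_with_def)
  define v where "v = (\<lambda>y. \<lambda>e \<in> topspace F. u (y, e))"
  have v: "continuous_map Y ?Z v"
    unfolding v_def by (rule continuous_map_into_mapping_space_kification)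
      (simp add: F kcontinuous_subtopology[OF u])
  have vZ: "v y \<in> topspace ?Z" if "y \<in> topspace Y" for y
    using v that unfolding continuous_map_def by blast
  define gs where "gs = (\<lambda>y. G (v y))"
  define hs where "hs = (\<lambda>(y, s, e). H (s, v y) e)"
  \<comment> \<open>The way back: a map into X^(kF) becomes a family on the pullback by evaluation
    at the \<open>E\<close>-component.\<close>
  have uncurry: "kcontinuous Y (prod_topology \<I> (total A (\<lambda>_. b))) X (\<lambda>(y, z). k (r (y, z)) (snd (snd z)))"
    if k: "continuous_map W ?Z k" and r: "continuous_map (prod_topology Y (prod_topology \<I> (total A (\<lambda>_. b)))) W r"
    for A :: "'c topology" and W :: "'w topology" and k r
  proof -
    have "continuous_map (prod_topology \<I> (total A (\<lambda>_. b))) F (\<lambda>z. snd (snd z))"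
      unfolding F by (intro continuous_map_into_subtopology continuous_map_total[OF continuous_map_snd]) auto
    from kcontinuous_compose[OF kcontinuous_from_mapping_space_kification[OF HF k] r this]
    show ?thesis by simp
  qed
  show thesis
  proof (rule that[of gs hs])
    fix A :: "'a topology"
    let ?T = "prod_topology \<I> (total A (\<lambda>_. b))"
    have "continuous_map (prod_topology Y ?T) (prod_topology \<I> Y) (\<lambda>z. (fst (snd z), fst z))"
      by (simp add: continuous_map_pairwise o_def continuous_map_fst continuous_map_fst_component[OF continuous_map_snd])
    then have "continuous_map (prod_topology Y ?T) ?Z (\<lambda>z. H (fst (snd z), v (fst z)))"
      using continuous_map_compose_Pair[OF H(1) _ continuous_map_compose[OF _ v]]
      by (auto simp: o_def continuous_map_pairwise)
    from uncurry[OF continuous_map_id this]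
    have "kcontinuous Y ?T X (\<lambda>(y, s, a, e). hs (y, s, e))"
      by (simp add: hs_def case_prod_unfold)
    moreover have "kcontinuous Y A X (\<lambda>(y, a). gs y)"
      unfolding gs_def using continuous_map_compose[OF v G] by (intro kcontinuous_fst) (simp add: o_def)
    ultimately show "solution A (\<lambda>_. b) (\<lambda>(y, a). gs y) (\<lambda>(y, s, a, e). hs (y, s, e))"
      unfolding solution_def using b H(2,3) by (auto simp: hs_def gs_def constant_map_def v_def tF)
  next
    fix A :: "'a topology" and g h
    assume A: "compact_space A" and sol: "solution A (\<lambda>_. b) g h"
    let ?W = "prod_topology Y A"
    let ?IA = "prod_topology \<I> A"
    have IA: "compact_space ?IA"
      using A by (simp add: compact_space_prod_topology compact_space_subtopology)
    define \<eta> where "\<eta> = (\<lambda>z. \<lambda>e \<in> topspace F. h (fst (snd z), (fst z, snd (snd z), e)))"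
    have \<eta>: "continuous_map (prod_topology \<I> ?W) ?Z \<eta>"
    proof -
      have q: "continuous_map (prod_topology ?IA F) (prod_topology \<I> (total A (\<lambda>_. b)))
          (\<lambda>z. (fst (fst z), snd (fst z), snd z))"
        unfolding continuous_map_pairwise[of _ \<I>] o_def fst_conv snd_conv
      proof (intro conjI continuous_map_into_total)
        show "continuous_map (prod_topology ?IA F) E snd"
          unfolding F using continuous_map_snd continuous_map_into_fulltopology by blast
        show "b = p (snd z)" if "z \<in> topspace (prod_topology ?IA F)" for z
          using that by (auto simp: tF)
      qed (intro continuous_map_fst_component[OF continuous_map_fst] continuous_map_snd_component[OF continuous_map_fst])+
      have \<pi>: "continuous_map (prod_topology \<I> ?W) ?IA (\<lambda>z. (fst z, snd (snd z)))"
        by (simp add: continuous_map_pairwise o_def continuous_map_fst continuous_map_snd_component[OF continuous_map_snd])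
      have r: "continuous_map (prod_topology \<I> ?W) Y (\<lambda>z. fst (snd z))"
        by (rule continuous_map_fst_component[OF continuous_map_snd])
      \<comment> \<open>Time and the point of \<open>A\<close> become parameters; this rests on
        compactness of \<open>?IA\<close>.\<close>
      have "kcontinuous (prod_topology \<I> ?W) F X (\<lambda>(z, e). h (fst (snd z), (fst z, snd (snd z), e)))"
        using kcontinuous_compact_param[OF _ IA r \<pi> q, of X h] sol by (simp add: solution_def)
      from continuous_map_into_mapping_space_kification[OF this]
      show ?thesis by (simp add: \<eta>_def)
    qed
    have gW: "continuous_map ?W X g"
      using sol A by (simp add: solution_def kcontinuous_compact)
    have vW: "continuous_map ?W ?Z (\<lambda>w. v (fst w))"
      using continuous_map_compose[OF continuous_map_fst v] by (simp add: o_def)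
    have start: "h (y, 0, a, e) = g (y, a)" "h (y, 1, a, e) = u (y, e)"
      if "y \<in> topspace Y" "a \<in> topspace A" "e \<in> topspace F" for y a e
      using sol that by (auto simp: solution_def tF)
    interpret partial_inverse_homotopy X ?Z ?W ?f G H L g "\<lambda>w. v (fst w)" \<eta>
      by unfold_locales
        (use f G H L gW vW \<eta> in \<open>auto simp: \<eta>_def constant_map_def v_def start intro!: restrict_ext\<close>)
    obtain gd hd where gd: "continuous_map (prod_topology \<I> ?W) X gd"
      and hd: "continuous_map (prod_topology \<I> (prod_topology \<I> ?W)) ?Z hd"
      and eqs: "\<And>w. w \<in> topspace ?W \<Longrightarrow> gd (0, w) = g w"
        "\<And>w. w \<in> topspace ?W \<Longrightarrow> gd (1, w) = G (v (fst w))"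
        "\<And>t w. t \<in> {0..1} \<Longrightarrow> w \<in> topspace ?W \<Longrightarrow> hd (t, 0, w) = ?f (gd (t, w))"
        "\<And>t w. t \<in> {0..1} \<Longrightarrow> w \<in> topspace ?W \<Longrightarrow> hd (t, 1, w) = v (fst w)"
        "\<And>s w. s \<in> {0..1} \<Longrightarrow> w \<in> topspace ?W \<Longrightarrow> hd (0, s, w) = \<eta> (s, w)"
        "\<And>s w. s \<in> {0..1} \<Longrightarrow> w \<in> topspace ?W \<Longrightarrow> hd (1, s, w) = H (s, v (fst w))"
      by (rule deformation) blast
    define g' where "g' = (\<lambda>z. gd (fst (snd z), fst z, snd (snd z)))"
    define h' where "h' = (\<lambda>(y, z). hd (fst (fst (snd z)), fst z, y, snd (fst (snd z))) (snd (snd z)))"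
    have "continuous_map (prod_topology Y ?IA) X g'"
      unfolding g'_def
      by (rule continuous_map_compose_Pair[OF gd])
        (simp_all add: continuous_map_pairwise o_def continuous_map_fst continuous_map_fst_component[OF continuous_map_snd]
          continuous_map_snd_component[OF continuous_map_snd])
    then have kg': "kcontinuous Y ?IA X g'"
      by (simp add: kcontinuous_compact[OF IA])
    let ?T = "prod_topology \<I> (total ?IA (\<lambda>_. b))"
    have pr: "continuous_map (prod_topology Y ?T) ?IA (\<lambda>z. fst (snd (snd z)))"
      by (rule continuous_map_total(1)[OF continuous_map_snd_component[OF continuous_map_snd]])
    have "continuous_map (prod_topology Y ?T) (prod_topology \<I> (prod_topology \<I> ?W))
        (\<lambda>z. (fst (fst (snd (snd z))), fst (snd z), fst z, snd (fst (snd (snd z)))))"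
      using continuous_map_fst_component[OF pr] continuous_map_snd_component[OF pr]
      by (simp add: continuous_map_pairwise o_def continuous_map_fst continuous_map_fst_component[OF continuous_map_snd])
    from uncurry[OF hd this]
    have kh': "kcontinuous Y ?T X h'"
      by (simp add: h'_def)
    have "solution ?IA (\<lambda>_. b) g' h'"
      unfolding solution_def
      using b kg' kh' eqs by (auto simp: g'_def h'_def constant_map_def v_def tF)
    moreover have "g' (y, 0, a) = g (y, a) \<and> g' (y, 1, a) = gs y" if "y \<in> topspace Y" "a \<in> topspace A" for y a
      using that eqs by (simp add: g'_def gs_def)
    moreover have "h' (y, s, (0, a), e) = h (y, s, a, e) \<and> h' (y, s, (1, a), e) = hs (y, s, e)"
      if "y \<in> topspace Y" "s \<in> {0..1}" "a \<in> topspace A" "e \<in> topspace E" "p e = b" for y s a e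
      using that eqs by (simp add: h'_def hs_def \<eta>_def tF)
    ultimately show "\<exists>g' h'. solution ?IA (\<lambda>_. b) g' h' \<and>
         (\<forall>y \<in> topspace Y. \<forall>a \<in> topspace A. g' (y, 0, a) = g (y, a) \<and> g' (y, 1, a) = gs y) \<and>
         (\<forall>y \<in> topspace Y. \<forall>s \<in> {0..1}. \<forall>a \<in> topspace A. \<forall>e \<in> topspace E. p e = b \<longrightarrow>
            h' (y, s, (0, a), e) = h (y, s, a, e) \<and> h' (y, s, (1, a), e) = hs (y, s, e))"
      by blast
  qed
qed

end

subsection \<open>Extension over a disc\<close>

context fibration_problem
begin

text \<open>For the unit ball \<open>P\<close> of a norm \<open>N\<close> one takes \<open>\<kappa> (s, x) = x /\<^sub>R max (N x) s\<close>, so that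
  \<open>\<kappa> (N x, x)\<close> is the radial projection.\<close>

lemma extend_solution_from_sphere:
  fixes P :: "'a topology"
  assumes b: "b \<in> topspace B" and F: "F = subtopology E {e \<in> topspace E. p e = b}"
    and he: "homotopy_equivalence_map X (mapping_space (kification F) X) (constant_map F)"
    and P: "compact_space P"
    and N: "continuous_map P euclideanreal N" and N01: "\<And>x. x \<in> topspace P \<Longrightarrow> N x \<in> {0..1}"
    and \<kappa>: "continuous_map (prod_topology (top_of_set {1/4..1}) P) P \<kappa>"
    and \<kappa>1: "\<And>x. x \<in> topspace P \<Longrightarrow> \<kappa> (1, x) = x"
    and \<kappa>N: "\<And>x. x \<in> topspace P \<Longrightarrow> 1/4 \<le> N x \<Longrightarrow> N (\<kappa> (N x, x)) = 1"
    and \<Omega>: "continuous_map (prod_topology \<I> P) B \<Omega>" and \<Omega>0: "\<And>x. x \<in> topspace P \<Longrightarrow> \<Omega> (0, x) = b"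
    and sol: "solution (subtopology P {x. N x = 1}) (\<lambda>x. \<Omega> (1, x)) g0 h0"
  obtains g h where "solution P (\<lambda>x. \<Omega> (1, x)) g h"
    "\<And>y x. y \<in> topspace Y \<Longrightarrow> x \<in> topspace P \<Longrightarrow> N x = 1 \<Longrightarrow> g (y, x) = g0 (y, x)"
    "\<And>y s x e. y \<in> topspace Y \<Longrightarrow> s \<in> {0..1} \<Longrightarrow> x \<in> topspace P \<Longrightarrow> N x = 1 \<Longrightarrow> e \<in> topspace E \<Longrightarrow>
       \<Omega> (1, x) = p e \<Longrightarrow> h (y, s, x, e) = h0 (y, s, x, e)"
proof -
  define S where "S = subtopology P {x. N x = 1}"
  have cl: "closedin P {x \<in> topspace P. N x \<in> C}" if "closed C" for C
    using closedin_continuous_map_preimage[OF N] that by simp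
  have S: "compact_space S"
  proof -
    have "S = subtopology P {x \<in> topspace P. N x \<in> {1}}"
      unfolding S_def by (subst subtopology_restrict[symmetric]) (auto intro!: arg_cong[where f = "subtopology _"])
    then show ?thesis
      using compact_space_subtopology[OF closedin_compact_space[OF P cl[of "{1}"]]] by simp
  qed
  have \<kappa>in: "\<kappa> (s, x) \<in> topspace P" if "s \<in> {1/4..1}" "x \<in> topspace P" for s x
    using \<kappa> that by (auto simp: continuous_map_def Pi_iff)
  have \<kappa>c: "continuous_map Q P (\<lambda>z. \<kappa> (s z, x z))"
    if "continuous_map Q euclideanreal s" "\<And>z. z \<in> topspace Q \<Longrightarrow> s z \<in> {1/4..1}" "continuous_map Q P x"
    for Q :: "'q topology" and s x
    by (rule continuous_map_compose_homotopy[OF \<kappa> that])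
  have \<Omega>c: "continuous_map Q B (\<lambda>z. \<Omega> (s z, x z))"
    if "continuous_map Q euclideanreal s" "\<And>z. z \<in> topspace Q \<Longrightarrow> s z \<in> {0..1}" "continuous_map Q P x"
    for Q :: "'q topology" and s x
    by (rule continuous_map_compose_homotopy[OF \<Omega> that])
  have SP: "continuous_map Q P x" if "continuous_map Q S x" for Q :: "'q topology" and x
    using that continuous_map_into_fulltopology by (simp add: S_def continuous_map_in_subtopology)
  obtain gs hs where std: "\<And>A :: 'a topology. solution A (\<lambda>_. b) (\<lambda>(y, a). gs y) (\<lambda>(y, s, a, e). hs (y, s, e))"
    and contr: "\<And>(A :: 'a topology) g h. compact_space A \<Longrightarrow> solution A (\<lambda>_. b) g h \<Longrightarrow>
       \<exists>g' h'. solution (prod_topology \<I> A) (\<lambda>_. b) g' h' \<and>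
         (\<forall>y \<in> topspace Y. \<forall>a \<in> topspace A. g' (y, 0, a) = g (y, a) \<and> g' (y, 1, a) = gs y) \<and>
         (\<forall>y \<in> topspace Y. \<forall>s \<in> {0..1}. \<forall>a \<in> topspace A. \<forall>e \<in> topspace E. p e = b \<longrightarrow>
            h' (y, s, (0, a), e) = h (y, s, a, e) \<and> h' (y, s, (1, a), e) = hs (y, s, e))"
    using contract_to_standard_solution[OF b F he] by blast
  let ?IS = "prod_topology \<I> S"
  have IS: "continuous_map ?IS euclideanreal fst" "continuous_map ?IS P snd"
    using continuous_map_fst[of \<I> S] SP[OF continuous_map_snd] by (auto simp: continuous_map_into_top_of_set)
  \<comment> \<open>For \<open>(t', x)\<close> in \<open>?IS\<close> the path sending
    \<open>t\<close> to \<open>\<Omega> (min (t' + t) 1, x)\<close> leads from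
    \<open>\<Omega> (t', x)\<close> to \<open>\<Omega> (1, x)\<close> and is stationary after time
    \<open>1 - t'\<close>. Transport along it extends the given solution from the outer end of the
    collar \<open>?IS\<close> inwards and changes nothing at \<open>t' = 1\<close>.\<close>
  have 1: "continuous_map (prod_topology \<I> ?IS) B (\<lambda>z. \<Omega> (min (fst (snd z) + fst z) 1, snd (snd z)))"
  proof (rule \<Omega>c)
    show "continuous_map (prod_topology \<I> ?IS) euclideanreal (\<lambda>z. min (fst (snd z) + fst z) 1)"
      using continuous_map_fst[of \<I> ?IS] continuous_map_fst_component[OF continuous_map_snd, of \<I> \<I> S]
      by (intro continuous_map_real_intros) (auto simp: continuous_map_into_top_of_set)
  qed (auto intro: SP continuous_map_snd_component[OF continuous_map_snd])
  have 2: "continuous_map ?IS euclideanreal (\<lambda>z. 1 - fst z)"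
    by (intro continuous_map_real_intros IS) auto
  have 3: "solution ?IS (\<lambda>z. \<Omega> (1, snd z)) (\<lambda>(y, z). g0 (y, snd z)) (\<lambda>(y, s, z, e). h0 (y, s, snd z, e))"
    using solution_compose[OF sol, folded S_def, OF continuous_map_snd[of \<I> S]] .
  obtain h1 where sol1: "solution ?IS (\<lambda>z. \<Omega> (fst z, snd z)) (\<lambda>(y, z). g0 (y, snd z)) h1"
    and h1: "\<And>y s x e. s \<in> {0..1} \<Longrightarrow> x \<in> topspace S \<Longrightarrow> e \<in> topspace E \<Longrightarrow> \<Omega> (1, x) = p e \<Longrightarrow>
       h1 (y, s, (1, x), e) = h0 (y, s, x, e)"
  proof (rule solution_transport[OF 1 2])
    show "1 - fst a \<in> {0..1}" if "a \<in> topspace ?IS" for a using that by auto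
    show "solution ?IS (\<lambda>a. \<Omega> (min (fst (snd (1, a)) + fst (1, a)) 1, snd (snd (1, a))))
        (\<lambda>(y, z). g0 (y, snd z)) (\<lambda>(y, s, z, e). h0 (y, s, snd z, e))"
      by (rule solution_cong[OF 3]) auto
  next
    fix h' assume h': "solution ?IS (\<lambda>a. \<Omega> (min (fst (snd (0, a)) + fst (0, a)) 1, snd (snd (0, a))))
         (\<lambda>(y, z). g0 (y, snd z)) h'"
      "\<And>y s a e. 1 - fst a = 0 \<Longrightarrow> s \<in> {0..1} \<Longrightarrow> a \<in> topspace ?IS \<Longrightarrow> e \<in> topspace E \<Longrightarrow>
        \<Omega> (min (fst (snd (0, a)) + fst (0, a)) 1, snd (snd (0, a))) = p e \<Longrightarrow>
        h' (y, s, a, e) = (case (y, s, a, e) of (y, s, z, e) \<Rightarrow> h0 (y, s, snd z, e))"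
    show thesis
    proof (rule that[of h'])
      show "solution ?IS (\<lambda>z. \<Omega> (fst z, snd z)) (\<lambda>(y, z). g0 (y, snd z)) h'"
        by (rule solution_cong[OF h'(1)]) auto
      show "h' (y, s, (1, x), e) = h0 (y, s, x, e)"
        if "s \<in> {0..1}" "x \<in> topspace S" "e \<in> topspace E" "\<Omega> (1, x) = p e" for y s x e
        using h'(2)[of "(1, x)" s e y] that by simp
    qed
  qed auto
  have 4: "continuous_map S ?IS (\<lambda>x. (0, x))"
    by (simp add: continuous_map_pairwise o_def)
  \<comment> \<open>At the inner end of the collar the base map is constant, so the solution can be
    contracted to the standard one along a second collar.\<close>
  have "solution S (\<lambda>_. b) (\<lambda>(y, x). g0 (y, x)) (\<lambda>(y, s, x, e). h1 (y, s, (0, x), e))"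
    by (rule solution_cong[OF solution_compose[OF sol1 4]]) (auto simp: \<Omega>0 S_def)
  then obtain g2 h2 where sol2: "solution ?IS (\<lambda>_. b) g2 h2"
    and g2: "\<And>y x. y \<in> topspace Y \<Longrightarrow> x \<in> topspace S \<Longrightarrow> g2 (y, 0, x) = g0 (y, x) \<and> g2 (y, 1, x) = gs y"
    and h2: "\<And>y s x e. y \<in> topspace Y \<Longrightarrow> s \<in> {0..1} \<Longrightarrow> x \<in> topspace S \<Longrightarrow> e \<in> topspace E \<Longrightarrow> p e = b \<Longrightarrow>
            h2 (y, s, (0, x), e) = h1 (y, s, (0, x), e) \<and> h2 (y, s, (1, x), e) = hs (y, s, e)"
    using contr[OF S] by fastforce
  \<comment> \<open>Radial projection to the sphere; it is applied for \<open>1/4 \<le> N x\<close>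
    only, which keeps it away from the centre.\<close>
  define \<pi> where "\<pi> = (\<lambda>x. \<kappa> (N x, x))"
  \<comment> \<open>The base map that suits the pieces: it runs through the null-homotopy \<Omega>
    on the shell between radius 1/2 and 1 and equals \<open>b\<close> further inside, where \<Omega>
    is at time 0.\<close>
  define \<psi> where "\<psi> = (\<lambda>x. \<Omega> (max 0 (2 * N x - 1), \<kappa> (max (1/2) (N x), x)))"
  \<comment> \<open>The first collar fills the radii from 1/2 to 1, the second one those from 1/4 to
    1/2, and the standard solution fills the rest. The outer shell shows \<open>g0\<close> itself
    because transport leaves the first component unchanged.\<close>
  define g where "g = (\<lambda>(y, x). if 1/2 \<le> N x then g0 (y, \<pi> x) else if 1/4 \<le> N x then g2 (y, 2 - 4 * N x, \<pi> x) else gs y)"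
  define h3 where "h3 = (\<lambda>(y, s, x, e). if 1/2 \<le> N x then h1 (y, s, (2 * N x - 1, \<pi> x), e)
     else if 1/4 \<le> N x then h2 (y, s, (2 - 4 * N x, \<pi> x), e) else hs (y, s, e))"
  have \<psi>: "continuous_map P B \<psi>"
    unfolding \<psi>_def
  proof (rule \<Omega>c)
    show "continuous_map P P (\<lambda>z. \<kappa> (max (1/2) (N z), z))"
      by (rule \<kappa>c) (use N01 in \<open>auto intro!: continuous_map_real_intros N continuous_map_id[unfolded id_def]\<close>)
  qed (use N01 in \<open>auto intro!: continuous_map_real_intros N\<close>)
  have \<psi>b: "\<psi> x = b" if "x \<in> topspace P" "N x \<le> 1/2" for x
    using that \<kappa>in[of "1/2" x] by (simp add: \<psi>_def \<Omega>0 max_absorb1)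
  have \<pi>S: "\<pi> x \<in> topspace S" if "x \<in> topspace P" "1/4 \<le> N x" for x
    using that \<kappa>in[of "N x" x] \<kappa>N[of x] N01[of x] by (simp add: \<pi>_def S_def)
  have \<pi>: "continuous_map (subtopology P C) S \<pi>" if "\<And>x. x \<in> topspace P \<Longrightarrow> x \<in> C \<Longrightarrow> 1/4 \<le> N x" for C
  proof -
    have "continuous_map (subtopology P C) P \<pi>"
      unfolding \<pi>_def by (rule \<kappa>c) (use N01 that in \<open>auto intro!: continuous_map_from_subtopology N\<close>)
    then show ?thesis
      using that \<pi>S by (auto simp: S_def continuous_map_in_subtopology)
  qed
  let ?P1 = "{x \<in> topspace P. N x \<in> {1/2..}}" and ?P2 = "{x \<in> topspace P. N x \<in> {1/4..1/2}}"
    and ?P3 = "{x \<in> topspace P. N x \<in> {..1/4}}" and ?P23 = "{x \<in> topspace P. N x \<in> {..1/2}}"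
  have p1: "solution (subtopology P ?P1) \<psi> g h3"
  proof (rule solution_cong[OF solution_compose[OF sol1]])
    have "continuous_map (subtopology P ?P1) S \<pi>"
      by (rule \<pi>) auto
    then show "continuous_map (subtopology P ?P1) ?IS (\<lambda>x. (2 * N x - 1, \<pi> x))"
      using N01 by (auto simp: continuous_map_pairwise o_def continuous_map_into_top_of_set
          intro!: continuous_map_from_subtopology N continuous_map_real_intros)
  qed (auto simp: \<psi>_def \<pi>_def g_def h3_def max_absorb2)
  have p2: "solution (subtopology P ?P2) \<psi> g h3"
  proof (rule solution_cong[OF solution_compose[OF sol2]])
    have "continuous_map (subtopology P ?P2) S \<pi>"
      by (rule \<pi>) auto
    then show "continuous_map (subtopology P ?P2) ?IS (\<lambda>x. (2 - 4 * N x, \<pi> x))"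
      using N01 by (auto simp: continuous_map_pairwise o_def continuous_map_into_top_of_set
          intro!: continuous_map_from_subtopology N continuous_map_real_intros)
    show "b = \<psi> a" if "a \<in> topspace (subtopology P ?P2)" for a
      using that \<psi>b by auto
    show "(case (y, a) of (y, x) \<Rightarrow> g2 (y, 2 - 4 * N x, \<pi> x)) = g (y, a)"
      if "y \<in> topspace Y" "a \<in> topspace (subtopology P ?P2)" for y a
    \<comment> \<open>On the common sphere of two pieces the definition takes the outer branch; the
      inner piece matches it by the boundary values of \<open>g2\<close>.\<close>
    proof (cases "N a = 1/2")
      case True
      then show ?thesis using that g2 \<pi>S[of a] by (simp add: g_def True)
    next
      case False
      then show ?thesis using that by (auto simp: g_def)
    qed
    show "(case (y, s, a, e) of (y, s, x, e) \<Rightarrow> h2 (y, s, (2 - 4 * N x, \<pi> x), e)) = h3 (y, s, a, e)"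
      if "y \<in> topspace Y" "s \<in> {0..1}" "a \<in> topspace (subtopology P ?P2)" "e \<in> topspace E" "b = p e" for y s a e
    proof (cases "N a = 1/2")
      case True
      then show ?thesis using that h2 \<pi>S[of a] by (simp add: h3_def True)
    next
      case False
      then show ?thesis using that by (auto simp: h3_def)
    qed
  qed
  have p3: "solution (subtopology P ?P3) \<psi> g h3"
  proof (rule solution_cong[OF std])
    show "b = \<psi> a" if "a \<in> topspace (subtopology P ?P3)" for a
      using that \<psi>b by auto
    show "(case (y, a) of (y, x) \<Rightarrow> gs y) = g (y, a)"
      if "y \<in> topspace Y" "a \<in> topspace (subtopology P ?P3)" for y a
    proof (cases "N a = 1/4")
      case True
      then show ?thesis using that g2 \<pi>S[of a] by (simp add: g_def True)
    next
      case False
      then show ?thesis using that by (auto simp: g_def)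
    qed
    show "(case (y, s, a, e) of (y, s, x, e) \<Rightarrow> hs (y, s, e)) = h3 (y, s, a, e)"
      if "y \<in> topspace Y" "s \<in> {0..1}" "a \<in> topspace (subtopology P ?P3)" "e \<in> topspace E" "b = p e" for y s a e
    proof (cases "N a = 1/4")
      case True
      then show ?thesis using that h2 \<pi>S[of a] by (simp add: h3_def True)
    next
      case False
      then show ?thesis using that by (auto simp: h3_def)
    qed
  qed
  have p23: "solution (subtopology P ?P23) \<psi> g h3"
  proof (rule solution_closed_cover[where ?S1.0 = ?P2 and ?S2.0 = ?P3])
    show "solution (subtopology (subtopology P ?P23) ?P2) \<psi> g h3"
      "solution (subtopology (subtopology P ?P23) ?P3) \<psi> g h3"
    proof -
      have e: "?P23 \<inter> ?P2 = ?P2" "?P23 \<inter> ?P3 = ?P3" by auto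
      show "solution (subtopology (subtopology P ?P23) ?P2) \<psi> g h3"
        "solution (subtopology (subtopology P ?P23) ?P3) \<psi> g h3"
        unfolding subtopology_subtopology e by (rule p2, rule p3)
    qed
    show "closedin (subtopology P ?P23) ?P2" "closedin (subtopology P ?P23) ?P3"
      using cl[of "{1/4..1/2}"] cl[of "{..1/4}"] by (auto intro!: closedin_subset_topspace)
  qed (use \<psi> in \<open>auto intro: continuous_map_from_subtopology\<close>)
  have solP: "solution P \<psi> g h3"
    by (rule solution_closed_cover[OF \<psi> cl cl _ p1 p23]) auto
  \<comment> \<open>The pieces solve the problem over \<psi> instead of
    \<open>\<Omega> (1, -)\<close>. This homotopy leads from the latter to \<psi>: both maxima
    decrease with time and reach their final values together, at time
    \<open>1 - max (1/2) (N x)\<close>. That time is \<open>?l\<close>; it vanishes on the sphere,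
    so the solution is kept there.\<close>
  let ?\<Phi> = "\<lambda>z. \<Omega> (max (1 - 2 * fst z) (max 0 (2 * N (snd z) - 1)),
      \<kappa> (max (max (1/2) (N (snd z))) (1 - fst z), snd z))"
  let ?l = "\<lambda>x. 1 - max (1/2) (N x)"
  have \<Phi>: "continuous_map (prod_topology \<I> P) B ?\<Phi>"
  proof -
    have t: "continuous_map (prod_topology \<I> P) euclideanreal fst"
      using continuous_map_fst[of \<I> P] by (simp add: continuous_map_into_top_of_set)
    have n: "continuous_map (prod_topology \<I> P) euclideanreal (\<lambda>z. N (snd z))"
      using continuous_map_compose[OF continuous_map_snd N] by (simp add: o_def)
    show ?thesis
    proof (rule \<Omega>c)
      show "continuous_map (prod_topology \<I> P) P (\<lambda>z. \<kappa> (max (max (1/2) (N (snd z))) (1 - fst z), snd z))"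
      proof (rule \<kappa>c)
        show "max (max (1/2) (N (snd z))) (1 - fst z) \<in> {1/4..1}" if "z \<in> topspace (prod_topology \<I> P)" for z
          using that N01[of "snd z"] by (auto simp: max_def)
      qed (use t n in \<open>auto intro!: continuous_map_real_intros continuous_map_snd\<close>)
    qed (use N01 t n in \<open>auto intro!: continuous_map_real_intros\<close>)
  qed
  obtain h where sol': "solution P (\<lambda>x. ?\<Phi> (0, x)) g h"
    and h: "\<And>y s x e. ?l x = 0 \<Longrightarrow> s \<in> {0..1} \<Longrightarrow> x \<in> topspace P \<Longrightarrow> e \<in> topspace E \<Longrightarrow> ?\<Phi> (0, x) = p e \<Longrightarrow>
       h (y, s, x, e) = h3 (y, s, x, e)"
  proof (rule solution_transport[OF \<Phi>, where l = ?l])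
    show "continuous_map P euclideanreal ?l"
      by (intro continuous_map_real_intros N) auto
    show "?l x \<in> {0..1}" if "x \<in> topspace P" for x using N01[OF that] by auto
    show "?\<Phi> (?l x, x) = ?\<Phi> (1, x)" if "x \<in> topspace P" for x
    proof -
      have "max (1 - 2 * ?l x) (max 0 (2 * N x - 1)) = max (1 - 2 * 1) (max 0 (2 * N x - 1))"
        "max (max (1/2) (N x)) (1 - ?l x) = max (max (1/2) (N x)) (1 - 1)"
        using N01[OF that] by auto
      then show ?thesis unfolding fst_conv snd_conv by presburger
    qed
    show "solution P (\<lambda>x. ?\<Phi> (1, x)) g h3"
      by (rule solution_cong[OF solP]) (auto simp: \<psi>_def max_def)
  qed blast
  have \<Phi>0: "?\<Phi> (0, x) = \<Omega> (1, x)" if "x \<in> topspace P" for x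
  proof -
    have "max (1 - 2 * 0) (max 0 (2 * N x - 1)) = 1" "max (max (1/2) (N x)) (1 - 0) = 1"
      using N01[OF that] by auto
    then show ?thesis unfolding fst_conv snd_conv by (simp add: \<kappa>1[OF that])
  qed
  show thesis
  proof (rule that[of g h])
    show "solution P (\<lambda>x. \<Omega> (1, x)) g h"
      by (rule solution_cong[OF sol']) (use \<Phi>0 in auto)
    show "g (y, x) = g0 (y, x)" if "x \<in> topspace P" "N x = 1" for y x
      using that \<kappa>1 by (simp add: g_def \<pi>_def)
    show "h (y, s, x, e) = h0 (y, s, x, e)"
      if "s \<in> {0..1}" "x \<in> topspace P" "N x = 1" "e \<in> topspace E" "\<Omega> (1, x) = p e" for y s x e
    proof -
      have "h (y, s, x, e) = h3 (y, s, x, e)"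
        by (rule h) (use that \<Phi>0[OF that(2)] in auto)
      also have "\<dots> = h0 (y, s, x, e)"
        using that \<kappa>1 h1[of s x e y] by (simp add: h3_def \<pi>_def S_def)
      finally show ?thesis .
    qed
  qed
qed

end

subsection \<open>CW complexes\<close>

lemma topspace_closed_disc:
  "topspace (closed_disc n) = {x. (\<forall>i\<ge>n. x i = 0) \<and> (\<Sum>i<n. (x i)\<^sup>2) \<le> 1}"
  by (auto simp: closed_disc_def topspace_Euclidean_space)

lemma topspace_closed_disc_split: "topspace (closed_disc n) = disc_interior n \<union> disc_boundary n"
  by (auto simp: closed_disc_def disc_interior_def disc_boundary_def)

lemma continuous_map_closed_disc_component: "continuous_map (closed_disc n) euclideanreal (\<lambda>x. x i)"
  unfolding closed_disc_def Euclidean_space_def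
  by (intro continuous_map_from_subtopology continuous_map_product_projection) auto

lemma continuous_map_into_closed_disc:
  assumes "\<And>i. continuous_map Q euclideanreal (\<lambda>z. x z i)"
    and "\<And>z. z \<in> topspace Q \<Longrightarrow> x z \<in> topspace (closed_disc n)"
  shows "continuous_map Q (closed_disc n) x"
  using assms by (auto simp: topspace_closed_disc closed_disc_def Euclidean_space_def continuous_map_in_subtopology
      continuous_map_componentwise_UNIV image_subset_iff)

lemma compact_space_closed_disc: "compact_space (closed_disc n)"
proof -
  have le: "\<bar>x i\<bar> \<le> 1" if "x \<in> topspace (closed_disc n)" for x i
  proof (cases "i < n")
    case True
    then have "(x i)\<^sup>2 \<le> (\<Sum>i<n. (x i)\<^sup>2)"
      by (intro member_le_sum) auto
    then have "(x i)\<^sup>2 \<le> 1" using that by (simp add: topspace_closed_disc)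
    then show ?thesis by (simp add: abs_square_le_1)
  qed (use that in \<open>simp add: topspace_closed_disc\<close>)
  have "closedin (Euclidean_space n) {x \<in> topspace (Euclidean_space n). (\<Sum>i<n. (x i)\<^sup>2) \<in> {..1}}"
  proof (rule closedin_continuous_map_preimage[where Y = euclideanreal])
    show "continuous_map (Euclidean_space n) euclideanreal (\<lambda>x. \<Sum>i<n. (x i)\<^sup>2)"
      unfolding Euclidean_space_def
      by (intro continuous_intros continuous_map_from_subtopology continuous_map_product_projection) auto
  qed simp
  also have "{x \<in> topspace (Euclidean_space n). (\<Sum>i<n. (x i)\<^sup>2) \<in> {..1}} = topspace (closed_disc n)"
    by (auto simp: closed_disc_def)
  finally have "closedin (powertop_real UNIV) (topspace (closed_disc n))"
    unfolding Euclidean_space_def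
    by (rule closedin_trans_full) (use closedin_Euclidean_space[of n] in \<open>simp add: topspace_Euclidean_space\<close>)
  moreover have "compactin (powertop_real UNIV) (PiE UNIV (\<lambda>_. {-1..1}))"
    by (simp add: compactin_PiE)
  moreover have "topspace (closed_disc n) \<subseteq> PiE UNIV (\<lambda>_. {-1..1})"
    using le by (force simp: abs_le_iff)
  ultimately have "compactin (powertop_real UNIV) (topspace (closed_disc n))"
    using closed_compactin by blast
  moreover have "closed_disc n = subtopology (powertop_real UNIV) (topspace (closed_disc n))"
    by (auto simp: closed_disc_def Euclidean_space_def subtopology_subtopology intro!: arg_cong[where f = "subtopology _"])
  ultimately show ?thesis
    by (metis compact_space_subtopology)
qed

lemma scaled_closed_disc:
  assumes "x \<in> topspace (closed_disc n)" "\<bar>c\<bar> \<le> 1"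
  shows "(\<lambda>i. c * x i) \<in> topspace (closed_disc n)"
proof -
  have "(\<Sum>i<n. (c * x i)\<^sup>2) = c\<^sup>2 * (\<Sum>i<n. (x i)\<^sup>2)"
    by (simp add: power_mult_distrib sum_distrib_left)
  also have "\<dots> \<le> 1"
    using assms by (intro mult_le_one) (auto simp: topspace_closed_disc abs_square_le_1 sum_nonneg)
  finally show ?thesis
    using assms by (simp add: topspace_closed_disc)
qed

lemma contractible_space_closed_disc: "contractible_space (closed_disc n)"
proof -
  let ?h = "\<lambda>(t :: real, x :: nat \<Rightarrow> real) i. (1 - t) * x i"
  have "continuous_map (prod_topology \<I> (closed_disc n)) (closed_disc n) ?h"
  proof (rule continuous_map_into_closed_disc)
    fix i
    have "continuous_map (prod_topology \<I> (closed_disc n)) euclideanreal (\<lambda>z. (1 - fst z) * snd z i)"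
      using continuous_map_compose[OF continuous_map_snd continuous_map_closed_disc_component, of \<I> n i]
        continuous_map_fst[of \<I> "closed_disc n"]
      by (intro continuous_map_real_mult continuous_map_diff) (auto simp: o_def continuous_map_into_top_of_set)
    then show "continuous_map (prod_topology \<I> (closed_disc n)) euclideanreal (\<lambda>z. ?h z i)"
      by (simp add: case_prod_unfold)
  next
    fix z assume "z \<in> topspace (prod_topology \<I> (closed_disc n))"
    then show "?h z \<in> topspace (closed_disc n)"
      using scaled_closed_disc[of "snd z" n "1 - fst z"] by auto
  qed
  then have "homotopic_with (\<lambda>_. True) (closed_disc n) (closed_disc n) id (\<lambda>_ _. 0)"
    unfolding homotopic_with_def by (intro exI[of _ ?h]) auto
  then show ?thesis
    unfolding contractible_space_def by blast
qed

section \<open>Point-set topology of CW complexes\<close>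

locale cw =
  fixes K :: "'k topology" and C :: "(nat \<times> ((nat \<Rightarrow> real) \<Rightarrow> 'k)) set"
  assumes Hausdorff: "Hausdorff_space K" and cells: "CW_structure K C"
begin

lemma characteristic_map: "(n, \<phi>) \<in> C \<Longrightarrow> continuous_map (closed_disc n) K \<phi>"
  using cells by (auto simp: CW_structure_def)

lemma inj_on_cell:
  assumes "(n, \<phi>) \<in> C"
  shows "inj_on \<phi> (disc_interior n)"
proof -
  have "homeomorphic_map (subtopology (closed_disc n) (disc_interior n)) (subtopology K (\<phi> ` disc_interior n)) \<phi>"
    using cells assms by (auto simp: CW_structure_def)
  moreover have "topspace (subtopology (closed_disc n) (disc_interior n)) = disc_interior n"
    by (auto simp: topspace_closed_disc_split)
  ultimately show ?thesis
    by (metis homeomorphic_imp_injective_map)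
qed

lemma cell_boundary:
  assumes "(n, \<phi>) \<in> C"
  obtains D where "D \<subseteq> C" "finite D" "\<And>m \<psi>. (m, \<psi>) \<in> D \<Longrightarrow> m < n"
    "\<phi> ` disc_boundary n \<subseteq> (\<Union>(m, \<psi>) \<in> D. \<psi> ` disc_interior m)"
  using cells assms unfolding CW_structure_def by (fastforce intro: that)

lemma cells_disjoint:
  assumes "(n, \<phi>) \<in> C" "(m, \<psi>) \<in> C" "k \<in> \<phi> ` disc_interior n" "k \<in> \<psi> ` disc_interior m"
  shows "(n, \<phi>) = (m, \<psi>)"
proof (rule ccontr)
  assume "(n, \<phi>) \<noteq> (m, \<psi>)"
  moreover have "disjoint_family_on (\<lambda>(n, \<phi>). \<phi> ` disc_interior n) C"
    using cells by (simp add: CW_structure_def)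
  ultimately have "(\<phi> ` disc_interior n) \<inter> (\<psi> ` disc_interior m) = {}"
    using assms unfolding disjoint_family_on_def by fastforce
  then show False using assms by blast
qed

lemma topspace_eq: "topspace K = (\<Union>(n, \<phi>) \<in> C. \<phi> ` disc_interior n)"
  using cells by (simp add: CW_structure_def)

lemma weak_topology:
  assumes "A \<subseteq> topspace K" "\<And>n \<phi>. (n, \<phi>) \<in> C \<Longrightarrow> closedin K (A \<inter> \<phi> ` topspace (closed_disc n))"
  shows "closedin K A"
proof -
  have "\<forall>A \<subseteq> topspace K. (\<forall>(n, \<phi>) \<in> C. closedin K (A \<inter> \<phi> ` topspace (closed_disc n))) \<longrightarrow> closedin K A"
    using cells unfolding CW_structure_def by (elim conjE)
  moreover have "\<forall>(n, \<phi>) \<in> C. closedin K (A \<inter> \<phi> ` topspace (closed_disc n))"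
    using assms(2) by auto
  ultimately show ?thesis using assms(1) by simp
qed

lemma compactin_closed_cell: "(n, \<phi>) \<in> C \<Longrightarrow> compactin K (\<phi> ` topspace (closed_disc n))"
  using image_compactin[OF _ characteristic_map] compact_space_closed_disc by (auto simp: compact_space_def)

lemma closedin_closed_cell: "(n, \<phi>) \<in> C \<Longrightarrow> closedin K (\<phi> ` topspace (closed_disc n))"
  using compactin_closed_cell compactin_imp_closedin[OF Hausdorff] by blast

lemma closed_cell_finite:
  assumes "(n, \<phi>) \<in> C"
  obtains D where "D \<subseteq> C" "finite D" "\<phi> ` topspace (closed_disc n) \<subseteq> (\<Union>(m, \<psi>) \<in> D. \<psi> ` disc_interior m)"
proof -
  obtain D where D: "D \<subseteq> C" "finite D" "\<phi> ` disc_boundary n \<subseteq> (\<Union>(m, \<psi>) \<in> D. \<psi> ` disc_interior m)"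
    using cell_boundary[OF assms] by metis
  show thesis
    by (rule that[of "insert (n, \<phi>) D"]) (use D assms in \<open>auto simp: topspace_closed_disc_split image_Un\<close>)
qed

text \<open>By closure finiteness a closed cell lies in finitely many open cells, so it meets
  \<open>A\<close> in finitely many points, and finite sets are closed. The weak topology does the
  rest.\<close>

lemma closedin_one_point_per_cell:
  assumes A: "A \<subseteq> topspace K"
    and one: "\<And>n \<phi> x y. (n, \<phi>) \<in> C \<Longrightarrow> x \<in> A \<Longrightarrow> y \<in> A \<Longrightarrow> x \<in> \<phi> ` disc_interior n \<Longrightarrow> y \<in> \<phi> ` disc_interior n \<Longrightarrow> x = y"
  shows "closedin K A"
proof (rule weak_topology[OF A])
  fix n \<phi> assume c: "(n, \<phi>) \<in> C"
  obtain D where D: "D \<subseteq> C" "finite D" "\<phi> ` topspace (closed_disc n) \<subseteq> (\<Union>(m, \<psi>) \<in> D. \<psi> ` disc_interior m)"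
    using closed_cell_finite[OF c] .
  have "finite (A \<inter> \<psi> ` disc_interior m)" if "(m, \<psi>) \<in> D" for m \<psi>
  proof (cases "A \<inter> \<psi> ` disc_interior m = {}")
    case False
    then obtain x where x: "x \<in> A \<inter> \<psi> ` disc_interior m" by blast
    have "A \<inter> \<psi> ` disc_interior m \<subseteq> {x}"
      using one[of m \<psi> _ x] that D(1) x by blast
    then show ?thesis using finite_subset by blast
  qed simp
  then have "finite (\<Union>(m, \<psi>) \<in> D. A \<inter> \<psi> ` disc_interior m)"
    using D(2) by auto
  moreover have "A \<inter> \<phi> ` topspace (closed_disc n) \<subseteq> (\<Union>(m, \<psi>) \<in> D. A \<inter> \<psi> ` disc_interior m)"
    using D(3) by fastforce
  ultimately have "finite (A \<inter> \<phi> ` topspace (closed_disc n))"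
    using finite_subset by blast
  then show "closedin K (A \<inter> \<phi> ` topspace (closed_disc n))"
    using A Hausdorff Hausdorff_imp_t1_space t1_space_closedin_finite by blast
qed

text \<open>Choose a point of \<open>A\<close> in every open cell that \<open>A\<close> meets. All
  subsets of the set of chosen points are closed, so it is a closed discrete subset of a compact set
  and therefore finite.\<close>

lemma compact_meets_finitely_many_cells:
  assumes A: "compactin K A"
  shows "finite {(n, \<phi>) \<in> C. \<phi> ` disc_interior n \<inter> A \<noteq> {}}"
proof -
  let ?D = "{(n, \<phi>) \<in> C. \<phi> ` disc_interior n \<inter> A \<noteq> {}}"
  define pt where "pt = (\<lambda>(n :: nat, \<phi>). SOME x. x \<in> \<phi> ` disc_interior n \<inter> A)"
  have pt: "pt (n, \<phi>) \<in> \<phi> ` disc_interior n \<inter> A" if "(n, \<phi>) \<in> ?D" for n \<phi>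
    using that some_in_eq[of "\<phi> ` disc_interior n \<inter> A"] by (simp add: pt_def)
  have AK: "A \<subseteq> topspace K" using A by (rule compactin_subset_topspace)
  have inj: "inj_on pt ?D"
  proof (rule inj_onI)
    fix c d assume c: "c \<in> ?D" and d: "d \<in> ?D" and "pt c = pt d"
    obtain n \<phi> m \<psi> where cd: "c = (n, \<phi>)" "d = (m, \<psi>)" by (metis surj_pair)
    show "c = d"
      unfolding cd by (rule cells_disjoint[of n \<phi> m \<psi> "pt c"])
        (use c d pt[of n \<phi>] pt[of m \<psi>] \<open>pt c = pt d\<close> in \<open>auto simp: cd\<close>)
  qed
  have cl: "closedin K S" if S: "S \<subseteq> pt ` ?D" for S
  proof (rule closedin_one_point_per_cell)
    show "S \<subseteq> topspace K" using S pt AK by blast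
    fix n \<phi> x y
    assume c: "(n, \<phi>) \<in> C" and x: "x \<in> S" "x \<in> \<phi> ` disc_interior n" and y: "y \<in> S" "y \<in> \<phi> ` disc_interior n"
    have *: "z = pt (n, \<phi>)" if z: "z \<in> S" "z \<in> \<phi> ` disc_interior n" for z
    proof -
      obtain m \<psi> where d: "(m, \<psi>) \<in> ?D" "z = pt (m, \<psi>)" using z(1) S by fastforce
      have "(m, \<psi>) = (n, \<phi>)"
        by (rule cells_disjoint[of m \<psi> n \<phi> z]) (use d pt[of m \<psi>] c z in auto)
      then show ?thesis using d by simp
    qed
    show "x = y" using *[OF x] *[OF y] by simp
  qed
  let ?S = "pt ` ?D"
  have SK: "?S \<subseteq> topspace K" using closedin_subset[OF cl[of ?S]] by simp
  have "compactin K ?S"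
    by (rule closed_compactin[OF A]) (use pt cl in auto)
  then have "compact_space (subtopology K ?S)"
    by (rule compact_space_subtopology)
  moreover have "discrete_topology ?S = subtopology K ?S"
    unfolding discrete_topology_unique
  proof (intro conjI ballI)
    show t: "topspace (subtopology K ?S) = ?S" by (rule topspace_subtopology_subset[OF SK])
    fix x assume "x \<in> ?S"
    have "closedin (subtopology K ?S) (?S - {x})"
      by (rule closedin_subset_topspace[OF cl]) auto
    then have "openin (subtopology K ?S) (?S - (?S - {x}))"
      unfolding closedin_def t by blast
    moreover have "?S - (?S - {x}) = {x}" using \<open>x \<in> ?S\<close> by blast
    ultimately show "openin (subtopology K ?S) {x}" by simp
  qed
  ultimately have "compact_space (discrete_topology ?S)" by simp
  then have "finite ?S" by (rule compact_space_discrete_topology[THEN iffD1])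
  then show ?thesis
    using finite_imageD[OF _ inj] by blast
qed

text \<open>A set that is closed on compact sets is closed on the closed cells, which are compact,
  and the weak topology tests nothing else.\<close>

lemma k_space: "k_space K"
  unfolding k_space
proof (intro allI impI)
  fix S assume S: "S \<subseteq> topspace K \<and> (\<forall>L. compactin K L \<longrightarrow> closedin (subtopology K L) (L \<inter> S))"
  show "closedin K S"
  proof (rule weak_topology)
    fix n \<phi> assume c: "(n, \<phi>) \<in> C"
    have "closedin (subtopology K (\<phi> ` topspace (closed_disc n))) (\<phi> ` topspace (closed_disc n) \<inter> S)"
      using S compactin_closed_cell[OF c] by blast
    from closedin_trans_full[OF this closedin_closed_cell[OF c]]
    show "closedin K (S \<inter> \<phi> ` topspace (closed_disc n))" by (simp add: Int_commute)
  qed (use S in blast)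
qed

text \<open>Closed cells are images of discs and so lie in single path components. By the weak
  topology every union of path components is closed, hence path components are clopen.\<close>

lemma path_connected:
  assumes "connected_space K"
  shows "path_connected_space K"
proof -
  have closed: "closedin K A"
    if A: "A \<subseteq> topspace K" and inv: "\<And>x y. path_component_of K x y \<Longrightarrow> x \<in> A \<longleftrightarrow> y \<in> A" for A
  proof (rule weak_topology[OF A])
    fix n \<phi> assume c: "(n, \<phi>) \<in> C"
    let ?D = "\<phi> ` topspace (closed_disc n)"
    have "path_connectedin K ?D"
      using path_connectedin_continuous_map_image[OF characteristic_map[OF c]]
        contractible_imp_path_connected_space[OF contractible_space_closed_disc]
      by (simp add: path_connectedin_topspace)
    then have "x \<in> A \<longleftrightarrow> y \<in> A" if "x \<in> ?D" "y \<in> ?D" for x y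
      using inv[of x y] that path_component_of[of K x y] by blast
    then have "A \<inter> ?D = {} \<or> A \<inter> ?D = ?D" by blast
    then show "closedin K (A \<inter> ?D)"
      using closedin_closed_cell[OF c] by auto
  qed
  have "path_component_of K x y" if x: "x \<in> topspace K" and y: "y \<in> topspace K" for x y
  proof -
    let ?A = "Collect (path_component_of K x)"
    have sub: "?A \<subseteq> topspace K" by (rule path_component_of_subset_topspace)
    have "closedin K ?A"
      by (rule closed[OF sub]) (auto intro: path_component_of_trans path_component_of_sym)
    moreover have "closedin K (topspace K - ?A)"
    proof (rule closed)
      fix a b assume "path_component_of K a b"
      moreover from this have "a \<in> topspace K" "b \<in> topspace K"
        by (auto simp: path_component_of_equiv)
      ultimately show "a \<in> topspace K - ?A \<longleftrightarrow> b \<in> topspace K - ?A"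
        by (auto intro: path_component_of_trans path_component_of_sym)
    qed auto
    ultimately have "openin K ?A \<and> closedin K ?A"
      using sub by (simp add: openin_closedin)
    moreover have "x \<in> ?A" using x by (simp add: path_component_of_refl)
    ultimately have "?A = topspace K"
      using assms unfolding connected_space_clopen_in by blast
    then show ?thesis using y by blast
  qed
  then show ?thesis
    by (simp add: path_connected_space_def path_component_of_def)
qed

text \<open>\<open>K\<close> carries a quotient topology of discs, but the product of a quotient map
  with an arbitrary \<open>Y\<close> need not be a quotient map. Over a compact \<open>A\<close>
  only finitely many cells matter, and over each of them the projection from the pullback of the
  disc is closed because the disc is compact; a continuous closed surjection is a quotient map
  whatever \<open>Y\<close> is.\<close>

lemma kcontinuous_cellwise:
  assumes \<kappa>: "continuous_map T K \<kappa>" and D: "D \<subseteq> C"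
    and cover: "\<kappa> ` topspace T \<subseteq> (\<Union>(n, \<phi>) \<in> D. \<phi> ` disc_interior n)"
    and h: "\<And>n \<phi>. (n, \<phi>) \<in> D \<Longrightarrow>
      kcontinuous Y (subtopology (prod_topology (closed_disc n) T) {(x, z). \<phi> x = \<kappa> z}) X (\<lambda>(y, x, z). h (y, z))"
  shows "kcontinuous Y T X h"
  unfolding kcontinuous_def
proof (intro allI impI)
  fix A assume A: "compactin T A"
  have AT: "A \<subseteq> topspace T" using A by (rule compactin_subset_topspace)
  let ?D = "{(n, \<phi>) \<in> D. \<phi> ` disc_interior n \<inter> \<kappa> ` A \<noteq> {}}"
  \<comment> \<open>The part of \<open>A\<close> over a closed cell: closed cells, unlike open ones,
    give a closed cover.\<close>
  define pc where "pc = (\<lambda>(n, \<phi>). {z \<in> topspace (subtopology T A). \<kappa> z \<in> \<phi> ` topspace (closed_disc n)})"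
  have TA: "continuous_map (subtopology T A) K \<kappa>"
    using \<kappa> by (rule continuous_map_from_subtopology)
  have fin: "finite ?D"
    by (rule finite_subset[OF _ compact_meets_finitely_many_cells[OF image_compactin[OF A \<kappa>]]]) (use D in auto)
  show "continuous_map (prod_topology Y (subtopology T A)) X h"
  proof (rule continuous_map_finite_closed_cover_right[where \<A> = "pc ` ?D"])
    show "finite (pc ` ?D)" using fin by blast
    show "topspace (subtopology T A) \<subseteq> \<Union> (pc ` ?D)"
    proof
      fix z assume z: "z \<in> topspace (subtopology T A)"
      then obtain n \<phi> where c: "(n, \<phi>) \<in> D" "\<kappa> z \<in> \<phi> ` disc_interior n" using cover by fastforce
      then have "z \<in> pc (n, \<phi>)" using z by (auto simp: pc_def topspace_closed_disc_split)
      moreover have "(n, \<phi>) \<in> ?D" using c z by auto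
      ultimately show "z \<in> \<Union> (pc ` ?D)" by blast
    qed
    fix S assume "S \<in> pc ` ?D"
    then obtain n \<phi> where c: "(n, \<phi>) \<in> D" and S: "S = pc (n, \<phi>)" by auto
    have cC: "(n, \<phi>) \<in> C" using c D by blast
    show clS: "closedin (subtopology T A) S"
      unfolding S pc_def using closedin_continuous_map_preimage[OF TA closedin_closed_cell[OF cC]] by simp
    then have SA: "S \<subseteq> A" using closedin_subset by fastforce
    have "compactin T S"
      using closedin_compact_space[OF compact_space_subtopology[OF A] clS] by (simp add: compactin_subtopology)
    then have compS: "compact_space (subtopology T S)" by (rule compact_space_subtopology)
    let ?TS = "subtopology T S"
    let ?M = "prod_topology (closed_disc n) (prod_topology Y ?TS)"
    let ?Q = "{w \<in> topspace ?M. \<phi> (fst w) = \<kappa> (snd (snd w))}"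
    let ?R = "{w \<in> topspace (prod_topology (closed_disc n) ?TS). \<phi> (fst w) = \<kappa> (snd w)}"
    have cQ: "closedin ?M ?Q"
      using continuous_map_compose[OF continuous_map_fst characteristic_map[OF cC]]
        continuous_map_compose[OF continuous_map_compose[OF continuous_map_snd continuous_map_snd]
          continuous_map_from_subtopology[OF \<kappa>]]
      by (intro closedin_continuous_maps_eq[OF Hausdorff]) (auto simp: o_def)
    have cR: "closedin (prod_topology (closed_disc n) ?TS) ?R"
      using continuous_map_compose[OF continuous_map_fst characteristic_map[OF cC]]
        continuous_map_compose[OF continuous_map_snd continuous_map_from_subtopology[OF \<kappa>]]
      by (intro closedin_continuous_maps_eq[OF Hausdorff]) (auto simp: o_def)
    let ?L = "subtopology (prod_topology (closed_disc n) T) {(x, z). \<phi> x = \<kappa> z}"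
    have "compactin (prod_topology (closed_disc n) ?TS) ?R"
      by (rule closedin_compact_space[OF _ cR])
        (simp add: compact_space_prod_topology compact_space_closed_disc compS)
    then have cR': "compactin ?L ?R"
      using SA by (auto simp: prod_topology_subtopology(2) compactin_subtopology)
    \<comment> \<open>Closedness of the projection along the compact disc survives restriction to
      the closed set \<open>?Q\<close>.\<close>
    have q: "quotient_map (subtopology ?M ?Q) (prod_topology Y ?TS) snd"
    proof (rule continuous_closed_imp_quotient_map)
      show "continuous_map (subtopology ?M ?Q) (prod_topology Y ?TS) snd"
        by (simp add: continuous_map_from_subtopology continuous_map_snd)
      show "closed_map (subtopology ?M ?Q) (prod_topology Y ?TS) snd"
        unfolding closed_map_def
        using closedin_trans_full[OF _ cQ] closed_map_snd[OF compact_space_closed_disc, of n "prod_topology Y ?TS"]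
        by (auto simp: closed_map_def)
      show "snd ` topspace (subtopology ?M ?Q) = topspace (prod_topology Y ?TS)"
      proof
        show "topspace (prod_topology Y ?TS) \<subseteq> snd ` topspace (subtopology ?M ?Q)"
        proof
          fix w assume w: "w \<in> topspace (prod_topology Y ?TS)"
          then have "\<kappa> (snd w) \<in> \<phi> ` topspace (closed_disc n)" by (auto simp: S pc_def)
          then obtain x where "x \<in> topspace (closed_disc n)" "\<phi> x = \<kappa> (snd w)" by (metis imageE)
          then show "w \<in> snd ` topspace (subtopology ?M ?Q)" using w by (intro image_eqI[of _ _ "(x, w)"]) auto
        qed
      qed auto
    qed
    have "continuous_map (subtopology ?M ?Q) (subtopology ?L ?R) (\<lambda>w. (fst w, snd (snd w)))"
      using continuous_map_compose[OF continuous_map_snd continuous_map_snd, of "closed_disc n" Y ?TS]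
      by (auto simp: continuous_map_in_subtopology continuous_map_pairwise o_def
          intro!: continuous_map_from_subtopology continuous_map_fst)
    moreover have "continuous_map (subtopology ?M ?Q) Y (\<lambda>w. fst (snd w))"
      using continuous_map_compose[OF continuous_map_snd continuous_map_fst, of "closed_disc n" Y ?TS]
      by (auto simp: o_def intro!: continuous_map_from_subtopology)
    ultimately have "continuous_map (subtopology ?M ?Q) X
        (\<lambda>w. (\<lambda>(y, x, z). h (y, z)) (fst (snd w), fst w, snd (snd w)))"
      by (intro continuous_map_compose_Pair[OF kcontinuousD[OF h[OF c] cR']])
    then have "continuous_map (subtopology ?M ?Q) X (h \<circ> snd)"
      by (simp add: o_def)
    from continuous_compose_quotient_map[OF q this]
    have "continuous_map (prod_topology Y ?TS) X h" .
    moreover have "subtopology (subtopology T A) S = ?TS"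
      using SA by (simp add: subtopology_subtopology Int_absorb1)
    ultimately show "continuous_map (prod_topology Y (subtopology (subtopology T A) S)) X h" by simp
  qed
qed

end

subsection \<open>Induction over the cells\<close>

lemma continuous_map_sum_squares:
  "continuous_map (closed_disc n) euclideanreal (\<lambda>x. \<Sum>i<n. (x i)\<^sup>2)"
  by (intro continuous_map_sum continuous_map_real_pow continuous_map_closed_disc_component) auto

context fibration_problem
begin

text \<open>\<open>J\<close> will be \<open>{0}\<close> for the existence and \<open>{-1..1}\<close> for the uniqueness of solutions.\<close>

lemma extend_solution_over_cell:
  fixes J :: "real set"
  assumes b: "b \<in> topspace B" and F: "F = subtopology E {e \<in> topspace E. p e = b}"
    and he: "homotopy_equivalence_map X (mapping_space (kification F) X) (constant_map F)"
    and B: "path_connected_space B"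
    and J: "closed J" "J \<subseteq> {-1..1}" "\<And>j s. j \<in> J \<Longrightarrow> \<bar>j\<bar> \<le> s \<Longrightarrow> 0 < s \<Longrightarrow> s \<le> 1 \<Longrightarrow> j / s \<in> J"
    and \<phi>: "continuous_map (closed_disc n) B \<phi>"
    and sol: "solution (subtopology (prod_topology (closed_disc n) (top_of_set J))
                 {(x, j). x \<in> disc_boundary n \<or> \<bar>j\<bar> = 1}) (\<lambda>(x, j). \<phi> x) g0 h0"
  obtains g h where "solution (prod_topology (closed_disc n) (top_of_set J)) (\<lambda>(x, j). \<phi> x) g h"
    "\<And>y x j. y \<in> topspace Y \<Longrightarrow> x \<in> topspace (closed_disc n) \<Longrightarrow> j \<in> J \<Longrightarrow> x \<in> disc_boundary n \<or> \<bar>j\<bar> = 1 \<Longrightarrow>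
       g (y, x, j) = g0 (y, x, j)"
    "\<And>y s x j e. y \<in> topspace Y \<Longrightarrow> s \<in> {0..1} \<Longrightarrow> x \<in> topspace (closed_disc n) \<Longrightarrow> j \<in> J \<Longrightarrow>
       x \<in> disc_boundary n \<or> \<bar>j\<bar> = 1 \<Longrightarrow> e \<in> topspace E \<Longrightarrow> \<phi> x = p e \<Longrightarrow>
       h (y, s, (x, j), e) = h0 (y, s, (x, j), e)"
proof -
  let ?P = "prod_topology (closed_disc n) (top_of_set J)"
  define r where "r = (\<lambda>x :: nat \<Rightarrow> real. sqrt (\<Sum>i<n. (x i)\<^sup>2))"
  \<comment> \<open>The norm whose unit sphere in the product of disc and \<open>J\<close> consists
    of the boundary of the disc times \<open>J\<close> and the ends with last coordinate 1 or -1,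
    which is the set where a solution is given. For \<open>n = 0\<close> and \<open>J = {0}\<close>
    that set is empty.\<close>
  define N where "N = (\<lambda>z :: (nat \<Rightarrow> real) \<times> real. max (r (fst z)) \<bar>snd z\<bar>)"
  \<comment> \<open>The denominator is at least \<open>N z\<close>, so the quotient stays in the
    unit ball; its last coordinate stays in \<open>J\<close> by the closure under such divisions
    assumed in \<open>J(3)\<close>.\<close>
  define \<kappa> where "\<kappa> = (\<lambda>(s, z). (\<lambda>i. fst z i / max (N z) s, snd z / max (N z) s))"
  have cr: "continuous_map (closed_disc n) euclideanreal r"
    unfolding r_def by (intro continuous_map_sqrt continuous_map_sum_squares)
  have r01: "0 \<le> r x" "r x \<le> 1" if "x \<in> topspace (closed_disc n)" for x
    using that by (auto simp: r_def topspace_closed_disc sum_nonneg)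
  have bd: "x \<in> disc_boundary n \<longleftrightarrow> r x = 1" if "x \<in> topspace (closed_disc n)" for x
    using that by (auto simp: r_def disc_boundary_def closed_disc_def)
  have rdiv: "r (\<lambda>i. x i / m) = r x / m" if "0 < m" for x m
    using that by (simp add: r_def power_divide real_sqrt_divide flip: sum_divide_distrib)
  have disc: "x \<in> topspace (closed_disc n) \<longleftrightarrow> (\<forall>i\<ge>n. x i = 0) \<and> r x \<le> 1" for x
    by (simp add: r_def topspace_closed_disc)
  have P: "compact_space ?P"
    using J(1,2) by (simp add: compact_space_prod_topology compact_space_closed_disc compact_space_subtopology
        bounded_subset[OF bounded_closed_interval] compact_eq_bounded_closed)
  have cN: "continuous_map ?P euclideanreal N"
    unfolding N_def
    using continuous_map_compose[OF continuous_map_fst cr, of "top_of_set J"] continuous_map_snd[of "closed_disc n" "top_of_set J"]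
    by (intro continuous_map_real_intros) (auto simp: o_def continuous_map_into_top_of_set)
  have N01: "N z \<in> {0..1}" if "z \<in> topspace ?P" for z
    using that r01[of "fst z"] J(2) by (force simp: N_def)
  have N1: "N (x, j) = 1 \<longleftrightarrow> x \<in> disc_boundary n \<or> \<bar>j\<bar> = 1" if "x \<in> topspace (closed_disc n)" "j \<in> J" for x j
  proof -
    have "\<bar>j\<bar> \<le> 1" using subsetD[OF J(2) that(2)] by auto
    then show ?thesis using bd[OF that(1)] r01[OF that(1)] by (auto simp: N_def max_def)
  qed
  have \<kappa>P: "\<kappa> (s, z) \<in> topspace ?P" if "s \<in> {1/4..1}" "z \<in> topspace ?P" for s z
  proof -
    have m: "0 < max (N z) s" "max (N z) s \<le> 1" "\<bar>snd z\<bar> \<le> max (N z) s" "r (fst z) \<le> max (N z) s"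
      using that N01[OF that(2)] by (auto simp: N_def)
    then have "snd z / max (N z) s \<in> J"
      using that by (intro J(3)) auto
    moreover have "(\<lambda>i. fst z i / max (N z) s) \<in> topspace (closed_disc n)"
      using that m unfolding disc rdiv[OF m(1)] by (auto simp: disc)
    ultimately show ?thesis by (simp add: \<kappa>_def)
  qed
  have c\<kappa>: "continuous_map (prod_topology (top_of_set {1/4..1}) ?P) ?P \<kappa>"
  proof -
    let ?Q = "prod_topology (top_of_set {1/4..1::real}) ?P"
    have s: "continuous_map ?Q euclideanreal fst"
      using continuous_map_fst[of "top_of_set {1/4..1::real}" ?P] by (simp add: continuous_map_into_top_of_set)
    have m: "continuous_map ?Q euclideanreal (\<lambda>w. max (N (snd w)) (fst w))"
      using continuous_map_compose[OF continuous_map_snd cN] s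
      by (intro continuous_map_real_intros) (auto simp: o_def)
    have m0: "max (N (snd w)) (fst w) \<noteq> 0" if "w \<in> topspace ?Q" for w
      using that N01[of "snd w"] by auto
    have 1: "continuous_map ?Q (closed_disc n) (\<lambda>w i. fst (snd w) i / max (N (snd w)) (fst w))"
    proof (rule continuous_map_into_closed_disc)
      fix i
      have "continuous_map ?Q euclideanreal (\<lambda>w. fst (snd w) i)"
        using continuous_map_compose[OF continuous_map_fst_component[OF continuous_map_snd] continuous_map_closed_disc_component]
        by (fastforce simp: o_def)
      then show "continuous_map ?Q euclideanreal (\<lambda>w. fst (snd w) i / max (N (snd w)) (fst w))"
        by (rule continuous_map_real_divide[OF _ m m0])
      show "(\<lambda>i. fst (snd w) i / max (N (snd w)) (fst w)) \<in> topspace (closed_disc n)" if "w \<in> topspace ?Q" for w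
        using \<kappa>P[of "fst w" "snd w"] that by (auto simp: \<kappa>_def)
    qed
    have "continuous_map ?Q euclideanreal (\<lambda>w. snd (snd w))"
      using continuous_map_snd_component[OF continuous_map_snd, of "top_of_set {1/4..1::real}" "closed_disc n" "top_of_set J"]
      by (simp add: continuous_map_into_top_of_set)
    then have "continuous_map ?Q euclideanreal (\<lambda>w. snd (snd w) / max (N (snd w)) (fst w))"
      by (rule continuous_map_real_divide[OF _ m m0])
    then have 2: "continuous_map ?Q (top_of_set J) (\<lambda>w. snd (snd w) / max (N (snd w)) (fst w))"
      unfolding continuous_map_into_top_of_set
    proof (rule conjI, intro Pi_I)
      fix w assume "w \<in> topspace ?Q"
      then show "snd (snd w) / max (N (snd w)) (fst w) \<in> J"
        using \<kappa>P[of "fst w" "snd w"] by (auto simp: \<kappa>_def)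
    qed
    show ?thesis
      using 1 2 by (simp add: \<kappa>_def case_prod_unfold continuous_map_pairwise o_def)
  qed
  have \<kappa>1: "\<kappa> (1, z) = z" if "z \<in> topspace ?P" for z
    using N01[OF that] by (simp add: \<kappa>_def max_absorb2)
  have \<kappa>N: "N (\<kappa> (N z, z)) = 1" if "z \<in> topspace ?P" "1/4 \<le> N z" for z
  proof -
    have "0 < N z" using that by auto
    then have "N (\<kappa> (N z, z)) = max (r (fst z) / N z) (\<bar>snd z\<bar> / N z)"
      by (subst N_def) (simp add: \<kappa>_def rdiv)
    also have "\<dots> = max (r (fst z)) \<bar>snd z\<bar> / N z"
      using \<open>0 < N z\<close> by (auto simp: max_def divide_le_cancel)
    also have "\<dots> = 1" using \<open>0 < N z\<close> by (simp add: N_def)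
    finally show ?thesis .
  qed
  \<comment> \<open>\<phi> is null-homotopic since the disc is contractible, and path connectedness
    of \<open>B\<close> moves the constant value to \<open>b\<close>. Reversed, this is the
    null-homotopy \<Omega>, which starts at \<open>b\<close>.\<close>
  obtain c where c: "homotopic_with (\<lambda>_. True) (closed_disc n) B \<phi> (\<lambda>_. c)"
    using nullhomotopic_from_contractible_space[OF \<phi> contractible_space_closed_disc] .
  have "(\<lambda>_. 0) \<in> topspace (closed_disc n)" by (simp add: topspace_closed_disc)
  then have cB: "c \<in> topspace B"
    using homotopic_with_imp_continuous_maps[OF c] by (auto simp: continuous_map_def)
  have "path_component_of B c b"
    using B cB b by (auto simp: path_connected_space_def path_component_of_def)
  then have "homotopic_with (\<lambda>_. True) (closed_disc n) B (\<lambda>_. c) (\<lambda>_. b)"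
    by (simp add: homotopic_constant_maps)
  with c have "homotopic_with (\<lambda>_. True) (closed_disc n) B \<phi> (\<lambda>_. b)"
    by (rule homotopic_with_trans)
  then have "homotopic_with (\<lambda>_. True) ?P B (\<phi> \<circ> fst) ((\<lambda>_. b) \<circ> fst)"
    by (rule homotopic_with_compose_continuous_map_right[OF _ continuous_map_fst]) simp
  then have "homotopic_with (\<lambda>_. True) ?P B ((\<lambda>_. b) \<circ> fst) (\<phi> \<circ> fst)"
    by (simp add: homotopic_with_sym)
  then obtain \<Omega> where \<Omega>: "continuous_map (prod_topology \<I> ?P) B \<Omega>"
    and \<Omega>0: "\<And>z. \<Omega> (0, z) = b" and \<Omega>1: "\<And>z. \<Omega> (1, z) = \<phi> (fst z)"
    by (auto simp: homotopic_with_def)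
  have \<Omega>': "(\<lambda>z. \<Omega> (1, z)) = (\<lambda>(x, j). \<phi> x)"
    by (auto simp: \<Omega>1)
  have "subtopology ?P {(x, j). x \<in> disc_boundary n \<or> \<bar>j\<bar> = 1} = subtopology ?P {z. N z = 1}"
    by (subst (1 2) subtopology_restrict[symmetric]) (auto simp: N1 intro!: arg_cong[where f = "subtopology _"])
  then have "solution (subtopology ?P {z. N z = 1}) (\<lambda>z. \<Omega> (1, z)) g0 h0"
    using sol by (simp add: \<Omega>')
  from extend_solution_from_sphere[OF b F he P cN N01 c\<kappa> \<kappa>1 \<kappa>N \<Omega> \<Omega>0 this]
  obtain g h where "solution ?P (\<lambda>z. \<Omega> (1, z)) g h"
    and g: "\<And>y z. y \<in> topspace Y \<Longrightarrow> z \<in> topspace ?P \<Longrightarrow> N z = 1 \<Longrightarrow> g (y, z) = g0 (y, z)"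
    and h: "\<And>y s z e. y \<in> topspace Y \<Longrightarrow> s \<in> {0..1} \<Longrightarrow> z \<in> topspace ?P \<Longrightarrow> N z = 1 \<Longrightarrow> e \<in> topspace E \<Longrightarrow>
       \<Omega> (1, z) = p e \<Longrightarrow> h (y, s, z, e) = h0 (y, s, z, e)"
    by blast
  then show thesis
    unfolding \<Omega>' by (rule that[of g h]) (auto simp: \<Omega>1 N1)
qed

end

locale cw_fibration_problem = fibration_problem E B p X Y u + cw K C
  for E :: "'e topology" and B :: "'b topology" and p :: "'e \<Rightarrow> 'b"
    and X :: "'x topology" and Y :: "'y topology" and u :: "'y \<times> 'e \<Rightarrow> 'x"
    and K :: "'k topology" and C :: "(nat \<times> ((nat \<Rightarrow> real) \<Rightarrow> 'k)) set" +
  fixes a :: "'k \<Rightarrow> 'b" and J :: "real set"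
  assumes a: "continuous_map K B a"
    and J: "closed J" "J \<subseteq> {-1..1}" "\<And>j s. j \<in> J \<Longrightarrow> \<bar>j\<bar> \<le> s \<Longrightarrow> 0 < s \<Longrightarrow> s \<le> 1 \<Longrightarrow> j / s \<in> J"
begin

text \<open>\<open>g\<close> and \<open>h\<close> are plain functions on all of \<open>K\<close>,
  and only their pullback along the characteristic map has to be a solution. Continuity on
  \<open>K\<close> itself is left to \<open>solution_cellwise\<close>, so the induction over
  dimensions handles total functions instead of maps on skeleta.\<close>

definition cell_solution :: "nat \<Rightarrow> ((nat \<Rightarrow> real) \<Rightarrow> 'k) \<Rightarrow> ('y \<times> 'k \<times> real \<Rightarrow> 'x) \<Rightarrow>
    ('y \<times> real \<times> ('k \<times> real) \<times> 'e \<Rightarrow> 'x) \<Rightarrow> bool" where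
  "cell_solution n \<phi> g h \<longleftrightarrow>
     solution (prod_topology (closed_disc n) (top_of_set J)) (\<lambda>(x, j). a (\<phi> x))
       (\<lambda>(y, x, j). g (y, \<phi> x, j)) (\<lambda>(y, s, (x, j), e). h (y, s, (\<phi> x, j), e))"

text \<open>Both components are glued by \<open>kcontinuous_cellwise\<close>, the second one on the
  pullback of \<open>E\<close>, which maps to \<open>K\<close> through its base point. The set
  \<open>D\<close> is all of \<open>C\<close> for the whole complex and the set of cells of lower
  dimension for the boundary of a cell.\<close>

lemma solution_cellwise:
  assumes \<kappa>: "continuous_map A K \<kappa>" and \<iota>: "continuous_map A (top_of_set J) \<iota>" and D: "D \<subseteq> C"
    and cover: "\<kappa> ` topspace A \<subseteq> (\<Union>(n, \<phi>) \<in> D. \<phi> ` disc_interior n)"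
    and sol: "\<And>n \<phi>. (n, \<phi>) \<in> D \<Longrightarrow> cell_solution n \<phi> g h"
  shows "solution A (\<lambda>z. a (\<kappa> z)) (\<lambda>(y, z). g (y, \<kappa> z, \<iota> z)) (\<lambda>(y, s, z, e). h (y, s, (\<kappa> z, \<iota> z), e))"
  unfolding solution_def
proof (intro conjI ballI impI)
  show "continuous_map A B (\<lambda>z. a (\<kappa> z))"
    using continuous_map_compose[OF \<kappa> a] by (simp add: o_def)
  show "kcontinuous Y A X (\<lambda>(y, z). g (y, \<kappa> z, \<iota> z))"
  proof (rule kcontinuous_cellwise[OF \<kappa> D cover])
    fix n \<phi> assume c: "(n, \<phi>) \<in> D"
    let ?L = "subtopology (prod_topology (closed_disc n) A) {(x, z). \<phi> x = \<kappa> z}"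
    have "kcontinuous Y (prod_topology (closed_disc n) (top_of_set J)) X (\<lambda>(y, x, j). g (y, \<phi> x, j))"
      using sol[OF c] by (simp add: cell_solution_def solution_def)
    moreover have "continuous_map ?L (prod_topology (closed_disc n) (top_of_set J)) (\<lambda>w. (fst w, \<iota> (snd w)))"
      using continuous_map_compose[OF continuous_map_snd \<iota>]
      by (auto simp: continuous_map_pairwise o_def intro!: continuous_map_from_subtopology continuous_map_fst)
    ultimately have "kcontinuous Y ?L X (\<lambda>(y, w). (\<lambda>(y, x, j). g (y, \<phi> x, j)) (y, (fst w, \<iota> (snd w))))"
      by (rule kcontinuous_compose_right)
    then show "kcontinuous Y ?L X (\<lambda>(y, x, z). (\<lambda>(y, z). g (y, \<kappa> z, \<iota> z)) (y, z))"
      by (rule kcontinuous_cong) auto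
  qed
  let ?T = "prod_topology \<I> (total A (\<lambda>z. a (\<kappa> z)))"
  have prA: "continuous_map ?T A (\<lambda>w. fst (snd w))" and prE: "continuous_map ?T E (\<lambda>w. snd (snd w))"
    by (rule continuous_map_total[OF continuous_map_snd])+
  have \<kappa>T: "continuous_map ?T K (\<lambda>w. \<kappa> (fst (snd w)))"
    using continuous_map_compose[OF prA \<kappa>] by (simp add: o_def)
  show "kcontinuous Y ?T X (\<lambda>(y, s, z, e). h (y, s, (\<kappa> z, \<iota> z), e))"
  proof (rule kcontinuous_cellwise[OF \<kappa>T D])
    show "(\<lambda>w. \<kappa> (fst (snd w))) ` topspace ?T \<subseteq> (\<Union>(n, \<phi>) \<in> D. \<phi> ` disc_interior n)"
      using cover by auto
    fix n \<phi> assume c: "(n, \<phi>) \<in> D"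
    let ?L = "subtopology (prod_topology (closed_disc n) ?T) {(x, w). \<phi> x = \<kappa> (fst (snd w))}"
    let ?DJ = "prod_topology (closed_disc n) (top_of_set J)"
    let ?q = "\<lambda>w. (fst (snd w), (fst w, \<iota> (fst (snd (snd w)))), snd (snd (snd w)))"
    have "kcontinuous Y (prod_topology \<I> (total ?DJ (\<lambda>(x, j). a (\<phi> x)))) X
        (\<lambda>(y, s, (x, j), e). h (y, s, (\<phi> x, j), e))"
      using sol[OF c] by (simp add: cell_solution_def solution_def)
    moreover have "continuous_map ?L (prod_topology \<I> (total ?DJ (\<lambda>(x, j). a (\<phi> x)))) ?q"
      unfolding continuous_map_pairwise[of _ \<I>] o_def fst_conv snd_conv
    proof (intro conjI continuous_map_into_total)
      have "continuous_map (prod_topology (closed_disc n) ?T) (top_of_set J) (\<lambda>w. \<iota> (fst (snd (snd w))))"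
        using continuous_map_compose[OF continuous_map_snd continuous_map_compose[OF prA \<iota>]] by (simp add: o_def)
      then show "continuous_map ?L ?DJ (\<lambda>w. (fst w, \<iota> (fst (snd (snd w)))))"
        by (auto simp: continuous_map_pairwise o_def intro!: continuous_map_from_subtopology continuous_map_fst)
      show "continuous_map ?L E (\<lambda>w. snd (snd (snd w)))"
        using continuous_map_compose[OF continuous_map_snd prE] by (auto simp: o_def intro!: continuous_map_from_subtopology)
      show "continuous_map ?L \<I> (\<lambda>w. fst (snd w))"
        by (intro continuous_map_from_subtopology continuous_map_fst_component[OF continuous_map_snd])
    qed auto
    ultimately have "kcontinuous Y ?L X (\<lambda>(y, w). (\<lambda>(y, s, (x, j), e). h (y, s, (\<phi> x, j), e)) (y, ?q w))"
      by (rule kcontinuous_compose_right)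
    then show "kcontinuous Y ?L X (\<lambda>(y, x, w). (\<lambda>(y, s, z, e). h (y, s, (\<kappa> z, \<iota> z), e)) (y, w))"
      by (rule kcontinuous_cong) auto
  qed
  fix y z e assume y: "y \<in> topspace Y" and z: "z \<in> topspace A" and e: "e \<in> topspace E" "a (\<kappa> z) = p e"
  obtain n \<phi> x where c: "(n, \<phi>) \<in> D" and x: "x \<in> disc_interior n" "\<kappa> z = \<phi> x"
    using cover z by fastforce
  have "x \<in> topspace (closed_disc n)" "\<iota> z \<in> J"
    using x(1) \<iota> z by (auto simp: topspace_closed_disc_split continuous_map_into_top_of_set)
  then show "(\<lambda>(y, s, z, e). h (y, s, (\<kappa> z, \<iota> z), e)) (y, 0, z, e) = (\<lambda>(y, z). g (y, \<kappa> z, \<iota> z)) (y, z)"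
    "(\<lambda>(y, s, z, e). h (y, s, (\<kappa> z, \<iota> z), e)) (y, 1, z, e) = u (y, e)"
    using sol[OF c] y e x by (auto simp: cell_solution_def solution_def)
qed


text \<open>For \<open>J = {-1..1}\<close> this fixes both ends of the cylinder over
  \<open>K\<close>; for \<open>J = {0}\<close> it demands nothing.\<close>

definition prescribed :: "('y \<times> 'k \<times> real \<Rightarrow> 'x) \<Rightarrow> ('y \<times> real \<times> ('k \<times> real) \<times> 'e \<Rightarrow> 'x) \<Rightarrow>
    ('y \<times> 'k \<times> real \<Rightarrow> 'x) \<Rightarrow> ('y \<times> real \<times> ('k \<times> real) \<times> 'e \<Rightarrow> 'x) \<Rightarrow> bool" where
  "prescribed g0 h0 g h \<longleftrightarrow>
     (\<forall>y \<in> topspace Y. \<forall>k \<in> topspace K. \<forall>j \<in> J. \<bar>j\<bar> = 1 \<longrightarrow>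
        g (y, k, j) = g0 (y, k, j) \<and>
        (\<forall>s \<in> {0..1}. \<forall>e \<in> topspace E. a k = p e \<longrightarrow> h (y, s, (k, j), e) = h0 (y, s, (k, j), e)))"

lemma lower_cells:
  assumes "(n, \<phi>) \<in> C" "x \<in> disc_boundary n"
  obtains m \<psi> where "(m, \<psi>) \<in> C" "m < n" "\<phi> x \<in> \<psi> ` disc_interior m"
proof -
  obtain D where D: "D \<subseteq> C" "\<And>m \<psi>. (m, \<psi>) \<in> D \<Longrightarrow> m < n"
    "\<phi> ` disc_boundary n \<subseteq> (\<Union>(m, \<psi>) \<in> D. \<psi> ` disc_interior m)"
    using cell_boundary[OF assms(1)] by metis
  have "\<phi> x \<in> (\<Union>(m, \<psi>) \<in> D. \<psi> ` disc_interior m)"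
    by (rule subsetD[OF D(3) imageI[OF assms(2)]])
  then obtain m \<psi> where "(m, \<psi>) \<in> D" "\<phi> x \<in> \<psi> ` disc_interior m" by auto
  then show thesis using D(1,2) that by blast
qed

text \<open>The set on which the solution is given splits into two closed parts: over the boundary
  of the disc it comes from the lower cells, at the ends of \<open>J\<close> from the prescribed
  solution.\<close>

lemma extend_over_one_cell:
  assumes b: "b \<in> topspace B" and F: "F = subtopology E {e \<in> topspace E. p e = b}"
    and he: "homotopy_equivalence_map X (mapping_space (kification F) X) (constant_map F)"
    and B: "path_connected_space B"
    and sol0: "solution (prod_topology K (top_of_set {j \<in> J. \<bar>j\<bar> = 1})) (\<lambda>(k, j). a k) g0 h0"
    and pre: "prescribed g0 h0 g h"
    and lower: "\<And>m \<psi>. (m, \<psi>) \<in> C \<Longrightarrow> m < n \<Longrightarrow> cell_solution m \<psi> g h"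
    and c: "(n, \<phi>) \<in> C"
  obtains g' h' where "solution (prod_topology (closed_disc n) (top_of_set J)) (\<lambda>(x, j). a (\<phi> x)) g' h'"
    "\<And>y x j. y \<in> topspace Y \<Longrightarrow> x \<in> topspace (closed_disc n) \<Longrightarrow> j \<in> J \<Longrightarrow> x \<in> disc_boundary n \<or> \<bar>j\<bar> = 1 \<Longrightarrow>
       g' (y, x, j) = g (y, \<phi> x, j)"
    "\<And>y s x j e. y \<in> topspace Y \<Longrightarrow> s \<in> {0..1} \<Longrightarrow> x \<in> topspace (closed_disc n) \<Longrightarrow> j \<in> J \<Longrightarrow>
       x \<in> disc_boundary n \<or> \<bar>j\<bar> = 1 \<Longrightarrow> e \<in> topspace E \<Longrightarrow> a (\<phi> x) = p e \<Longrightarrow>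
       h' (y, s, (x, j), e) = h (y, s, (\<phi> x, j), e)"
proof -
  let ?P = "prod_topology (closed_disc n) (top_of_set J)"
  let ?S = "{(x, j). x \<in> disc_boundary n \<or> \<bar>j\<bar> = 1}"
  let ?g = "\<lambda>(y, x, j). g (y, \<phi> x, j)" and ?h = "\<lambda>(y, s, (x, j), e). h (y, s, (\<phi> x, j), e)"
  have \<phi>: "continuous_map (closed_disc n) K \<phi>" using characteristic_map[OF c] .
  have \<phi>K: "\<phi> x \<in> topspace K" if "x \<in> topspace (closed_disc n)" for x
    using \<phi> that by (auto simp: continuous_map_def)
  have a\<phi>: "continuous_map (closed_disc n) B (\<lambda>x. a (\<phi> x))"
    using continuous_map_compose[OF \<phi> a] by (simp add: o_def)
  have fP: "continuous_map ?P K (\<lambda>z. \<phi> (fst z))"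
    using continuous_map_compose[OF continuous_map_fst \<phi>] by (simp add: o_def)
  let ?S1 = "{z \<in> topspace ?P. fst z \<in> disc_boundary n}"
  let ?S2 = "{z \<in> topspace ?P. snd z \<in> {j. \<bar>j\<bar> = 1}}"
  have S1: "closedin ?P ?S1"
  proof -
    have "continuous_map ?P euclideanreal (\<lambda>z. \<Sum>i<n. (fst z i)\<^sup>2)"
      using continuous_map_compose[OF continuous_map_fst continuous_map_sum_squares] by (simp add: o_def)
    then have "closedin ?P {z \<in> topspace ?P. (\<Sum>i<n. (fst z i)\<^sup>2) \<in> {1}}"
      by (rule closedin_continuous_map_preimage) simp
    also have "{z \<in> topspace ?P. (\<Sum>i<n. (fst z i)\<^sup>2) \<in> {1}} = ?S1"
      by (auto simp: disc_boundary_def closed_disc_def)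
    finally show ?thesis .
  qed
  have S2: "closedin ?P ?S2"
  proof (rule closedin_continuous_map_preimage[where Y = euclideanreal])
    show "continuous_map ?P euclideanreal snd"
      using continuous_map_snd[of "closed_disc n" "top_of_set J"] by (simp add: continuous_map_into_top_of_set)
    have "{j :: real. \<bar>j\<bar> = 1} = {1, -1}" by auto
    then show "closedin euclideanreal {j :: real. \<bar>j\<bar> = 1}" by simp
  qed
  have sol1: "solution (subtopology ?P ?S1) (\<lambda>(x, j). a (\<phi> x)) ?g ?h"
  proof -
    have "solution (subtopology ?P ?S1) (\<lambda>z. a (\<phi> (fst z))) (\<lambda>(y, z). g (y, \<phi> (fst z), snd z))
        (\<lambda>(y, s, z, e). h (y, s, (\<phi> (fst z), snd z), e))"
    proof (rule solution_cellwise[where D = "{(m, \<psi>) \<in> C. m < n}"])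
      show "continuous_map (subtopology ?P ?S1) K (\<lambda>z. \<phi> (fst z))"
        by (rule continuous_map_from_subtopology[OF fP])
      show "continuous_map (subtopology ?P ?S1) (top_of_set J) snd"
        by (rule continuous_map_from_subtopology[OF continuous_map_snd])
      show "(\<lambda>z. \<phi> (fst z)) ` topspace (subtopology ?P ?S1)
          \<subseteq> (\<Union>(m, \<psi>) \<in> {(m, \<psi>) \<in> C. m < n}. \<psi> ` disc_interior m)"
      proof (rule image_subsetI)
        fix z assume "z \<in> topspace (subtopology ?P ?S1)"
        then have "fst z \<in> disc_boundary n" by auto
        from lower_cells[OF c this] obtain m \<psi> where "(m, \<psi>) \<in> C" "m < n" "\<phi> (fst z) \<in> \<psi> ` disc_interior m" .
        then show "\<phi> (fst z) \<in> (\<Union>(m, \<psi>) \<in> {(m, \<psi>) \<in> C. m < n}. \<psi> ` disc_interior m)"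
          by (intro UN_I[of "(m, \<psi>)"]) auto
      qed
    qed (use lower in auto)
    then show ?thesis by (rule solution_cong) auto
  qed
  have sol2: "solution (subtopology ?P ?S2) (\<lambda>(x, j). a (\<phi> x)) ?g ?h"
  proof -
    have "continuous_map (subtopology ?P ?S2) euclideanreal snd"
      using continuous_map_snd[of "closed_disc n" "top_of_set J"]
      by (auto simp: continuous_map_into_top_of_set continuous_map_from_subtopology)
    then have "continuous_map (subtopology ?P ?S2) (prod_topology K (top_of_set {j \<in> J. \<bar>j\<bar> = 1}))
        (\<lambda>z. (\<phi> (fst z), snd z))"
      using continuous_map_from_subtopology[OF fP]
      by (auto simp: continuous_map_pairwise o_def continuous_map_into_top_of_set)
    from solution_compose[OF sol0 this] show ?thesis
      by (rule solution_cong) (use pre \<phi>K in \<open>auto simp: prescribed_def\<close>)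
  qed
  have "solution (subtopology ?P (?S1 \<union> ?S2)) (\<lambda>(x, j). a (\<phi> x)) ?g ?h"
  proof (rule solution_closed_cover[where ?S1.0 = ?S1 and ?S2.0 = ?S2])
    have e: "(?S1 \<union> ?S2) \<inter> ?S1 = ?S1" "(?S1 \<union> ?S2) \<inter> ?S2 = ?S2" by blast+
    show "solution (subtopology (subtopology ?P (?S1 \<union> ?S2)) ?S1) (\<lambda>(x, j). a (\<phi> x)) ?g ?h"
      "solution (subtopology (subtopology ?P (?S1 \<union> ?S2)) ?S2) (\<lambda>(x, j). a (\<phi> x)) ?g ?h"
      unfolding subtopology_subtopology e by (rule sol1, rule sol2)
    show "continuous_map (subtopology ?P (?S1 \<union> ?S2)) B (\<lambda>(x, j). a (\<phi> x))"
      using continuous_map_from_subtopology[OF continuous_map_compose[OF continuous_map_fst a\<phi>]]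
      by (simp add: o_def case_prod_unfold)
    show "closedin (subtopology ?P (?S1 \<union> ?S2)) ?S1" "closedin (subtopology ?P (?S1 \<union> ?S2)) ?S2"
      by (rule closedin_subset_topspace[OF S1], blast, rule closedin_subset_topspace[OF S2], blast)
  qed auto
  moreover have "subtopology ?P (?S1 \<union> ?S2) = subtopology ?P ?S"
    by (subst (2) subtopology_restrict[symmetric]) (auto intro!: arg_cong[where f = "subtopology _"])
  ultimately have "solution (subtopology ?P ?S) (\<lambda>(x, j). a (\<phi> x)) ?g ?h" by simp
  from extend_solution_over_cell[OF b F he B J a\<phi> this]
  obtain g' h' where "solution ?P (\<lambda>(x, j). a (\<phi> x)) g' h'"
    and "\<And>y x j. y \<in> topspace Y \<Longrightarrow> x \<in> topspace (closed_disc n) \<Longrightarrow> j \<in> J \<Longrightarrow> x \<in> disc_boundary n \<or> \<bar>j\<bar> = 1 \<Longrightarrow>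
       g' (y, x, j) = ?g (y, x, j)"
    and "\<And>y s x j e. y \<in> topspace Y \<Longrightarrow> s \<in> {0..1} \<Longrightarrow> x \<in> topspace (closed_disc n) \<Longrightarrow> j \<in> J \<Longrightarrow>
       x \<in> disc_boundary n \<or> \<bar>j\<bar> = 1 \<Longrightarrow> e \<in> topspace E \<Longrightarrow> a (\<phi> x) = p e \<Longrightarrow>
       h' (y, s, (x, j), e) = ?h (y, s, (x, j), e)"
    by blast
  then show thesis by (intro that[of g' h']) auto
qed

text \<open>All \<open>n\<close>-cells are treated at once. Open cells are disjoint, so overwriting
  the functions on the open \<open>n\<close>-cells affects no other cell; strict agreement on the
  boundaries makes the new values fit on whole closed discs.\<close>

lemma extend_over_skeleton:
  assumes b: "b \<in> topspace B" and F: "F = subtopology E {e \<in> topspace E. p e = b}"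
    and he: "homotopy_equivalence_map X (mapping_space (kification F) X) (constant_map F)"
    and B: "path_connected_space B"
    and sol0: "solution (prod_topology K (top_of_set {j \<in> J. \<bar>j\<bar> = 1})) (\<lambda>(k, j). a k) g0 h0"
    and pre: "prescribed g0 h0 g h"
    and lower: "\<And>m \<psi>. (m, \<psi>) \<in> C \<Longrightarrow> m < n \<Longrightarrow> cell_solution m \<psi> g h"
  obtains g' h' where "prescribed g0 h0 g' h'"
    "\<And>m \<psi>. (m, \<psi>) \<in> C \<Longrightarrow> m < Suc n \<Longrightarrow> cell_solution m \<psi> g' h'"
    "\<And>m \<psi> k. (m, \<psi>) \<in> C \<Longrightarrow> m < n \<Longrightarrow> k \<in> \<psi> ` disc_interior m \<Longrightarrow>
       (\<forall>y j. g' (y, k, j) = g (y, k, j)) \<and> (\<forall>y s j e. h' (y, s, (k, j), e) = h (y, s, (k, j), e))"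
proof -
  define good where "good = (\<lambda>\<phi> gc hc.
      solution (prod_topology (closed_disc n) (top_of_set J)) (\<lambda>(x, j). a (\<phi> x)) gc hc \<and>
      (\<forall>y \<in> topspace Y. \<forall>x \<in> topspace (closed_disc n). \<forall>j \<in> J. x \<in> disc_boundary n \<or> \<bar>j\<bar> = 1 \<longrightarrow>
         gc (y, x, j) = g (y, \<phi> x, j) \<and>
         (\<forall>s \<in> {0..1}. \<forall>e \<in> topspace E. a (\<phi> x) = p e \<longrightarrow> hc (y, s, (x, j), e) = h (y, s, (\<phi> x, j), e))))"
  have "\<exists>gc hc. good \<phi> gc hc" if "(n, \<phi>) \<in> C" for \<phi>
    by (rule extend_over_one_cell[OF b F he B sol0 pre lower that], assumption, assumption)
      (unfold good_def, blast)
  then obtain gc hc where good: "\<And>\<phi>. (n, \<phi>) \<in> C \<Longrightarrow> good \<phi> (gc \<phi>) (hc \<phi>)"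
    by metis
  have gc0: "\<And>\<phi>. (n, \<phi>) \<in> C \<Longrightarrow>
      solution (prod_topology (closed_disc n) (top_of_set J)) (\<lambda>(x, j). a (\<phi> x)) (gc \<phi>) (hc \<phi>)"
    and gc: "\<And>\<phi> y x j. (n, \<phi>) \<in> C \<Longrightarrow> y \<in> topspace Y \<Longrightarrow> x \<in> topspace (closed_disc n) \<Longrightarrow> j \<in> J \<Longrightarrow>
      x \<in> disc_boundary n \<or> \<bar>j\<bar> = 1 \<Longrightarrow> gc \<phi> (y, x, j) = g (y, \<phi> x, j)"
    and hc: "\<And>\<phi> y s x j e. (n, \<phi>) \<in> C \<Longrightarrow> y \<in> topspace Y \<Longrightarrow> s \<in> {0..1} \<Longrightarrow> x \<in> topspace (closed_disc n) \<Longrightarrow> j \<in> J \<Longrightarrow>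
      x \<in> disc_boundary n \<or> \<bar>j\<bar> = 1 \<Longrightarrow> e \<in> topspace E \<Longrightarrow> a (\<phi> x) = p e \<Longrightarrow>
      hc \<phi> (y, s, (x, j), e) = h (y, s, (\<phi> x, j), e)"
    using good unfolding good_def by blast+
  define top where "top = (\<lambda>k. \<exists>\<phi>. (n, \<phi>) \<in> C \<and> k \<in> \<phi> ` disc_interior n)"
  \<comment> \<open>\<open>cf k\<close> will be the only characteristic map whose open
    \<open>n\<close>-cell contains \<open>k\<close>, and \<open>pt k\<close> the only point of the
    open disc above \<open>k\<close>.\<close>
  define cf where "cf = (\<lambda>k. SOME \<phi>. (n, \<phi>) \<in> C \<and> k \<in> \<phi> ` disc_interior n)"
  define pt where "pt = (\<lambda>k. inv_into (disc_interior n) (cf k) k)"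
  define g' where "g' = (\<lambda>(y, k, j). if top k then gc (cf k) (y, pt k, j) else g (y, k, j))"
  define h' where "h' = (\<lambda>(y, s, (k, j), e). if top k then hc (cf k) (y, s, (pt k, j), e) else h (y, s, (k, j), e))"
  have interior: "top (\<phi> x)" "cf (\<phi> x) = \<phi>" "pt (\<phi> x) = x" if "(n, \<phi>) \<in> C" "x \<in> disc_interior n" for \<phi> x
  proof -
    show "top (\<phi> x)" using that by (auto simp: top_def)
    then have "(n, cf (\<phi> x)) \<in> C \<and> \<phi> x \<in> cf (\<phi> x) ` disc_interior n"
      unfolding top_def cf_def by (rule someI_ex)
    then show cf: "cf (\<phi> x) = \<phi>"
      using cells_disjoint[of n "cf (\<phi> x)" n \<phi> "\<phi> x"] that by auto
    show "pt (\<phi> x) = x"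
      unfolding pt_def cf using inj_on_cell[OF that(1)] that(2) by (rule inv_into_f_f)
  qed
  have low: "\<not> top k" if "(m, \<psi>) \<in> C" "m < n" "k \<in> \<psi> ` disc_interior m" for m \<psi> k
    using that cells_disjoint[of m \<psi> n _ k] by (auto simp: top_def)
  have old: "(\<forall>y j. g' (y, k, j) = g (y, k, j)) \<and> (\<forall>y s j e. h' (y, s, (k, j), e) = h (y, s, (k, j), e))"
    if "(m, \<psi>) \<in> C" "m < n" "k \<in> \<psi> ` disc_interior m" for m \<psi> k
    using low[OF that] by (simp add: g'_def h'_def)
  \<comment> \<open>A boundary point of a cell lies in an open cell of lower dimension, so its
    values are not overwritten, even for an \<open>n\<close>-cell.\<close>
  have old': "(\<forall>y j. g' (y, \<psi> x, j) = g (y, \<psi> x, j)) \<and> (\<forall>y s j e. h' (y, s, (\<psi> x, j), e) = h (y, s, (\<psi> x, j), e))"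
    if m: "(m, \<psi>) \<in> C" and x: "x \<in> topspace (closed_disc m)" and *: "m < n \<or> m = n \<and> x \<in> disc_boundary m" for m \<psi> x
  proof (cases "x \<in> disc_boundary m")
    case True
    from lower_cells[OF m True] obtain l \<xi> where "(l, \<xi>) \<in> C" "l < m" "\<psi> x \<in> \<xi> ` disc_interior l" .
    then show ?thesis using old[of l \<xi> "\<psi> x"] * by auto
  next
    case False
    then have "\<psi> x \<in> \<psi> ` disc_interior m" using x by (auto simp: topspace_closed_disc_split)
    then show ?thesis using old[OF m] False * by blast
  qed
  show thesis
  proof (rule that[of g' h'])
    show "prescribed g0 h0 g' h'"
      unfolding prescribed_def
    proof (intro ballI impI)
      fix y k j assume y: "y \<in> topspace Y" and k: "k \<in> topspace K" and j: "j \<in> J" "\<bar>j\<bar> = 1"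
      show "g' (y, k, j) = g0 (y, k, j) \<and>
        (\<forall>s \<in> {0..1}. \<forall>e \<in> topspace E. a k = p e \<longrightarrow> h' (y, s, (k, j), e) = h0 (y, s, (k, j), e))"
      proof (cases "top k")
        case True
        then obtain \<phi> x where \<phi>: "(n, \<phi>) \<in> C" "x \<in> disc_interior n" "k = \<phi> x" by (auto simp: top_def)
        have xD: "x \<in> topspace (closed_disc n)" using \<phi>(2) by (simp add: topspace_closed_disc_split)
        have "g' (y, k, j) = g (y, k, j)"
          using gc[OF \<phi>(1) y xD j(1)] interior[OF \<phi>(1,2)] j(2) by (simp add: g'_def \<phi>(3))
        moreover have "h' (y, s, (k, j), e) = h (y, s, (k, j), e)"
          if "s \<in> {0..1}" "e \<in> topspace E" "a k = p e" for s e
          using hc[OF \<phi>(1) y that(1) xD j(1) _ that(2)] interior[OF \<phi>(1,2)] j(2) that(3) by (simp add: h'_def \<phi>(3))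
        ultimately show ?thesis using pre y k j by (simp add: prescribed_def)
      next
        case False
        then show ?thesis using pre y k j by (simp add: prescribed_def g'_def h'_def)
      qed
    qed
    show "cell_solution m \<psi> g' h'" if m: "(m, \<psi>) \<in> C" "m < Suc n" for m \<psi>
    proof (cases "m < n")
      case True
      show ?thesis
        using lower[OF m(1) True] unfolding cell_solution_def
        by (rule solution_cong) (use old'[OF m(1)] True in auto)
    next
      case False
      then have [simp]: "m = n" using m(2) by simp
      have \<psi>: "(n, \<psi>) \<in> C" using m by simp
      have eq: "gc \<psi> (y, x, j) = g' (y, \<psi> x, j)"
        if "y \<in> topspace Y" "x \<in> topspace (closed_disc n)" "j \<in> J" for y x j
      proof (cases "x \<in> disc_boundary n")
        case True
        then show ?thesis using gc[OF \<psi> that] old'[OF \<psi> that(2)] by simp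
      next
        case False
        then have "x \<in> disc_interior n" using that(2) by (simp add: topspace_closed_disc_split)
        then show ?thesis using interior[OF \<psi>, of x] by (simp add: g'_def)
      qed
      have eqh: "hc \<psi> (y, s, (x, j), e) = h' (y, s, (\<psi> x, j), e)"
        if "y \<in> topspace Y" "s \<in> {0..1}" "x \<in> topspace (closed_disc n)" "j \<in> J" "e \<in> topspace E" "a (\<psi> x) = p e"
        for y s x j e
      proof (cases "x \<in> disc_boundary n")
        case True
        then show ?thesis using hc[OF \<psi> that(1-4) _ that(5,6)] old'[OF \<psi> that(3)] by simp
      next
        case False
        then have "x \<in> disc_interior n" using that(3) by (simp add: topspace_closed_disc_split)
        then show ?thesis using interior[OF \<psi>, of x] by (simp add: h'_def)
      qed
      show ?thesis
        using gc0[OF \<psi>] unfolding cell_solution_def \<open>m = n\<close>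
        by (rule solution_cong) (use eq eqh in auto)
    qed
  qed (rule old)
qed

text \<open>The invariant at stage \<open>n\<close> concerns the cells of dimension below
  \<open>n\<close>, and later stages keep the values there. The stages thus have a pointwise limit,
  and \<open>solution_cellwise\<close> turns it into a solution.\<close>

theorem extend_solution_over_complex:
  assumes b: "b \<in> topspace B" and F: "F = subtopology E {e \<in> topspace E. p e = b}"
    and he: "homotopy_equivalence_map X (mapping_space (kification F) X) (constant_map F)"
    and B: "path_connected_space B"
    and sol0: "solution (prod_topology K (top_of_set {j \<in> J. \<bar>j\<bar> = 1})) (\<lambda>(k, j). a k) g0 h0"
  obtains g h where "solution (prod_topology K (top_of_set J)) (\<lambda>(k, j). a k) g h" "prescribed g0 h0 g h"
proof -
  let ?Inv = "\<lambda>n gh. prescribed g0 h0 (fst gh) (snd gh) \<and>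
     (\<forall>m \<psi>. (m, \<psi>) \<in> C \<longrightarrow> m < n \<longrightarrow> cell_solution m \<psi> (fst gh) (snd gh))"
  let ?Ext = "\<lambda>n gh gh'. \<forall>m \<psi> k. (m, \<psi>) \<in> C \<longrightarrow> m < n \<longrightarrow> k \<in> \<psi> ` disc_interior m \<longrightarrow>
       (\<forall>y j. fst gh' (y, k, j) = fst gh (y, k, j)) \<and> (\<forall>y s j e. snd gh' (y, s, (k, j), e) = snd gh (y, s, (k, j), e))"
  have "\<exists>f. \<forall>n. ?Inv n (f n) \<and> ?Ext n (f n) (f (Suc n))"
  proof (rule dependent_nat_choice)
    \<comment> \<open>At stage 0 there are no cells to consider, so the prescribed functions
      themselves will do.\<close>
    show "\<exists>gh. ?Inv 0 gh"
      by (intro exI[of _ "(g0, h0)"]) (simp add: prescribed_def)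
    fix gh n assume inv: "?Inv n gh"
    show "\<exists>gh'. ?Inv (Suc n) gh' \<and> ?Ext n gh gh'"
    proof (rule extend_over_skeleton[OF b F he B sol0, of "fst gh" "snd gh" n])
      fix g' h' assume "prescribed g0 h0 g' h'"
        "\<And>m \<psi>. (m, \<psi>) \<in> C \<Longrightarrow> m < Suc n \<Longrightarrow> cell_solution m \<psi> g' h'"
        "\<And>m \<psi> k. (m, \<psi>) \<in> C \<Longrightarrow> m < n \<Longrightarrow> k \<in> \<psi> ` disc_interior m \<Longrightarrow>
       (\<forall>y j. g' (y, k, j) = fst gh (y, k, j)) \<and> (\<forall>y s j e. h' (y, s, (k, j), e) = snd gh (y, s, (k, j), e))"
      then show ?thesis
        by (intro exI[of _ "(g', h')"]) simp
    qed (use inv in auto)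
  qed
  then obtain f where inv: "\<And>n. ?Inv n (f n)" and ext: "\<And>n. ?Ext n (f n) (f (Suc n))" by metis
  define dim where "dim = (\<lambda>k. SOME n. \<exists>\<phi>. (n, \<phi>) \<in> C \<and> k \<in> \<phi> ` disc_interior n)"
  have dim: "dim k = n" if "(n, \<phi>) \<in> C" "k \<in> \<phi> ` disc_interior n" for n \<phi> k
  proof -
    have "\<exists>\<psi>. (dim k, \<psi>) \<in> C \<and> k \<in> \<psi> ` disc_interior (dim k)"
      unfolding dim_def by (rule someI_ex) (use that in blast)
    then show ?thesis using cells_disjoint[OF that(1) _ that(2)] by blast
  qed
  \<comment> \<open>A point of an open cell of dimension \<open>dim k\<close> gets its final value
    in passing from stage \<open>dim k\<close> to stage \<open>Suc (dim k)\<close>.\<close>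
  define g where "g = (\<lambda>(y, k, j). fst (f (Suc (dim k))) (y, k, j))"
  define h where "h = (\<lambda>(y, s, (k, j), e). snd (f (Suc (dim k))) (y, s, (k, j), e))"
  have stable: "(\<forall>y j. fst (f m) (y, k, j) = g (y, k, j)) \<and> (\<forall>y s j e. snd (f m) (y, s, (k, j), e) = h (y, s, (k, j), e))"
    if c: "(n, \<phi>) \<in> C" "k \<in> \<phi> ` disc_interior n" and m: "Suc n \<le> m" for n \<phi> k m
    using m
  proof (induction m rule: dec_induct)
    case base
    then show ?case by (simp add: g_def h_def dim[OF c])
  next
    case (step m)
    then show ?case using ext[of m, rule_format, of n \<phi> k] c by simp
  qed
  have cell: "cell_solution n \<phi> g h" if c: "(n, \<phi>) \<in> C" for n \<phi>
  proof -
    have eq: "(\<forall>y j. fst (f (Suc n)) (y, \<phi> x, j) = g (y, \<phi> x, j)) \<and>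
        (\<forall>y s j e. snd (f (Suc n)) (y, s, (\<phi> x, j), e) = h (y, s, (\<phi> x, j), e))"
      if "x \<in> topspace (closed_disc n)" for x
    proof (cases "x \<in> disc_boundary n")
      case True
      from lower_cells[OF c True] obtain l \<xi> where "(l, \<xi>) \<in> C" "l < n" "\<phi> x \<in> \<xi> ` disc_interior l" .
      then show ?thesis using stable[of l \<xi> "\<phi> x" "Suc n"] by simp
    next
      case False
      then have "\<phi> x \<in> \<phi> ` disc_interior n" using that by (auto simp: topspace_closed_disc_split)
      then show ?thesis using stable[OF c] by blast
    qed
    have "cell_solution n \<phi> (fst (f (Suc n))) (snd (f (Suc n)))"
      using inv[of "Suc n"] c by simp
    then show ?thesis
      unfolding cell_solution_def by (rule solution_cong) (use eq in auto)
  qed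
  have "solution (prod_topology K (top_of_set J)) (\<lambda>z. a (fst z)) (\<lambda>(y, z). g (y, fst z, snd z))
      (\<lambda>(y, s, z, e). h (y, s, (fst z, snd z), e))"
    by (rule solution_cellwise[OF continuous_map_fst continuous_map_snd subset_refl])
      (use cell in \<open>auto simp: topspace_eq\<close>)
  then have "solution (prod_topology K (top_of_set J)) (\<lambda>(k, j). a k) g h"
    by (rule solution_cong) auto
  moreover have "prescribed g0 h0 g h"
    using inv by (auto simp: prescribed_def g_def h_def)
  ultimately show thesis by (rule that)
qed

end

subsection \<open>Function spaces\<close>

lemma homotopic_withI:
  assumes "continuous_map (prod_topology \<I> S) T h"
    and "\<And>x. x \<in> topspace S \<Longrightarrow> h (0, x) = f x" "\<And>x. x \<in> topspace S \<Longrightarrow> h (1, x) = g x"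
  shows "homotopic_with (\<lambda>_. True) S T f g"
  using assms by (subst homotopic_with) auto

lemma homotopic_with_cong:
  assumes "homotopic_with (\<lambda>_. True) S T f g"
    and "\<And>x. x \<in> topspace S \<Longrightarrow> f x = f' x" "\<And>x. x \<in> topspace S \<Longrightarrow> g x = g' x"
  shows "homotopic_with (\<lambda>_. True) S T f' g'"
  using homotopic_with_eq[OF assms(1)] assms(2,3) by metis

lemma maps_restrict: "f \<in> maps T X \<Longrightarrow> restrict f (topspace T) = f"
  by (simp add: maps_def extensional_restrict)

lemma induced_map_id: "f \<in> maps T X \<Longrightarrow> induced_map T id f = f"
  by (simp add: induced_map_def maps_restrict)

lemma induced_map_kification: "induced_map (kification T) q = induced_map T q"
  by (simp add: induced_map_def fun_eq_iff)

lemma continuous_map_induced_map: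
  assumes T: "Hausdorff_space T" and q: "continuous_map T' T q"
  shows "continuous_map (mapping_space T X) (mapping_space T' X) (induced_map T' q)"
proof -
  have "continuous_map (mapping_space T X) (mapping_space T' X) (\<lambda>f. \<lambda>t \<in> topspace T'. (\<lambda>(f, t). f (q t)) (f, t))"
  proof (rule continuous_map_into_mapping_space)
    show "kcontinuous (mapping_space T X) T' X (\<lambda>(f, t). f (q t))"
      using kcontinuous_compose_right[OF kcontinuous_eval[OF T] q] by simp
    show "continuous_map T' X (\<lambda>t. (\<lambda>(f, t). f (q t)) (f, t))" if "f \<in> topspace (mapping_space T X)" for f
      using that continuous_map_compose[OF q] by (auto simp: maps_def o_def)
  qed
  then show ?thesis by (rule continuous_map_eq) (simp add: induced_map_def o_def)
qed

text \<open>The time enters the argument at which a map is evaluated, which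
  \<open>kcontinuous_compact_param\<close> admits because the interval is compact.\<close>

lemma homotopic_induced_map:
  assumes T: "Hausdorff_space T" and q: "homotopic_with (\<lambda>_. True) T' T q q'"
  shows "homotopic_with (\<lambda>_. True) (mapping_space T X) (mapping_space T' X) (induced_map T' q) (induced_map T' q')"
proof -
  obtain \<eta> where \<eta>: "continuous_map (prod_topology \<I> T') T \<eta>" "\<And>t. \<eta> (0, t) = q t" "\<And>t. \<eta> (1, t) = q' t"
    using q by (auto simp: homotopic_with_def)
  have "continuous_map (prod_topology \<I> (mapping_space T X)) (mapping_space T' X)
      (\<lambda>z. \<lambda>t \<in> topspace T'. (\<lambda>(z, t). snd z (\<eta> (fst z, t))) (z, t))"
  proof (rule continuous_map_into_mapping_space)
    have I: "compact_space \<I>" by (simp add: compact_space_subtopology)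
    show "kcontinuous (prod_topology \<I> (mapping_space T X)) T' X (\<lambda>(z, t). snd z (\<eta> (fst z, t)))"
      using kcontinuous_compact_param[OF kcontinuous_eval[OF T] I continuous_map_snd continuous_map_fst \<eta>(1)] by simp
    fix z assume z: "z \<in> topspace (prod_topology \<I> (mapping_space T X))"
    then have "continuous_map T' T (\<lambda>t. \<eta> (fst z, t))"
      by (intro continuous_map_compose_Pair[OF \<eta>(1)]) auto
    then show "continuous_map T' X (\<lambda>t. (\<lambda>(z, t). snd z (\<eta> (fst z, t))) (z, t))"
      using z continuous_map_compose[of T' T "\<lambda>t. \<eta> (fst z, t)" X "snd z"] by (auto simp: maps_def o_def)
  qed
  then show ?thesis
    by (rule homotopic_withI) (auto simp: induced_map_def \<eta>(2,3))
qed

text \<open>A map out of the k-space \<open>T'\<close> stays continuous into the finer topology of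
  \<open>kification T\<close>, and so does the composite \<open>j\<close> through \<open>T'\<close>.
  The homotopy to the identity lifts as well, because the product of the interval with a k-space is
  a k-space.\<close>

lemma k_space_homotopy_equivalent_kification:
  assumes "T homotopy_equivalent_space T'" "k_space T'"
  obtains j where "continuous_map T (kification T) j"
    "homotopic_with (\<lambda>_. True) T T j id" "homotopic_with (\<lambda>_. True) (kification T) (kification T) j id"
proof -
  obtain f g where f: "continuous_map T T' f" and g: "continuous_map T' T g"
    and gf: "homotopic_with (\<lambda>_. True) T T (g \<circ> f) id"
    using assms(1) by (auto simp: homotopy_equivalent_space_def)
  have g': "continuous_map T' (kification T) g"
    using g by (simp add: continuous_map_into_kification[OF assms(2)])
  obtain \<eta> where \<eta>: "continuous_map (prod_topology \<I> T) T \<eta>" "\<And>t. \<eta> (0, t) = g (f t)" "\<And>t. \<eta> (1, t) = t"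
    using gf by (auto simp: homotopic_with_def)
  have "continuous_map (prod_topology \<I> (kification T)) T (\<lambda>z. \<eta> (fst z, id (snd z)))"
    by (intro continuous_map_compose_Pair[OF \<eta>(1)] continuous_map_fst
        continuous_map_compose[OF continuous_map_snd, unfolded o_def] continuous_map_from_kification continuous_map_id)
  moreover have "k_space (prod_topology \<I> (kification T))"
    by (rule k_space_prod_topology_left)
      (simp_all add: compact_imp_locally_compact_space compact_space_subtopology Hausdorff_space_subtopology)
  ultimately have "continuous_map (prod_topology \<I> (kification T)) (kification T) (\<lambda>z. \<eta> (fst z, snd z))"
    by (simp add: continuous_map_into_kification)
  then have "homotopic_with (\<lambda>_. True) (kification T) (kification T) (g \<circ> f) id"
    by (rule homotopic_withI) (auto simp: \<eta>)
  then show thesis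
    by (intro that[of "g \<circ> f"] continuous_map_compose[OF f g'] gf)
qed

lemma homotopy_equivalence_map_compose:
  assumes "homotopy_equivalence_map S T f" "homotopy_equivalence_map T U g"
  shows "homotopy_equivalence_map S U (g \<circ> f)"
proof -
  obtain f' where f: "continuous_map S T f" "continuous_map T S f'"
    "homotopic_with (\<lambda>_. True) S S (f' \<circ> f) id" "homotopic_with (\<lambda>_. True) T T (f \<circ> f') id"
    using assms(1) by (auto simp: homotopy_equivalence_map_def)
  obtain g' where g: "continuous_map T U g" "continuous_map U T g'"
    "homotopic_with (\<lambda>_. True) T T (g' \<circ> g) id" "homotopic_with (\<lambda>_. True) U U (g \<circ> g') id"
    using assms(2) by (auto simp: homotopy_equivalence_map_def)
  have "homotopic_with (\<lambda>_. True) S S (f' \<circ> ((g' \<circ> g) \<circ> f)) (f' \<circ> (id \<circ> f))"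
    by (intro homotopic_with_compose_continuous_map_left[OF _ f(2)]
        homotopic_with_compose_continuous_map_right[OF g(3) f(1)]) auto
  then have 1: "homotopic_with (\<lambda>_. True) S S ((f' \<circ> g') \<circ> (g \<circ> f)) id"
    using homotopic_with_trans[OF _ f(3)] by (simp add: o_assoc)
  have "homotopic_with (\<lambda>_. True) U U (g \<circ> ((f \<circ> f') \<circ> g')) (g \<circ> (id \<circ> g'))"
    by (intro homotopic_with_compose_continuous_map_left[OF _ g(1)]
        homotopic_with_compose_continuous_map_right[OF f(4) g(2)]) auto
  then have 2: "homotopic_with (\<lambda>_. True) U U ((g \<circ> f) \<circ> (f' \<circ> g')) id"
    using homotopic_with_trans[OF _ g(4)] by (simp add: o_assoc)
  show ?thesis
    unfolding homotopy_equivalence_map_def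
    using 1 2 continuous_map_compose[OF f(1) g(1)] continuous_map_compose[OF g(2) f(2)] by blast
qed

text \<open>Precomposition with the identity from \<open>kification T\<close> to \<open>T\<close>
  leaves maps unchanged, and precomposition with \<open>j\<close> goes back. Both composites are
  precomposition with \<open>j\<close>, hence homotopic to the identity.\<close>

lemma homotopy_equivalence_mapping_space_kification:
  assumes T: "Hausdorff_space T" and "T homotopy_equivalent_space T'" "k_space T'"
  shows "homotopy_equivalence_map (mapping_space T X) (mapping_space (kification T) X) id"
proof -
  obtain j where j: "continuous_map T (kification T) j"
    "homotopic_with (\<lambda>_. True) T T j id" "homotopic_with (\<lambda>_. True) (kification T) (kification T) j id"
    using k_space_homotopy_equivalent_kification[OF assms(2,3)] .
  note kT = Hausdorff_space_kification[OF T]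
  have "continuous_map (mapping_space T X) (mapping_space (kification T) X) (induced_map (kification T) id)"
    by (intro continuous_map_induced_map[OF T] continuous_map_from_kification continuous_map_id)
  then have "continuous_map (mapping_space T X) (mapping_space (kification T) X) id"
    by (rule continuous_map_eq) (simp add: induced_map_kification induced_map_id)
  moreover have "continuous_map (mapping_space (kification T) X) (mapping_space T X) (induced_map T j)"
    by (rule continuous_map_induced_map[OF kT j(1)])
  moreover have "homotopic_with (\<lambda>_. True) (mapping_space T X) (mapping_space T X) (induced_map T j \<circ> id) id"
    by (rule homotopic_with_cong[OF homotopic_induced_map[OF T j(2)]]) (auto simp: induced_map_id)
  moreover have "homotopic_with (\<lambda>_. True) (mapping_space (kification T) X) (mapping_space (kification T) X)
      (id \<circ> induced_map T j) id"
    by (rule homotopic_with_cong[OF homotopic_induced_map[OF kT j(3)]])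
      (auto simp: induced_map_kification induced_map_id[of _ "kification T", unfolded induced_map_kification])
  ultimately show ?thesis
    unfolding homotopy_equivalence_map_def by blast
qed

lemma path_connected_space_homotopy_equivalent:
  assumes "S homotopy_equivalent_space T" "path_connected_space T"
  shows "path_connected_space S"
proof -
  obtain f g where f: "continuous_map S T f" and g: "continuous_map T S g"
    and gf: "homotopic_with (\<lambda>_. True) S S (g \<circ> f) id"
    using assms(1) by (auto simp: homotopy_equivalent_space_def)
  obtain \<eta> where \<eta>: "continuous_map (prod_topology \<I> S) S \<eta>" "\<And>t. \<eta> (0, t) = g (f t)" "\<And>t. \<eta> (1, t) = t"
    using gf by (auto simp: homotopic_with_def)
  have 1: "path_component_of S (g (f x)) x" if "x \<in> topspace S" for x
    unfolding path_component_of_def pathin_def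
    using that by (intro exI[of _ "\<lambda>t. \<eta> (t, x)"] conjI continuous_map_compose_Pair[OF \<eta>(1)]) (auto simp: \<eta>)
  have "path_component_of S x y" if x: "x \<in> topspace S" and y: "y \<in> topspace S" for x y
  proof -
    have "f x \<in> topspace T" "f y \<in> topspace T" using f x y by (auto simp: continuous_map_def)
    then obtain \<gamma> where "pathin T \<gamma>" "\<gamma> 0 = f x" "\<gamma> 1 = f y"
      using assms(2) by (auto simp: path_connected_space_def)
    then have "path_component_of S (g (f x)) (g (f y))"
      unfolding path_component_of_def pathin_def
      by (intro exI[of _ "g \<circ> \<gamma>"]) (auto intro: continuous_map_compose[OF _ g])
    then show ?thesis
      using 1[OF x] 1[OF y] by (metis path_component_of_sym path_component_of_trans)
  qed
  then show ?thesis
    by (simp add: path_connected_space_def path_component_of_def)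
qed

section \<open>Existence of solutions over a complex and their uniqueness up to homotopy\<close>

context fibration_problem
begin

lemma solution_empty:
  assumes "topspace A = {}"
  shows "solution A f g h"
proof -
  have "topspace (total A f) = {}" using assms by auto
  then show ?thesis
    using assms by (auto simp: solution_def kcontinuous_def continuous_map_def)
qed

lemma solution_exists:
  assumes K: "cw K C" and a: "continuous_map K B a"
    and b: "b \<in> topspace B" and F: "F = subtopology E {e \<in> topspace E. p e = b}"
    and he: "homotopy_equivalence_map X (mapping_space (kification F) X) (constant_map F)"
    and B: "path_connected_space B"
  obtains g h where "solution K a g h"
proof -
  interpret cw K C by fact
  \<comment> \<open>\<open>J = {0}\<close> reduces the cylinder to \<open>K\<close> itself and has
    no ends, so nothing is prescribed.\<close>
  interpret cw_fibration_problem E B p X Y u K C a "{0}"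
    by unfold_locales (use a in auto)
  have "solution (prod_topology K (top_of_set {j \<in> {0 :: real}. \<bar>j\<bar> = 1})) (\<lambda>(k, j). a k) undefined undefined"
    by (rule solution_empty) auto
  from extend_solution_over_complex[OF b F he B this]
  obtain g h where sol: "solution (prod_topology K (top_of_set {0 :: real})) (\<lambda>(k, j). a k) g h" .
  have "continuous_map K (prod_topology K (top_of_set {0})) (\<lambda>k. (k, 0 :: real))"
    by (simp add: continuous_map_pairwise o_def)
  from solution_compose[OF sol this] show thesis
    by (intro that) simp
qed

lemma solutions_homotopic:
  assumes K: "cw K C" and a: "continuous_map K B a"
    and b: "b \<in> topspace B" and F: "F = subtopology E {e \<in> topspace E. p e = b}"
    and he: "homotopy_equivalence_map X (mapping_space (kification F) X) (constant_map F)"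
    and B: "path_connected_space B"
    and sol: "solution K a g0 h0" "solution K a g1 h1"
  obtains g where "kcontinuous Y (prod_topology \<I> K) X g"
    "\<And>y k. y \<in> topspace Y \<Longrightarrow> k \<in> topspace K \<Longrightarrow> g (y, 0, k) = g0 (y, k)"
    "\<And>y k. y \<in> topspace Y \<Longrightarrow> k \<in> topspace K \<Longrightarrow> g (y, 1, k) = g1 (y, k)"
proof -
  interpret cw K C by fact
  interpret cw_fibration_problem E B p X Y u K C a "{-1..1}"
    by unfold_locales (use a in \<open>auto simp: field_simps abs_le_iff\<close>)
  \<comment> \<open>\<open>?J0\<close> is \<open>{-1, 1}\<close>: the two given solutions sit at the
    two ends, told apart by the sign of \<open>j\<close>.\<close>
  let ?J0 = "{j \<in> {-1..1}. \<bar>j :: real\<bar> = 1}"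
  let ?A = "prod_topology K (top_of_set ?J0)"
  define gg where "gg = (\<lambda>(y, k, j :: real). if j \<le> 0 then g0 (y, k) else g1 (y, k))"
  define hh where "hh = (\<lambda>(y, s, (k, j :: real), e). if j \<le> 0 then h0 (y, s, k, e) else h1 (y, s, k, e))"
  have snd: "continuous_map ?A euclideanreal snd"
    using continuous_map_snd[of K "top_of_set ?J0"] by (simp add: continuous_map_into_top_of_set)
  have aA: "continuous_map ?A B (\<lambda>(k, j). a k)"
    using continuous_map_compose[OF continuous_map_fst a] by (simp add: o_def case_prod_unfold)
  have "solution ?A (\<lambda>(k, j). a k) gg hh"
  proof (rule solution_closed_cover[OF aA])
    show "closedin ?A {z \<in> topspace ?A. snd z \<in> {..0}}" "closedin ?A {z \<in> topspace ?A. snd z \<in> {0..}}"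
      by (rule closedin_continuous_map_preimage[OF snd], simp)+
    show "solution (subtopology ?A {z \<in> topspace ?A. snd z \<in> {..0}}) (\<lambda>(k, j). a k) gg hh"
      by (rule solution_cong[OF solution_compose[OF sol(1) continuous_map_from_subtopology[OF continuous_map_fst]]])
        (auto simp: gg_def hh_def)
    show "solution (subtopology ?A {z \<in> topspace ?A. snd z \<in> {0..}}) (\<lambda>(k, j). a k) gg hh"
      by (rule solution_cong[OF solution_compose[OF sol(2) continuous_map_from_subtopology[OF continuous_map_fst]]])
        (auto simp: gg_def hh_def)
  qed auto
  from extend_solution_over_complex[OF b F he B this]
  obtain g h where sol: "solution (prod_topology K (top_of_set {-1..1})) (\<lambda>(k, j). a k) g h"
    and pre: "prescribed gg hh g h" .
  have "continuous_map (prod_topology \<I> K) euclideanreal (\<lambda>z. 2 * fst z - 1)"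
    using continuous_map_fst[of \<I> K] by (intro continuous_map_real_intros) (auto simp: continuous_map_into_top_of_set)
  then have "continuous_map (prod_topology \<I> K) (prod_topology K (top_of_set {-1..1})) (\<lambda>z. (snd z, 2 * fst z - 1))"
    by (auto simp: continuous_map_pairwise o_def continuous_map_snd continuous_map_into_top_of_set)
  then have "kcontinuous Y (prod_topology \<I> K) X (\<lambda>(y, z). g (y, snd z, 2 * fst z - 1))"
    using sol by (intro kcontinuous_compose_right) (auto simp: solution_def)
  then show thesis
    by (rule that) (use pre in \<open>auto simp: prescribed_def gg_def\<close>)
qed

end

theorem proposition3p1p1:
  fixes E :: "'e topology" and B :: "'b topology" and F :: "'e topology" and X :: "'x topology"
    and p :: "'e \<Rightarrow> 'b" and b :: 'b
    and K :: "'k topology" and E' :: "'c topology" and F' :: "'d topology"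
  assumes "Hausdorff_space E" and "Hausdorff_space B" and "Hausdorff_space X"
    and "Hurewicz_fibration E B p"
    and "b \<in> topspace B" and "F = subtopology E {e \<in> topspace E. p e = b}"
    and "CW_complex K" and "connected_space K" and "B homotopy_equivalent_space K"
    and "k_space E'" and "Hausdorff_space E'" and "E homotopy_equivalent_space E'"
    and "k_space F'" and "Hausdorff_space F'" and "F homotopy_equivalent_space F'"
    and "homotopy_equivalence_map X (mapping_space F X) (constant_map F)"
  shows "homotopy_equivalence_map (mapping_space B X) (mapping_space E X) (induced_map E p)"
proof -
  note HE = assms(1) and HB = assms(2) and fib = assms(4) and b = assms(5) and F = assms(6)
  obtain C where C: "cw K C"
    using assms(7) by (auto simp: CW_complex_def cw_def)
  interpret cw K C by fact
  have kK: "kification K = K" using k_space kification_eq_self by blast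
  have B: "path_connected_space B"
    by (rule path_connected_space_homotopy_equivalent[OF assms(9) path_connected[OF assms(8)]])
  have HF: "Hausdorff_space F" unfolding F by (rule Hausdorff_space_subtopology[OF HE])
  \<comment> \<open>The construction over cells works with the k-ification of \<open>F\<close>; the
    identity from X^F to X^(kF) is a homotopy equivalence, so the hypothesis carries over.\<close>
  have he: "homotopy_equivalence_map X (mapping_space (kification F) X) (constant_map F)"
    using homotopy_equivalence_map_compose[OF assms(16)
        homotopy_equivalence_mapping_space_kification[OF HF assms(15,13)]] by simp
  have p: "continuous_map E B p" using fib by (simp add: Hurewicz_fibration_def)
  have pB: "p e \<in> topspace B" if "e \<in> topspace E" for e
    using p that by (auto simp: continuous_map_def)
  obtain \<zeta> a where \<zeta>: "continuous_map B K \<zeta>" and a: "continuous_map K B a"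
    and a\<zeta>: "homotopic_with (\<lambda>_. True) B B (a \<circ> \<zeta>) id"
    using assms(9) by (auto simp: homotopy_equivalent_space_def)
  let ?XB = "mapping_space B X" and ?XE = "mapping_space E X" and ?XK = "mapping_space K X"
  let ?p = "induced_map E p"
  have cp: "continuous_map ?XB ?XE ?p" by (rule continuous_map_induced_map[OF HB p])
  have pin: "?p f \<in> maps E X" if "f \<in> maps B X" for f
    using cp that by (auto simp: continuous_map_def)
  interpret PE: fibration_problem E B p X ?XE "\<lambda>(f, e). f e"
    by unfold_locales (use fib HE HB kcontinuous_eval[OF HE] in auto)
  interpret PB: fibration_problem E B p X ?XB "\<lambda>(f, e). f (p e)"
    by unfold_locales (use fib HE HB kcontinuous_compose_right[OF kcontinuous_eval[OF HB] p] in auto)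
  obtain g h where sol: "PE.solution K a g h"
    using PE.solution_exists[OF C a b F he B] .
  \<comment> \<open>The parameters are all maps on \<open>E\<close>, so the first component of the
    solution assigns to each of them a map on \<open>K\<close>. As \<open>K\<close> is its own
    k-ification, this is continuous from X^E to X^K.\<close>
  define rK where "rK = (\<lambda>f. \<lambda>k \<in> topspace K. g (f, k))"
  have "kcontinuous ?XE K X g"
    using sol by (simp add: PE.solution_def)
  from continuous_map_into_mapping_space_kification[OF this]
  have rK: "continuous_map ?XE ?XK rK"
    by (simp add: rK_def kK)
  have c\<zeta>: "continuous_map ?XK ?XB (induced_map B \<zeta>)"
    by (rule continuous_map_induced_map[OF Hausdorff \<zeta>])
  define r where "r = induced_map B \<zeta> \<circ> rK"
  have r: "continuous_map ?XE ?XB r"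
    unfolding r_def by (rule continuous_map_compose[OF rK c\<zeta>])
  have \<zeta>K: "\<zeta> x \<in> topspace K" if "x \<in> topspace B" for x
    using \<zeta> that by (auto simp: continuous_map_def)
  have I: "compact_space \<I>" by (simp add: compact_space_subtopology)

  have right: "homotopic_with (\<lambda>_. True) ?XE ?XE (?p \<circ> r) id"
  proof -
    obtain \<Phi> where \<Phi>: "continuous_map (prod_topology \<I> B) B \<Phi>" "\<And>x. \<Phi> (0, x) = x" "\<And>x. \<Phi> (1, x) = a (\<zeta> x)"
      using homotopic_with_symD[OF a\<zeta>] by (auto simp: homotopic_with_def)
    \<comment> \<open>\<open>g\<close> pulled back along \<zeta> solves the problem over
      \<open>a\<close> after \<zeta>. Transport along the homotopy to the identity gives a solution
      over \<open>B\<close> itself, with the same first component; no values have to be kept, so the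
      length is 1 throughout.\<close>
    have "PE.solution B (\<lambda>x. \<Phi> (1, x)) (\<lambda>(f, x). g (f, \<zeta> x)) (\<lambda>(f, s, x, e). h (f, s, \<zeta> x, e))"
      using PE.solution_compose[OF sol \<zeta>] by (simp add: \<Phi>)
    then obtain h' where h': "PE.solution B (\<lambda>x. \<Phi> (0, x)) (\<lambda>(f, x). g (f, \<zeta> x)) h'"
      using PE.solution_transport[OF \<Phi>(1), of "\<lambda>_. 1"] by auto
    have eqs: "h' (f, 0, p e, e) = g (f, \<zeta> (p e))" "h' (f, 1, p e, e) = f e"
      if "f \<in> maps E X" "e \<in> topspace E" for f e
      using h' that pB by (auto simp: PE.solution_def \<Phi>)
    have kh': "kcontinuous ?XE (prod_topology \<I> (PE.total B (\<lambda>x. \<Phi> (0, x)))) X h'"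
      using h' by (simp add: PE.solution_def)
    \<comment> \<open>\<open>E\<close> embeds into the pullback along the identity of
      \<open>B\<close> as the graph of \<open>p\<close>; on it \<open>h'\<close> becomes a homotopy
      of maps on \<open>E\<close>.\<close>
    have "continuous_map (prod_topology \<I> E) (prod_topology \<I> (PE.total B (\<lambda>x. \<Phi> (0, x)))) (\<lambda>z. (fst z, p (snd z), snd z))"
      unfolding continuous_map_pairwise[of _ \<I>] o_def fst_conv snd_conv
      by (intro conjI PE.continuous_map_into_total continuous_map_fst continuous_map_snd
          continuous_map_compose[OF continuous_map_snd p, unfolded o_def]) (simp add: \<Phi>)
    from kcontinuous_compact_param[OF kh' I continuous_map_snd continuous_map_fst this]
    have "kcontinuous (prod_topology \<I> ?XE) E X (\<lambda>(z, e). h' (snd z, fst z, p e, e))"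
      by simp
    from continuous_map_into_mapping_space_kification[OF this]
    \<comment> \<open>Gluing over compact sets yields this homotopy in X^(kE) only.\<close>
    have H: "homotopic_with (\<lambda>_. True) ?XE (mapping_space (kification E) X) (?p \<circ> r) id"
      by (rule homotopic_withI)
        (auto simp: induced_map_def r_def rK_def eqs \<zeta>K pB fun_eq_iff maps_restrict intro!: restrict_ext
          dest: maps_restrict[symmetric] cong: restrict_cong)
    obtain j where j: "continuous_map E (kification E) j" "homotopic_with (\<lambda>_. True) E E j id"
      using k_space_homotopy_equivalent_kification[OF assms(12,10)] .
    have jE: "homotopic_with (\<lambda>_. True) ?XE ?XE (induced_map E j) id"
      by (rule homotopic_with_cong[OF homotopic_induced_map[OF HE j(2)]]) (auto simp: induced_map_id)
    \<comment> \<open>Precomposition with \<open>j\<close> carries the homotopy from X^(kE) to X^E.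
      As a self-map of X^E it is homotopic to the identity by \<open>jE\<close>, which corrects both
      ends.\<close>
    have "homotopic_with (\<lambda>_. True) ?XE ?XE (induced_map E j \<circ> (?p \<circ> r)) (induced_map E j \<circ> id)"
      by (rule homotopic_with_compose_continuous_map_left[OF H
            continuous_map_induced_map[OF Hausdorff_space_kification[OF HE] j(1)]]) simp
    moreover have "homotopic_with (\<lambda>_. True) ?XE ?XE (induced_map E j \<circ> (?p \<circ> r)) (id \<circ> (?p \<circ> r))"
      by (rule homotopic_with_compose_continuous_map_right[OF jE continuous_map_compose[OF r cp]]) simp
    ultimately show ?thesis
      using jE homotopic_with_symD homotopic_with_trans by (metis comp_id id_comp)
  qed

  have left: "homotopic_with (\<lambda>_. True) ?XB ?XB (r \<circ> ?p) id"
  proof -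
    \<comment> \<open>The family of all \<open>f\<close> composed with \<open>p\<close> has two
      solutions over \<open>K\<close>: the universal one restricted to these maps, and the evident
      one, \<open>f\<close> composed with \<open>a\<close> together with a constant homotopy.
      Uniqueness up to homotopy compares them.\<close>
    have "PB.solution K a (\<lambda>(f, k). g (?p f, k)) (\<lambda>(f, z). h (?p f, z))"
      unfolding PB.solution_def
    proof (intro conjI ballI impI)
      show "kcontinuous ?XB K X (\<lambda>(f, k). g (?p f, k))"
        "kcontinuous ?XB (prod_topology \<I> (PB.total K a)) X (\<lambda>(f, z). h (?p f, z))"
        using sol by (auto simp: PE.solution_def intro: kcontinuous_compose_left[OF _ cp])
      fix f k e assume *: "f \<in> topspace ?XB" "k \<in> topspace K" "e \<in> topspace E" "a k = p e"
      then have "?p f \<in> topspace ?XE" using pin by simp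
      then have "h (?p f, 0, k, e) = g (?p f, k)" "h (?p f, 1, k, e) = ?p f e"
        using sol * by (auto simp: PE.solution_def)
      moreover have "?p f e = f (p e)" using * by (simp add: induced_map_def)
      ultimately show "(\<lambda>(f, z). h (?p f, z)) (f, 0, k, e) = (\<lambda>(f, k). g (?p f, k)) (f, k)"
        "(\<lambda>(f, z). h (?p f, z)) (f, 1, k, e) = (\<lambda>(f, e). f (p e)) (f, e)" by simp_all
    qed (rule a)
    moreover have "PB.solution K a (\<lambda>(f, k). f (a k)) (\<lambda>(f, s, k, e). f (a k))"
    proof -
      have "continuous_map (prod_topology \<I> (PB.total K a)) B (\<lambda>z. a (fst (snd z)))"
        using continuous_map_compose[OF PB.continuous_map_total(1)[OF continuous_map_snd] a] by (simp add: o_def)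
      from kcontinuous_compose_right[OF kcontinuous_eval[OF HB] this]
        kcontinuous_compose_right[OF kcontinuous_eval[OF HB] a]
      show ?thesis unfolding PB.solution_def using a by (auto simp: case_prod_unfold)
    qed
    ultimately obtain gg where gg: "kcontinuous ?XB (prod_topology \<I> K) X gg"
      and gg01: "\<And>f k. f \<in> topspace ?XB \<Longrightarrow> k \<in> topspace K \<Longrightarrow> gg (f, 0, k) = g (?p f, k)"
        "\<And>f k. f \<in> topspace ?XB \<Longrightarrow> k \<in> topspace K \<Longrightarrow> gg (f, 1, k) = f (a k)"
      by (rule PB.solutions_homotopic[OF C a b F he B]) auto
    have "kcontinuous (prod_topology \<I> ?XB) K X (\<lambda>(z, k). gg (snd z, fst z, k))"
      using kcontinuous_compact_param[OF gg I continuous_map_snd continuous_map_fst continuous_map_id] by simp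
    from continuous_map_into_mapping_space_kification[OF this]
    have "homotopic_with (\<lambda>_. True) ?XB ?XK (rK \<circ> ?p) (induced_map K a)"
      unfolding kK
      by (rule homotopic_withI) (auto simp: rK_def induced_map_def gg01 intro!: restrict_ext)
    from homotopic_with_compose_continuous_map_left[OF this c\<zeta>, of "\<lambda>_. True"]
    have "homotopic_with (\<lambda>_. True) ?XB ?XB (r \<circ> ?p) (induced_map B \<zeta> \<circ> induced_map K a)"
      by (simp add: r_def o_assoc)
    moreover have "homotopic_with (\<lambda>_. True) ?XB ?XB (induced_map B \<zeta> \<circ> induced_map K a) id"
      by (rule homotopic_with_cong[OF homotopic_induced_map[OF HB a\<zeta>]])
        (auto simp: induced_map_id, auto simp: induced_map_def \<zeta>K)
    ultimately show ?thesis by (rule homotopic_with_trans)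
  qed

  show ?thesis
    unfolding homotopy_equivalence_map_def using cp r left right by blast
qed

end
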